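(* Let $f(z,w,t)=1+z+w+t$ and set $\gamma_1=(-1/2,-1/2,0)$, $\gamma_2=(-1,0,-1/2,-1/2)$, $$B_1=(-1,-1,1,1)^{tr},\qquad B_2=\left(\begin{array}{cccccc}-1&1&0&-1&1&0\\0&1&-1&-1&0&1\end{array}\right)^{tr}.$$ Then for $(x,y,u)\in\mathcal{A}_f\setminus\mathcal{C}$ the second order derivatives of the Ronkin function $N_f$ can be expressed in terms of $A$-hypergeometric functions as \begin{align*} \frac{\partial^2 N_f}{\partial x^2}&=g\,e^{2x}\,\Phi(1,1,1,k^2),\\ \frac{\partial^2 N_f}{\partial x\,\partial y}&=-\frac{g}{4}\left(Q_1\Phi(1,1,1,k^2)+Q_2\tilde\Phi(1,1,1,1,\alpha_1^2,k^2)+Q_3\tilde\Phi(1,1,1,1,\alpha_2^2,k^2)\right), \end{align*} where $\Phi$ is taken with parameter $\gamma_1$ and matrix $B_1$, $\tilde\Phi$ is taken with parameter $\gamma_2$ and matrix $B_2$, and $g,k^2,\alpha_1^2,\alpha_2^2,Q_1,Q_2,Q_3$ are the chamber-dependent functions of $(x,y,u)$ given in the context.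
   Context: Write $\mathrm{Log}:(\mathbb{C}^* )^3\to\mathbb{R}^3$, $\mathrm{Log}(z,w,t)=(\log|z|,\log|w|,\log|t|)$. The amoeba of $f$ is $\mathcal{A}_f=\mathrm{Log}(f^{-1}(0))$, where $f^{-1}(0)\subset(\mathbb{C}^* )^3$. The Ronkin function is $$N_f(x,y,u)=\left(\frac{1}{2\pi i}\right)^3\int_{\mathrm{Log}^{-1}(x,y,u)}\log|f(z,w,t)|\,\frac{dz\,dw\,dt}{zwt}.$$ The contour $\mathcal{C}$ is the set of critical values of $\mathrm{Log}$ restricted to $f^{-1}(0)$; here it is the set of $(x,y,u)\in\mathbb{R}^3$ satisfying at least one of $1+e^x=e^y+e^u$, $1+e^y=e^x+e^u$, $1+e^u=e^x+e^y$, $e^x=1+e^y+e^u$, $e^y=1+e^x+e^u$, $e^u=1+e^x+e^y$, $1=e^x+e^y+e^u$. A point of $\mathcal{A}_f\setminus\mathcal{C}$ belongs to the chamber $(\epsilon_1,\epsilon_2,\epsilon_3)\in\{+,-\}^3$, where $\epsilon_1,\epsilon_2,\epsilon_3$ are the signs of $1+e^x-e^y-e^u$, $1+e^y-e^x-e^u$, $1+e^u-e^x-e^y$. Hypergeometric series. Given an integer $N\times(N-n)$ matrix $B$ with rows $B_{(1)},\dots,B_{(N)}$ (the last $N-n$ rows forming the identity matrix) and $\gamma\in\mathbb{C}^n$ (extended by $\gamma_{n+1}=\dots=\gamma_N=0$), for $a=(a_1,\dots,a_N)$ put $a^{\gamma+\langle B,\kappa\rangle}=\prod_{j=1}^N a_j^{\gamma_j+\langle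 B_{(j)},\kappa\rangle}$ and $$\Phi(a)=\sum_{\kappa\in\mathbb{Z}^{N-n}}\frac{a^{\gamma+\langle B,\kappa\rangle}}{\prod_{j=1}^n\Gamma(\gamma_j+\langle B_{(j)},\kappa\rangle+1)\,\kappa!},$$ $$\tilde\Phi(a)=\sum_{\kappa\in\mathbb{Z}^{N-n}}\frac{(-1)^{\langle B_{(1)},\kappa\rangle}\,\Gamma(-\gamma_1-\langle B_{(1)},\kappa\rangle)\,a^{\gamma+\langle B,\kappa\rangle}}{\prod_{j=2}^n\Gamma(\gamma_j+\langle B_{(j)},\kappa\rangle+1)\,\kappa!},$$ where $\kappa!=\prod_i\kappa_i!$, $1/\Gamma$ is zero at nonpositive integers, and terms with some $\kappa_i<0$ are zero (the factor $1/\kappa!$ vanishes; in $\tilde\Phi$ singularities are removed by regarding the series as meromorphic in the parameter). Explicitly, for the parameters in the claim, $$\Phi(1,1,1,z)=\sum_{m\ge0}\frac{z^m}{\Gamma(\frac12-m)^2\,\Gamma(1+m)\,m!},$$ $$\tilde\Phi(1,1,1,1,z_1,z_2)=\sum_{m,l\ge0}\frac{(-1)^m\,\Gamma(1+m)\,z_1^m z_2^l}{\Gamma(1+m+l)\,\Gamma(\frac12-l)\,\Gamma(\frac12-m-l)\,m!\,l!}.$$ The functions $g,k^2,\alpha_i^2,Q_i$. Let $\xi=(1+e^x+e^y-e^u)(1+e^x-e^y+e^u)(1-e^x+e^y+e^u)(-1+e^x+e^y+e^u)$. In chambers $(+,+,+)$ and $(+,-,-)$: $g=\frac{1}{2\sqrt{e^{x+y+u}}}$,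 $k^2=\frac{\xi}{16e^{x+y+u}}$, $Q_1=2\frac{e^y(e^{2x}+e^{2y}+e^{2u}-1-2e^{y+u})}{e^y-e^u}$, $Q_2=(1-e^x+e^y-e^u)(1-e^x-e^y+e^u)$, $Q_3=\frac{(e^u+e^y)(1-e^x+e^y-e^u)(1+e^x)(1-e^x-e^y+e^u)}{(e^u-e^y)(e^x-1)}$, $\alpha_1^2=\frac{(1-e^x+e^y+e^u)(-1+e^x+e^y+e^u)}{4e^{y+u}}$, $\alpha_2^2=\alpha_1^2\frac{(e^y-e^u)^2}{(1-e^x)^2}$. In chambers $(-,+,+)$ and $(-,-,-)$: $g=\frac{2}{\sqrt{\xi}}$, $k^2=\frac{16e^{x+y+u}}{\xi}$, $Q_1=2\frac{e^y(e^{2x}+e^{2y}+e^{2u}-1-2e^{y+u})}{e^y-e^u}$, $Q_2=(1-e^x+e^y-e^u)(1-e^x-e^y+e^u)$, $Q_3=\frac{(e^u+e^y)(1-e^x+e^y-e^u)(1+e^x)(1-e^x-e^y+e^u)}{(e^u-e^y)(e^x-1)}$, $\alpha_1^2=\frac{4e^x}{(1+e^x+e^y-e^u)(1+e^x-e^y+e^u)}$, $\alpha_2^2=\alpha_1^2\frac{(e^y-e^u)^2}{(1-e^x)^2}$. In chambers $(-,-,+)$ and $(-,+,-)$: $g=\frac{1}{2\sqrt{e^{x+y+u}}}$, $k^2=\frac{\xi}{16e^{x+y+u}}$, $Q_1=2\frac{e^x(e^{2x}+e^{2y}-e^{2u}+1-2e^{x})}{e^x-1}$, $Q_2=-(1-e^x+e^y-e^u)(1-e^x-e^y+e^u)$,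 $Q_3=-\frac{(e^u+e^y)(1-e^x+e^y-e^u)(1+e^x)(1-e^x-e^y+e^u)}{(e^u-e^y)(e^x-1)}$, $\alpha_1^2=\frac{(1+e^x-e^y+e^u)(1+e^x+e^y-e^u)}{4e^{x}}$, $\alpha_2^2=\alpha_1^2\frac{(e^x-1)^2}{(e^y-e^u)^2}$. In chambers $(+,-,+)$ and $(+,+,-)$: $g=\frac{2}{\sqrt{\xi}}$, $k^2=\frac{16e^{x+y+u}}{\xi}$, $Q_1=-2\frac{e^x(e^{2x}+e^{2y}-e^{2u}+1-2e^{x})}{1-e^x}$, $Q_2=-(1-e^x+e^y-e^u)(1-e^x-e^y+e^u)$, $Q_3=-\frac{(e^u+e^y)(1-e^x+e^y-e^u)(1+e^x)(1-e^x-e^y+e^u)}{(e^u-e^y)(e^x-1)}$, $\alpha_1^2=\frac{4e^{y+u}}{(1-e^x+e^y+e^u)(-1+e^x+e^y+e^u)}$, $\alpha_2^2=\alpha_1^2\frac{(1-e^x)^2}{(e^y-e^u)^2}$. At points of a chamber where $e^x-1$ or $e^y-e^u$ vanishes in a denominator, the apparent singularity is removable and the right-hand side is understood as its continuous extension. *)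

theory Defs
  imports "HOL-Analysis.Analysis"
begin

section \<open>Amoeba, contour and Ronkin function in three variables\<close>

definition Log3 :: "complex \<times> complex \<times> complex \<Rightarrow> real \<times> real \<times> real" where
  "Log3 = (\<lambda>(z, w, t). (ln (cmod z), ln (cmod w), ln (cmod t)))"

definition zero_locus :: "(complex \<times> complex \<times> complex \<Rightarrow> complex) \<Rightarrow> (complex \<times> complex \<times> complex) set" where
  "zero_locus f = {(z, w, t). z \<noteq> 0 \<and> w \<noteq> 0 \<and> t \<noteq> 0 \<and> f (z, w, t) = 0}"

definition amoeba :: "(complex \<times> complex \<times> complex \<Rightarrow> complex) \<Rightarrow> (real \<times> real \<times> real) set" where
  "amoeba f = Log3 ` zero_locus f"

text \<open>
  The contour is the set of critical values of the restriction of \<^term>\<open>Log3\<close> to the zero locus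
  \<open>V\<close> of \<open>f\<close>. It is assumed that the derivative of \<open>f\<close> does not vanish on \<open>V\<close>, so that its kernel
  is the tangent space of \<open>V\<close>; a point of \<open>V\<close> is critical if the real derivative of
  \<^term>\<open>Log3\<close> does not map that tangent space onto the whole of three-space.
\<close>
definition contour :: "(complex \<times> complex \<times> complex \<Rightarrow> complex) \<Rightarrow> (real \<times> real \<times> real) set" where
  "contour f = Log3 ` {p \<in> zero_locus f.
     frechet_derivative Log3 (at p) ` {v. frechet_derivative f (at p) v = 0} \<noteq> UNIV}"

subsection \<open>The contour of \<open>1 + z + w + t\<close>\<close>

lemma has_derivative_ln_cmod:
  assumes "z \<noteq> 0"
  shows "((\<lambda>z. ln (cmod z)) has_derivative (\<lambda>v. Re (v / z))) (at z)"
proof -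
  have "(cmod has_derivative (\<lambda>v. sgn z \<bullet> v)) (at z)"
    using has_derivative_norm[OF assms] by (simp add: inner_commute)
  then have "((\<lambda>z. ln (cmod z)) has_derivative (\<lambda>v. (1 / cmod z) * (sgn z \<bullet> v))) (at z)"
    using assms by (auto intro!: derivative_eq_intros simp: divide_inverse mult.commute)
  moreover have "(1 / cmod z) * (sgn z \<bullet> v) = Re (v / z)" for v
  proof -
    have "(1 / cmod z) * (sgn z \<bullet> v) = (z \<bullet> v) / (cmod z)\<^sup>2"
      by (simp add: sgn_div_norm divide_inverse power2_eq_square)
    also have "\<dots> = Re (v / z)"
      by (simp add: inner_complex_def Re_divide cmod_power2 mult.commute)
    finally show ?thesis .
  qed
  ultimately show ?thesis by simp
qed

lemma frechet_derivative_Log3: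
  assumes "z \<noteq> 0" "w \<noteq> 0" "t \<noteq> 0"
  shows "frechet_derivative Log3 (at (z, w, t)) = (\<lambda>(a, b, c). (Re (a / z), Re (b / w), Re (c / t)))"
proof -
  have eq: "Log3 = (\<lambda>p. (ln (cmod (fst p)), ln (cmod (fst (snd p))), ln (cmod (snd (snd p)))))"
    by (auto simp: Log3_def)
  have d: "((\<lambda>p. ln (cmod (\<pi> p))) has_derivative (\<lambda>v. Re (\<pi> v / \<pi> (z, w, t)))) (at (z, w, t))"
    if "bounded_linear \<pi>" "\<pi> (z, w, t) \<noteq> 0" for \<pi> :: "complex \<times> complex \<times> complex \<Rightarrow> complex"
    by (rule has_derivative_compose[OF bounded_linear_imp_has_derivative[OF that(1)] has_derivative_ln_cmod[OF that(2)]])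
  have "(Log3 has_derivative (\<lambda>p. (Re (fst p / z), Re (fst (snd p) / w), Re (snd (snd p) / t)))) (at (z, w, t))"
    unfolding eq
    using d[of fst] d[of "\<lambda>p. fst (snd p)"] d[of "\<lambda>p. snd (snd p)"] assms
    by (intro has_derivative_Pair)
      (simp_all add: bounded_linear_fst bounded_linear_snd bounded_linear_fst_comp bounded_linear_snd_comp)
  from frechet_derivative_at[OF this] show ?thesis
    by (auto simp: case_prod_unfold)
qed

lemma frechet_derivative_linear_polynomial:
  "frechet_derivative (\<lambda>(z, w, t). 1 + z + w + t) (at p) = (\<lambda>(a, b, c). a + b + (c::complex))"
proof -
  have "((\<lambda>p::complex\<times>complex\<times>complex. 1 + fst p + fst (snd p) + snd (snd p)) has_derivative
      (\<lambda>p. fst p + fst (snd p) + snd (snd p))) (at p)"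
    by (auto intro!: derivative_eq_intros)
  from frechet_derivative_at[OF this] show ?thesis
    by (simp add: case_prod_unfold)
qed

lemma real_combination:
  assumes "Im (w * cnj z) \<noteq> 0"
  shows "\<exists>p q. c = of_real p * z + of_real q * w"
proof -
  define d where "d = Re z * Im w - Im z * Re w"
  have d: "d \<noteq> 0" using assms by (simp add: d_def algebra_simps)
  have re: "((Re c * Im w - Im c * Re w) * Re z + (Re z * Im c - Im z * Re c) * Re w) / d = Re c"
    using d by (simp add: nonzero_divide_eq_eq) (simp add: d_def algebra_simps)
  have im: "((Re c * Im w - Im c * Re w) * Im z + (Re z * Im c - Im z * Re c) * Im w) / d = Im c"
    using d by (simp add: nonzero_divide_eq_eq) (simp add: d_def algebra_simps)
  show ?thesis
    by (intro exI[of _ "(Re c * Im w - Im c * Re w) / d"] exI[of _ "(Re z * Im c - Im z * Re c) / d"])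
      (use re im in \<open>simp add: complex_eq_iff add_divide_distrib\<close>)
qed

lemma real_span:
  assumes "1 + z + w + t = 0" "Im z \<noteq> 0 \<or> Im w \<noteq> 0 \<or> Im t \<noteq> 0"
  shows "\<exists>p q r. c = of_real p * z + of_real q * w + of_real r * (t::complex)"
proof -
  have t: "t = - 1 - z - w" using assms(1) by (simp add: algebra_simps eq_neg_iff_add_eq_0)
  have "Im (w * cnj z) \<noteq> 0 \<or> Im (t * cnj z) \<noteq> 0 \<or> Im (t * cnj w) \<noteq> 0"
  proof (rule ccontr)
    assume "\<not> ?thesis"
    then have "Im z = 0" "Im w = 0" by (auto simp: t algebra_simps)
    with assms t show False by auto
  qed
  then consider "Im (w * cnj z) \<noteq> 0" | "Im (t * cnj z) \<noteq> 0" | "Im (t * cnj w) \<noteq> 0" by blast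
  then show ?thesis
  proof cases
    case 1
    then obtain p q where "c = of_real p * z + of_real q * w" using real_combination by blast
    then show ?thesis by (intro exI[of _ p] exI[of _ q] exI[of _ 0]) simp
  next
    case 2
    then obtain p q where "c = of_real p * z + of_real q * t" using real_combination by blast
    then show ?thesis by (intro exI[of _ p] exI[of _ 0] exI[of _ q]) simp
  next
    case 3
    then obtain p q where "c = of_real p * w + of_real q * t" using real_combination by blast
    then show ?thesis by (intro exI[of _ 0] exI[of _ p] exI[of _ q]) simp
  qed
qed

lemma critical_iff_real:
  assumes "z \<noteq> 0" "w \<noteq> 0" "t \<noteq> 0" "1 + z + w + t = 0"
  shows "(\<lambda>(a, b, c). (Re (a / z), Re (b / w), Re (c / t))) ` {(a, b, c). a + b + c = 0} \<noteq> UNIV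
         \<longleftrightarrow> Im z = 0 \<and> Im w = 0 \<and> Im t = 0" (is "?L ` ?K \<noteq> _ \<longleftrightarrow> ?R")
proof
  show ?R if "?L ` ?K \<noteq> UNIV"
  proof (rule ccontr)
    assume nr: "\<not> ?R"
    have "(a, b, c) \<in> ?L ` ?K" for a b c
    proof -
      obtain p q r where pqr: "\<i> * (of_real a * z + of_real b * w + of_real c * t) =
          of_real p * z + of_real q * w + of_real r * t"
        using real_span[OF assms(4)] nr by blast
      define v where "v = (z * Complex a p, w * Complex b q, t * Complex c r)"
      have "z * Complex a p + w * Complex b q + t * Complex c r
          = (of_real a * z + of_real b * w + of_real c * t) + \<i> * (of_real p * z + of_real q * w + of_real r * t)"
        by (simp add: Complex_eq algebra_simps)
      also have "\<dots> = 0" by (simp flip: pqr mult.assoc)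
      finally have "v \<in> ?K" by (simp add: v_def)
      moreover have "(a, b, c) = ?L v" using assms(1-3) by (simp add: v_def)
      ultimately show ?thesis by (rule rev_image_eqI)
    qed
    then have "?L ` ?K = UNIV" by (intro UNIV_eq_I[symmetric]) (simp only: split_paired_all)
    with that show False by contradiction
  qed
next
  assume r: ?R
  define a b c where "a = Re z" "b = Re w" "c = Re t"
  with r have abc: "z = of_real a" "w = of_real b" "t = of_real c"
    by (simp_all add: complex_eq_iff)
  have "(a, 0, 0) \<notin> ?L ` ?K"
  proof
    assume "(a, 0, 0) \<in> ?L ` ?K"
    then obtain v1 v2 v3 where v: "v1 + v2 + v3 = 0" "a = Re (v1 / z)" "Re (v2 / w) = 0" "Re (v3 / t) = 0"
      by auto
    have "Re v1 = a * a" "Re v2 = 0" "Re v3 = 0"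
      using v(2-4) assms(1-3) unfolding abc by (simp_all add: Re_divide_of_real field_simps)
    moreover have "Re v1 + Re v2 + Re v3 = 0" using arg_cong[OF v(1), of Re] by simp
    ultimately show False using abc assms(1) by simp
  qed
  then show "?L ` ?K \<noteq> UNIV" by blast
qed

lemma contour_linear_polynomial:
  "(x, y, u) \<in> contour (\<lambda>(z, w, t). 1 + z + w + t) \<longleftrightarrow>
     1 + exp x = exp y + exp u \<or> 1 + exp y = exp x + exp u \<or> 1 + exp u = exp x + exp y \<or>
     exp x = 1 + exp y + exp u \<or> exp y = 1 + exp x + exp u \<or> exp u = 1 + exp x + exp y \<or>
     1 = exp x + exp y + exp u" (is "?C \<longleftrightarrow> ?E")
proof -
  have "?C \<longleftrightarrow> (\<exists>z w t. z \<noteq> 0 \<and> w \<noteq> 0 \<and> t \<noteq> 0 \<and> 1 + z + w + t = 0 \<and> Im z = 0 \<and> Im w = 0 \<and> Im t = 0 \<and>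
      x = ln (cmod z) \<and> y = ln (cmod w) \<and> u = ln (cmod t))"
  proof -
    have "p \<in> zero_locus (\<lambda>(z, w, t). 1 + z + w + t) \<and>
        frechet_derivative Log3 (at p) ` {v. frechet_derivative (\<lambda>(z, w, t). 1 + z + w + t) (at p) v = 0} \<noteq> UNIV
      \<longleftrightarrow> (case p of (z, w, t) \<Rightarrow> z \<noteq> 0 \<and> w \<noteq> 0 \<and> t \<noteq> 0 \<and> 1 + z + w + t = 0 \<and> Im z = 0 \<and> Im w = 0 \<and> Im t = 0)"
      for p :: "complex \<times> complex \<times> complex"
    proof -
      obtain z w t where p: "p = (z, w, t)" by (cases p)
      have K: "{v. (\<lambda>(a, b, c). a + b + c) v = 0} = {(a, b, c). a + b + (c::complex) = 0}" by auto
      show ?thesis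
      proof (cases "z \<noteq> 0 \<and> w \<noteq> 0 \<and> t \<noteq> 0 \<and> 1 + z + w + t = 0")
        case True
        then have "p \<in> zero_locus (\<lambda>(z, w, t). 1 + z + w + t)" by (simp add: p zero_locus_def)
        moreover have "frechet_derivative Log3 (at p) `
            {v. frechet_derivative (\<lambda>(z, w, t). 1 + z + w + t) (at p) v = 0} \<noteq> UNIV
            \<longleftrightarrow> Im z = 0 \<and> Im w = 0 \<and> Im t = 0"
          unfolding frechet_derivative_linear_polynomial K unfolding p
          using True by (simp only: frechet_derivative_Log3 critical_iff_real not_False_eq_True)
        ultimately show ?thesis using True unfolding p by blast
      next
        case False
        then have "p \<notin> zero_locus (\<lambda>(z, w, t). 1 + z + w + t)" by (simp add: p zero_locus_def)
        with False show ?thesis unfolding p by blast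
      qed
    qed
    then show ?thesis
      unfolding contour_def image_iff by (simp only: mem_Collect_eq Bex_def split_paired_Ex) (simp add: Log3_def)
  qed
  also have "\<dots> \<longleftrightarrow> (\<exists>a b c::real. a \<noteq> 0 \<and> b \<noteq> 0 \<and> c \<noteq> 0 \<and> 1 + a + b + c = 0 \<and>
      \<bar>a\<bar> = exp x \<and> \<bar>b\<bar> = exp y \<and> \<bar>c\<bar> = exp u)" (is "?P \<longleftrightarrow> ?Q")
  proof
    assume ?P
    then obtain z w t where *: "z \<noteq> 0" "w \<noteq> 0" "t \<noteq> 0" "1 + z + w + t = 0" "Im z = 0" "Im w = 0" "Im t = 0"
      "x = ln (cmod z)" "y = ln (cmod w)" "u = ln (cmod t)" by blast
    have "1 + Re z + Re w + Re t = 0"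
      using *(4) by (metis plus_complex.simps(1) zero_complex.simps(1) one_complex.simps(1))
    with * show ?Q
      by (intro exI[of _ "Re z"] exI[of _ "Re w"] exI[of _ "Re t"])
        (auto simp: complex_eq_iff cmod_eq_Re)
  next
    assume ?Q
    then obtain a b c :: real where *: "a \<noteq> 0" "b \<noteq> 0" "c \<noteq> 0" "1 + a + b + c = 0" 
      "\<bar>a\<bar> = exp x" "\<bar>b\<bar> = exp y" "\<bar>c\<bar> = exp u" by blast
    have "1 + complex_of_real a + of_real b + of_real c = of_real (1 + a + b + c)" by simp
    with * show ?P
      by (intro exI[of _ "complex_of_real a"] exI[of _ "complex_of_real b"] exI[of _ "complex_of_real c"]) simp
  qed
  also have "\<dots> \<longleftrightarrow> ?E"
  proof
    show ?E if ?Q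
    proof -
      from that obtain a b c :: real where *: "1 + a + b + c = 0" "\<bar>a\<bar> = exp x" "\<bar>b\<bar> = exp y" "\<bar>c\<bar> = exp u"
        by blast
      from *(2-4) have "a = exp x \<or> a = - exp x" "b = exp y \<or> b = - exp y" "c = exp u \<or> c = - exp u"
        by linarith+
      moreover have "exp x > 0" "exp y > 0" "exp u > 0" by simp_all
      ultimately show ?thesis using *(1) by argo
    qed
    have I: ?Q if "1 + a * exp x + b * exp y + c * exp u = 0" "\<bar>a\<bar> = 1" "\<bar>b\<bar> = 1" "\<bar>c\<bar> = 1" for a b c
      using that by (intro exI[of _ "a * exp x"] exI[of _ "b * exp y"] exI[of _ "c * exp u"]) (auto simp: abs_mult)
    assume ?E
    then consider "1 + exp x = exp y + exp u" | "1 + exp y = exp x + exp u" | "1 + exp u = exp x + exp y"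
      | "exp x = 1 + exp y + exp u" | "exp y = 1 + exp x + exp u" | "exp u = 1 + exp x + exp y"
      | "1 = exp x + exp y + exp u" by argo
    then show ?Q
    proof cases
      case 1 then show ?thesis by (intro I[of 1 "-1" "-1"]) simp_all
    next
      case 2 then show ?thesis by (intro I[of "-1" 1 "-1"]) simp_all
    next
      case 3 then show ?thesis by (intro I[of "-1" "-1" 1]) simp_all
    next
      case 4 then show ?thesis by (intro I[of "-1" 1 1]) simp_all
    next
      case 5 then show ?thesis by (intro I[of 1 "-1" 1]) simp_all
    next
      case 6 then show ?thesis by (intro I[of 1 1 "-1"]) simp_all
    next
      case 7 then show ?thesis by (intro I[of "-1" "-1" "-1"]) simp_all
    qed
  qed
  finally show ?thesis .
qed

subsection \<open>The Ronkin function\<close>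

text \<open>
  The integral of the form \<open>log|f| dz dw dt / (z w t)\<close> over the torus is computed in the
  parametrization \<open>z = exp (x + i\<alpha>)\<close>, \<open>w = exp (y + i\<beta>)\<close>, \<open>t = exp (u + i\<delta>)\<close>, for which
  \<open>dz dw dt\<close> pulls back to \<open>(i z) (i w) (i t) d\<alpha> d\<beta> d\<delta>\<close>. The result is a real number, hence
  the real part. The convention \<open>ln 0 = 0\<close> only affects the integrand on the zero locus.
\<close>
definition Ronkin :: "(complex \<times> complex \<times> complex \<Rightarrow> complex) \<Rightarrow> real \<times> real \<times> real \<Rightarrow> real" where
  "Ronkin f = (\<lambda>(x, y, u).
     Re ((1 / (2 * complex_of_real pi * \<i>)) ^ 3 *
       (LINT \<theta> : cbox (0, 0, 0) (2 * pi, 2 * pi, 2 * pi) | lborel.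
          (case \<theta> of (\<alpha>, \<beta>, \<delta>) \<Rightarrow>
             let z = exp (Complex x \<alpha>); w = exp (Complex y \<beta>); t = exp (Complex u \<delta>)
             in complex_of_real (ln (cmod (f (z, w, t)))) / (z * w * t)
                * ((\<i> * z) * (\<i> * w) * (\<i> * t))))))"

section \<open>Partial derivatives\<close>

definition pdiff :: "real \<times> real \<times> real \<Rightarrow> (real \<times> real \<times> real \<Rightarrow> real) \<Rightarrow> real \<times> real \<times> real \<Rightarrow> bool" where
  "pdiff v F p \<longleftrightarrow> (\<lambda>h. F (p + h *\<^sub>R v)) field_differentiable (at 0)"

definition pderiv_dir :: "real \<times> real \<times> real \<Rightarrow> (real \<times> real \<times> real \<Rightarrow> real) \<Rightarrow> real \<times> real \<times> real \<Rightarrow> real" where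
  "pderiv_dir v F p = deriv (\<lambda>h. F (p + h *\<^sub>R v)) 0"

definition pdiff2 :: "real \<times> real \<times> real \<Rightarrow> real \<times> real \<times> real \<Rightarrow> (real \<times> real \<times> real \<Rightarrow> real) \<Rightarrow>
    real \<times> real \<times> real \<Rightarrow> bool" where
  "pdiff2 v w F p \<longleftrightarrow> (\<forall>\<^sub>F q in nhds p. pdiff w F q) \<and> pdiff v (pderiv_dir w F) p"

abbreviation e_x :: "real \<times> real \<times> real" where "e_x \<equiv> (1, 0, 0)"
abbreviation e_y :: "real \<times> real \<times> real" where "e_y \<equiv> (0, 1, 0)"

section \<open>Hypergeometric series\<close>

text \<open>
  A matrix \<open>B\<close> is the list of its \<open>N\<close> rows, \<open>\<gamma>\<close> is a list of length \<open>n\<close> and \<open>a\<close> one of length \<open>N\<close>;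
  indices start at 0. The summation index ranges over the integer vectors of length \<open>N - n\<close>.
\<close>

definition row_dot :: "int list \<Rightarrow> int list \<Rightarrow> int" where
  "row_dot r \<kappa> = (\<Sum>i<length \<kappa>. r ! i * \<kappa> ! i)"

text \<open>Powers are principal branches. Since \<open>0 powr s = 0\<close> for every \<open>s\<close>, including \<open>s = 0\<close>,
  the entries of \<open>a\<close> should be nonzero.\<close>
definition hyp_monomial :: "complex list \<Rightarrow> int list list \<Rightarrow> complex list \<Rightarrow> int list \<Rightarrow> complex" where
  "hyp_monomial \<gamma> B a \<kappa> =
     (\<Prod>j<length B. a ! j powr ((if j < length \<gamma> then \<gamma> ! j else 0) + of_int (row_dot (B ! j) \<kappa>)))"

text \<open>\<open>1 / \<kappa>!\<close>, which vanishes as soon as some entry of \<open>\<kappa>\<close> is negative.\<close>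
definition inv_fact :: "int list \<Rightarrow> complex" where
  "inv_fact \<kappa> = (\<Prod>i<length \<kappa>. rGamma (of_int (\<kappa> ! i) + 1))"

definition hyp_Phi :: "complex list \<Rightarrow> int list list \<Rightarrow> complex list \<Rightarrow> complex" where
  "hyp_Phi \<gamma> B a =
     (\<Sum>\<^sub>\<infinity>\<kappa>\<in>{\<kappa>. length \<kappa> = length B - length \<gamma>}.
        hyp_monomial \<gamma> B a \<kappa>
        * (\<Prod>j<length \<gamma>. rGamma (\<gamma> ! j + of_int (row_dot (B ! j) \<kappa>) + 1))
        * inv_fact \<kappa>)"

text \<open>
  Terms with a negative entry of \<open>\<kappa>\<close> are zero because of \<^const>\<open>inv_fact\<close>, also where
  \<^const>\<open>Gamma\<close> has a pole. The definition is meant for parameters such that no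
  pole of \<^const>\<open>Gamma\<close> is met for nonnegative \<open>\<kappa>\<close>.
\<close>
definition hyp_Phi_tilde :: "complex list \<Rightarrow> int list list \<Rightarrow> complex list \<Rightarrow> complex" where
  "hyp_Phi_tilde \<gamma> B a =
     (\<Sum>\<^sub>\<infinity>\<kappa>\<in>{\<kappa>. length \<kappa> = length B - length \<gamma>}.
        (-1) powi row_dot (B ! 0) \<kappa>
        * Gamma (- (\<gamma> ! 0) - of_int (row_dot (B ! 0) \<kappa>))
        * hyp_monomial \<gamma> B a \<kappa>
        * (\<Prod>j\<in>{1..<length \<gamma>}. rGamma (\<gamma> ! j + of_int (row_dot (B ! j) \<kappa>) + 1))
        * inv_fact \<kappa>)"

section \<open>Chambers and the chamber-dependent functions\<close>

definition chamber :: "real \<times> real \<times> real \<Rightarrow> real \<times> real \<times> real" where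
  "chamber = (\<lambda>(x, y, u).
     (sgn (1 + exp x - exp y - exp u), sgn (1 + exp y - exp x - exp u), sgn (1 + exp u - exp x - exp y)))"

definition chamber_case :: "real \<times> real \<times> real \<Rightarrow> real \<Rightarrow> real \<Rightarrow> real \<Rightarrow> real \<Rightarrow> real" where
  "chamber_case p a b c d =
     (if chamber p \<in> {(1, 1, 1), (1, -1, -1)} then a
      else if chamber p \<in> {(-1, 1, 1), (-1, -1, -1)} then b
      else if chamber p \<in> {(-1, -1, 1), (-1, 1, -1)} then c
      else if chamber p \<in> {(1, -1, 1), (1, 1, -1)} then d
      else undefined)"

definition xi :: "real \<times> real \<times> real \<Rightarrow> real" where
  "xi = (\<lambda>(x, y, u).
     (1 + exp x + exp y - exp u) * (1 + exp x - exp y + exp u)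
     * (1 - exp x + exp y + exp u) * (- 1 + exp x + exp y + exp u))"

definition gfun :: "real \<times> real \<times> real \<Rightarrow> real" where
  "gfun = (\<lambda>(x, y, u). chamber_case (x, y, u)
     (1 / (2 * sqrt (exp (x + y + u))))
     (2 / sqrt (xi (x, y, u)))
     (1 / (2 * sqrt (exp (x + y + u))))
     (2 / sqrt (xi (x, y, u))))"

definition ksq :: "real \<times> real \<times> real \<Rightarrow> real" where
  "ksq = (\<lambda>(x, y, u). chamber_case (x, y, u)
     (xi (x, y, u) / (16 * exp (x + y + u)))
     (16 * exp (x + y + u) / xi (x, y, u))
     (xi (x, y, u) / (16 * exp (x + y + u)))
     (16 * exp (x + y + u) / xi (x, y, u)))"

definition Q1 :: "real \<times> real \<times> real \<Rightarrow> real" where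
  "Q1 = (\<lambda>(x, y, u). chamber_case (x, y, u)
     (2 * (exp y * (exp (2*x) + exp (2*y) + exp (2*u) - 1 - 2 * exp (y + u)) / (exp y - exp u)))
     (2 * (exp y * (exp (2*x) + exp (2*y) + exp (2*u) - 1 - 2 * exp (y + u)) / (exp y - exp u)))
     (2 * (exp x * (exp (2*x) + exp (2*y) - exp (2*u) + 1 - 2 * exp x) / (exp x - 1)))
     (- 2 * (exp x * (exp (2*x) + exp (2*y) - exp (2*u) + 1 - 2 * exp x) / (1 - exp x))))"

definition Q2 :: "real \<times> real \<times> real \<Rightarrow> real" where
  "Q2 = (\<lambda>(x, y, u). chamber_case (x, y, u)
     ((1 - exp x + exp y - exp u) * (1 - exp x - exp y + exp u))
     ((1 - exp x + exp y - exp u) * (1 - exp x - exp y + exp u))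
     (- ((1 - exp x + exp y - exp u) * (1 - exp x - exp y + exp u)))
     (- ((1 - exp x + exp y - exp u) * (1 - exp x - exp y + exp u))))"

definition Q3_base :: "real \<times> real \<times> real \<Rightarrow> real" where
  "Q3_base = (\<lambda>(x, y, u).
     (exp u + exp y) * (1 - exp x + exp y - exp u) * (1 + exp x) * (1 - exp x - exp y + exp u)
     / ((exp u - exp y) * (exp x - 1)))"

definition Q3 :: "real \<times> real \<times> real \<Rightarrow> real" where
  "Q3 p = chamber_case p (Q3_base p) (Q3_base p) (- Q3_base p) (- Q3_base p)"

definition alpha1sq :: "real \<times> real \<times> real \<Rightarrow> real" where
  "alpha1sq = (\<lambda>(x, y, u). chamber_case (x, y, u)
     ((1 - exp x + exp y + exp u) * (- 1 + exp x + exp y + exp u) / (4 * exp (y + u)))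
     (4 * exp x / ((1 + exp x + exp y - exp u) * (1 + exp x - exp y + exp u)))
     ((1 + exp x - exp y + exp u) * (1 + exp x + exp y - exp u) / (4 * exp x))
     (4 * exp (y + u) / ((1 - exp x + exp y + exp u) * (- 1 + exp x + exp y + exp u))))"

definition alpha2sq :: "real \<times> real \<times> real \<Rightarrow> real" where
  "alpha2sq = (\<lambda>(x, y, u). alpha1sq (x, y, u) * chamber_case (x, y, u)
     ((exp y - exp u)\<^sup>2 / (1 - exp x)\<^sup>2)
     ((exp y - exp u)\<^sup>2 / (1 - exp x)\<^sup>2)
     ((exp x - 1)\<^sup>2 / (exp y - exp u)\<^sup>2)
     ((1 - exp x)\<^sup>2 / (exp y - exp u)\<^sup>2))"

text \<open>The points where none of the denominators \<open>exp x - 1\<close>, \<open>exp y - exp u\<close> vanishes.\<close>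
definition regular_pts :: "(real \<times> real \<times> real) set" where
  "regular_pts = {(x, y, u). exp x \<noteq> 1 \<and> exp y \<noteq> exp u}"

text \<open>\<open>F\<close> restricted to \<open>S\<close> extends continuously to \<open>p\<close> with value \<open>c\<close> there; where \<open>F\<close> is
  already given by its formula (\<open>p \<in> S\<close>), \<open>c\<close> is simply its value.\<close>
definition extends_to :: "('a::topological_space \<Rightarrow> complex) \<Rightarrow> 'a set \<Rightarrow> 'a \<Rightarrow> complex \<Rightarrow> bool" where
  "extends_to F S p c \<longleftrightarrow> (if p \<in> S then F p = c else (F \<longlongrightarrow> c) (at p within S))"

end

theory Submission
  imports Defs "HOL-Complex_Analysis.Cauchy_Integral_Formula"
begin

text \<open>
  By Jensen's formula in one of the variables, \<open>N\<^sub>f\<close> is an average of \<open>ln (max X \<bar>1 + w + t\<bar>)\<close> with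
  \<open>X = exp x\<close>, so its first derivatives are probabilities such as \<open>P (\<bar>1 + z + t\<bar> < Y)\<close> for
  independent uniform arguments. Given \<open>z\<close>, this is an \<open>arccos\<close> of an expression in \<open>s = \<bar>1 + z\<bar>\<^sup>2\<close>,
  \<open>Y\<close> and \<open>U\<close>. Differentiating once more and taking \<open>s\<close> as variable yields integrals of
  \<open>R s / sqrt ((s - (1 - X)\<^sup>2) (s - (1 + X)\<^sup>2) (s - (Y - U)\<^sup>2) (s - (Y + U)\<^sup>2))\<close>
  over the interval between the two middle branch points, where \<open>R\<close> is constant for
  \<open>\<partial>\<^sub>x\<^sup>2\<close> (after exchanging \<open>X\<close> and \<open>Y\<close>) and a combination of \<open>s\<close>, \<open>1\<close>, \<open>1 / s\<close> for \<open>\<partial>\<^sub>x \<partial>\<^sub>y\<close>.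
  A Moebius substitution sends the branch points to those of Legendre's normal form: \<open>1\<close> gives the
  complete integral \<open>K\<close> (the series \<open>\<Phi>\<close>), while \<open>s\<close> and \<open>1 / s\<close> give complete integrals of the
  third kind with characteristics \<open>\<alpha>\<^sub>1\<^sup>2\<close> and \<open>\<alpha>\<^sub>2\<^sup>2\<close> (the series \<open>\<Phi>\<close> with a tilde). The contour is
  the locus where branch points collide, and the chambers are the possible orders of the branch points.
\<close>

section \<open>Differentiation of parameter integrals\<close>

text \<open>The obstacle is the inverse square root singularities of the differentiated integrand:
  they sit where a triangle degenerates, and their position depends on the parameter.
  Differentiation therefore goes through an integrated identity, which asks only for a uniform L1
  bound and for continuity of the candidate derivative. That continuity comes from the Moebius
  substitution: in the new angle the interval is always [0, pi/2] and the integrand is jointly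
  continuous in parameter and angle. The two derivatives differ because of what moves. In a
  probability with threshold X, varying X leaves s fixed, so R is constant; in a probability with
  threshold Y, varying X moves s itself, and this brings in 1 / s. The partial fractions of 1 / s
  are taken relative to the lowest branch point, which vanishes exactly when exp x = 1 or exp y =
  exp u. There the coefficients of the decomposition become singular while the integral itself stays
  continuous; hence the removable singularities.\<close>

text \<open>Since the fundamental theorem of calculus is integrated over \<open>w\<close>, no integrable majorant of
  \<open>h t w\<close> uniform in \<open>t\<close> is needed. This matters because the singularities of \<open>h t\<close> move with \<open>t\<close> below.\<close>
lemma has_derivative_integral_Fubini:
  fixes F h :: "real \<Rightarrow> 'a \<Rightarrow> real"
  assumes M: "sigma_finite_measure M" and ab: "a < b"
    and hm: "(\<lambda>(t, w). h t w) \<in> borel_measurable (borel \<Otimes>\<^sub>M M)"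
    and Fi: "\<And>t. t \<in> {a..b} \<Longrightarrow> integrable M (F t)"
    and cont: "AE w in M. continuous_on {a..b} (\<lambda>t. F t w)"
    and deriv: "AE w in M. \<exists>E. finite E \<and> (\<forall>t\<in>{a<..<b} - E. ((\<lambda>t. F t w) has_real_derivative h t w) (at t))"
    and hi: "\<And>t. t \<in> {a..b} \<Longrightarrow> integrable M (h t)"
    and hC: "\<And>t. t \<in> {a..b} \<Longrightarrow> (\<integral>w. \<bar>h t w\<bar> \<partial>M) \<le> C"
    and D: "continuous_on {a..b} (\<lambda>t. \<integral>w. h t w \<partial>M)"
    and t: "t \<in> {a<..<b}"
  shows "((\<lambda>t. \<integral>w. F t w \<partial>M) has_real_derivative (\<integral>w. h t w \<partial>M)) (at t)"
proof -
  interpret M: sigma_finite_measure M by fact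
  interpret P: pair_sigma_finite lborel M by unfold_locales
  note [measurable] = hm
  let ?D = "\<lambda>t. \<integral>w. h t w \<partial>M"
  have main: "(\<integral>w. F s w \<partial>M) - (\<integral>w. F a w \<partial>M) = integral {a..s} ?D" if s: "s \<in> {a..b}" for s
  proof -
    let ?h = "\<lambda>(t, w). indicator {a..s} t * h t w"
    \<comment> \<open>The uniform L1 bound \<open>C\<close> replaces a pointwise majorant: it bounds
      the inner integrals on \<open>{a..s}\<close>, which suffices for integrability over the
      product.\<close>
    have int: "integrable (lborel \<Otimes>\<^sub>M M) ?h"
    proof (rule P.Fubini_integrable)
      show "?h \<in> borel_measurable (lborel \<Otimes>\<^sub>M M)" by measurable
      have eq: "(\<lambda>t. \<integral>w. norm (?h (t, w)) \<partial>M) = (\<lambda>t. indicator {a..s} t * (\<integral>w. \<bar>h t w\<bar> \<partial>M))"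
        by (auto simp: abs_mult indicator_def)
      show "integrable lborel (\<lambda>t. \<integral>w. norm (?h (t, w)) \<partial>M)"
        unfolding eq
      proof (rule Bochner_Integration.integrable_bound)
        show "integrable lborel (\<lambda>t. indicator {a..s} t * \<bar>C\<bar>)"
          by (intro integrable_mult_left integrable_real_indicator) (auto simp: emeasure_lborel_Icc_eq)
        show "AE t in lborel. norm (indicator {a..s} t * (\<integral>w. \<bar>h t w\<bar> \<partial>M)) \<le> norm (indicator {a..s} t * \<bar>C\<bar>)"
        proof (intro AE_I2)
          fix t
          have "0 \<le> (\<integral>w. \<bar>h t w\<bar> \<partial>M)" by simp
          moreover have "t \<in> {a..s} \<Longrightarrow> (\<integral>w. \<bar>h t w\<bar> \<partial>M) \<le> \<bar>C\<bar>"
            using hC[of t] s by (auto intro: order_trans)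
          ultimately show "norm (indicator {a..s} t * (\<integral>w. \<bar>h t w\<bar> \<partial>M)) \<le> norm (indicator {a..s} t * \<bar>C\<bar>)"
            by (auto simp: indicator_def)
        qed
      qed measurable
      show "AE t in lborel. integrable M (\<lambda>w. ?h (t, w))"
        using hi s by (intro AE_I2) (auto simp: indicator_def)
    qed
    have "AE w in M. integrable lborel (\<lambda>t. indicator {a..s} t * h t w)"
      by (rule P.AE_integrable_snd[OF int])
    \<comment> \<open>For almost every fixed \<open>w\<close> the fundamental theorem applies in
      \<open>t\<close>; finitely many exceptional \<open>t\<close> are harmless because
      \<open>F\<close> is continuous in \<open>t\<close>.\<close>
    then have inner: "AE w in M. (\<integral>t. indicator {a..s} t * h t w \<partial>lborel) = F s w - F a w"
      using cont deriv
    proof eventually_elim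
      case (elim w)
      then obtain E where E: "finite E" "\<And>t. t\<in>{a<..<b} - E \<Longrightarrow> ((\<lambda>t. F t w) has_real_derivative h t w) (at t)"
        by blast
      have "((\<lambda>t. h t w) has_integral (F s w - F a w)) {a..s}"
      proof (rule fundamental_theorem_of_calculus_interior_strong[OF E(1)])
        show "continuous_on {a..s} (\<lambda>t. F t w)"
          by (rule continuous_on_subset[OF elim(2)]) (use s in auto)
        show "((\<lambda>t. F t w) has_vector_derivative h t w) (at t)" if "t \<in> {a<..<s} - E" for t
          using E(2)[of t] that s by (auto simp: has_real_derivative_iff_has_vector_derivative)
      qed (use s in auto)
      moreover have "set_integrable lborel {a..s} (\<lambda>t. h t w)"
        using elim(1) by (simp add: set_integrable_def)
      from set_borel_integral_eq_integral[OF this]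
      have "(\<integral>t. indicator {a..s} t * h t w \<partial>lborel) = integral {a..s} (\<lambda>t. h t w)"
        by (simp add: set_lebesgue_integral_def)
      ultimately show ?case by (simp add: integral_unique)
    qed
    have "(\<integral>w. F s w \<partial>M) - (\<integral>w. F a w \<partial>M) = (\<integral>w. F s w - F a w \<partial>M)"
      using Fi s ab by simp
    also have "\<dots> = (\<integral>w. (\<integral>t. indicator {a..s} t * h t w \<partial>lborel) \<partial>M)"
    proof (rule integral_cong_AE)
      show "(\<lambda>w. F s w - F a w) \<in> borel_measurable M"
        using Fi[of s] Fi[of a] s ab by (intro borel_measurable_diff) auto
    qed (use inner in \<open>auto intro!: M.borel_measurable_lebesgue_integral lborel.borel_measurable_lebesgue_integral\<close>)
    also have "\<dots> = (\<integral>t. (\<integral>w. indicator {a..s} t * h t w \<partial>M) \<partial>lborel)"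
      by (rule P.Fubini_integral[OF int])
    also have "\<dots> = (\<integral>t. indicator {a..s} t *\<^sub>R ?D t \<partial>lborel)" by simp
    also have "\<dots> = integral {a..s} ?D"
    proof -
      have "set_integrable lborel {a..s} ?D"
        by (rule borel_integrable_atLeastAtMost', rule continuous_on_subset[OF D]) (use s in auto)
      from set_borel_integral_eq_integral(2)[OF this] show ?thesis
        by (simp add: set_lebesgue_integral_def)
    qed
    finally show ?thesis .
  qed
  \<comment> \<open>Continuity of \<open>?D\<close> allows the integrated identity to be
    differentiated at every point, not just at almost every one.\<close>
  have "((\<lambda>s. integral {a..s} ?D) has_real_derivative ?D t) (at t within {a..b})"
    using integral_has_real_derivative[OF D, of t] t by simp
  then have "((\<lambda>s. integral {a..s} ?D) has_real_derivative ?D t) (at t)"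
    using t by (simp add: at_within_Icc_at)
  then have "((\<lambda>s. (\<integral>w. F a w \<partial>M) + integral {a..s} ?D) has_real_derivative ?D t) (at t)"
    by (auto intro!: derivative_eq_intros)
  then show ?thesis
  proof (rule has_field_derivative_transform_within_open)
    show "(\<integral>w. F a w \<partial>M) + integral {a..s} ?D = (\<integral>w. F s w \<partial>M)" if "s \<in> {a<..<b}" for s
      using main[of s] that by simp
  qed (use t in auto)
qed

section \<open>Jensen's formula and the first derivatives of the Ronkin function\<close>

definition circ :: "real measure" where
  "circ = uniform_measure lborel {0..2*pi}"

lemma sets_circ[measurable_cong]: "sets circ = sets borel"
  by (simp add: circ_def)

lemma space_circ[simp]: "space circ = UNIV"
  by (simp add: circ_def)

lemma emeasure_circ_UNIV: "emeasure circ UNIV = 1"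
  unfolding circ_def by (subst emeasure_uniform_measure) auto

lemma measure_circ_UNIV[simp]: "measure circ UNIV = 1"
  by (simp add: measure_def emeasure_circ_UNIV)

interpretation circ: finite_measure circ
  by (rule finite_measureI) (simp add: emeasure_circ_UNIV)

lemma nn_integral_circ:
  assumes "f \<in> borel_measurable borel"
  shows "(\<integral>\<^sup>+a. f a \<partial>circ) = (\<integral>\<^sup>+a\<in>{0..2*pi}. f a \<partial>lborel) / ennreal (2*pi)"
  using assms by (simp add: circ_def nn_integral_uniform_measure)

lemma AE_circ_I:
  assumes "countable S" "\<And>a. a \<in> {0..2*pi} \<Longrightarrow> a \<notin> S \<Longrightarrow> P a"
  shows "AE a in circ. P a"
proof -
  have "AE a in lborel. a \<notin> S"
    using countable_imp_null_set_lborel[OF assms(1)] by (rule AE_not_in)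
  then have "AE a in lborel. a \<in> {0..2*pi} \<longrightarrow> P a"
    by eventually_elim (use assms in auto)
  then show ?thesis
    unfolding circ_def by (intro AE_uniform_measureI) auto
qed


text \<open>The shifted window is cut at the period and its upper piece is moved back; half-open
  intervals tile exactly, so no null sets enter.\<close>

lemma nn_integral_periodic_shift:
  fixes f :: "real \<Rightarrow> ennreal"
  assumes [measurable]: "f \<in> borel_measurable borel" and per: "\<And>a. f (a + p) = f a"
    and \<phi>: "0 \<le> \<phi>" "\<phi> \<le> p"
  shows "(\<integral>\<^sup>+a\<in>{0..<p}. f (a + \<phi>) \<partial>lborel) = (\<integral>\<^sup>+a\<in>{0..<p}. f a \<partial>lborel)"
proof -
  have "(\<integral>\<^sup>+a\<in>{0..<p}. f (a + \<phi>) \<partial>lborel) = (\<integral>\<^sup>+a\<in>{\<phi>..<p + \<phi>}. f a \<partial>lborel)"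
    by (subst (2) nn_integral_real_affine[where c=1 and t=\<phi>])
      (auto intro!: nn_integral_cong simp: indicator_def add.commute)
  also have "\<dots> = (\<integral>\<^sup>+a. f a * indicator {\<phi>..<p} a + f a * indicator {p..<p + \<phi>} a \<partial>lborel)"
    using \<phi> by (intro nn_integral_cong) (auto simp: indicator_def)
  also have "\<dots> = (\<integral>\<^sup>+a\<in>{\<phi>..<p}. f a \<partial>lborel) + (\<integral>\<^sup>+a\<in>{p..<p + \<phi>}. f a \<partial>lborel)"
    by (subst nn_integral_add) auto
  also have "(\<integral>\<^sup>+a\<in>{p..<p + \<phi>}. f a \<partial>lborel) = (\<integral>\<^sup>+a\<in>{0..<\<phi>}. f a \<partial>lborel)"
    by (subst nn_integral_real_affine[where c=1 and t=p])
      (auto intro!: nn_integral_cong simp: indicator_def add.commute[of p] per)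
  also have "(\<integral>\<^sup>+a\<in>{\<phi>..<p}. f a \<partial>lborel) + \<dots> = (\<integral>\<^sup>+a. f a * indicator {\<phi>..<p} a + f a * indicator {0..<\<phi>} a \<partial>lborel)"
    by (subst nn_integral_add) auto
  also have "\<dots> = (\<integral>\<^sup>+a\<in>{0..<p}. f a \<partial>lborel)"
    using \<phi> by (intro nn_integral_cong) (auto simp: indicator_def)
  finally show ?thesis .
qed

lemma nn_integral_circ':
  assumes [measurable]: "f \<in> borel_measurable borel"
  shows "(\<integral>\<^sup>+a. f a \<partial>circ) = (\<integral>\<^sup>+a\<in>{0..<2*pi}. f a \<partial>lborel) / ennreal (2*pi)"
proof -
  have "AE a in lborel. a \<noteq> (2*pi::real)"
    by (rule AE_lborel_singleton)
  then have "(\<integral>\<^sup>+a\<in>{0..2*pi}. f a \<partial>lborel) = (\<integral>\<^sup>+a\<in>{0..<2*pi}. f a \<partial>lborel)"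
    by (intro nn_integral_cong_AE, eventually_elim) (auto simp: indicator_def)
  then show ?thesis by (simp add: nn_integral_circ)
qed

text \<open>\<open>circ\<close> is not invariant under translation of the angle, but its image on
  the unit circle is, by periodicity of \<open>cis\<close>. This is what later allows a complex
  number to be replaced by its modulus.\<close>

lemma distr_circ_shift:
  assumes \<phi>: "0 \<le> \<phi>" "\<phi> \<le> 2*pi"
  shows "distr circ borel (\<lambda>a. cis (a + \<phi>)) = distr circ borel cis"
proof (rule measure_eqI)
  fix S assume "S \<in> sets (distr circ borel (\<lambda>a. cis (a + \<phi>)))"
  then have [measurable]: "S \<in> sets borel" by simp
  have [measurable]: "cis \<in> borel_measurable borel"
    by (intro borel_measurable_continuous_onI continuous_intros)
  have distr: "emeasure (distr circ borel g) S = (\<integral>\<^sup>+a. indicator S (g a) \<partial>circ)"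
    if [measurable]: "g \<in> borel_measurable borel" for g :: "real \<Rightarrow> complex"
    by (subst nn_integral_indicator[symmetric], simp, subst nn_integral_distr) auto
  have "emeasure (distr circ borel (\<lambda>a. cis (a + \<phi>))) S = (\<integral>\<^sup>+a. indicator S (cis (a + \<phi>)) \<partial>circ)"
    by (simp add: distr)
  also have "\<dots> = (\<integral>\<^sup>+a. indicator S (cis a) \<partial>circ)"
  proof -
    have "cis (a + 2 * pi) = cis a" for a
      by (simp add: complex_eq_iff)
    then have "(\<integral>\<^sup>+a\<in>{0..<2*pi}. indicator S (cis (a + \<phi>)) \<partial>lborel) = (\<integral>\<^sup>+a\<in>{0..<2*pi}. indicator S (cis a) \<partial>lborel)"
      by (intro nn_integral_periodic_shift[where f="\<lambda>a. indicator S (cis a)"]) (use \<phi> in auto)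
    then show ?thesis
      by (subst (1 2) nn_integral_circ') auto
  qed
  also have "\<dots> = emeasure (distr circ borel cis) S"
    by (simp add: distr)
  finally show "emeasure (distr circ borel (\<lambda>a. cis (a + \<phi>))) S = emeasure (distr circ borel cis) S" .
qed simp

text \<open>The reflection a -> 2 pi - a preserves the cosine and folds the circle onto (0, pi),
  where the cosine is injective and can serve as variable of integration.\<close>

lemma nn_integral_circ_cos:
  assumes [measurable]: "f \<in> borel_measurable borel"
  shows "(\<integral>\<^sup>+a. f (cos a) \<partial>circ) = (\<integral>\<^sup>+a\<in>{0<..<pi}. f (cos a) \<partial>lborel) / ennreal pi"
proof -
  have "AE a in lborel. a \<noteq> (0::real) \<and> a \<noteq> pi \<and> a \<noteq> 2*pi"
    using AE_lborel_singleton[of 0] AE_lborel_singleton[of pi] AE_lborel_singleton[of "2*pi"]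
    by eventually_elim auto
  then have "(\<integral>\<^sup>+a\<in>{0..2*pi}. f (cos a) \<partial>lborel) =
      (\<integral>\<^sup>+a. f (cos a) * indicator {0<..<pi} a + f (cos a) * indicator {pi<..<2*pi} a \<partial>lborel)"
    by (intro nn_integral_cong_AE, eventually_elim) (auto simp: indicator_def)
  also have "\<dots> = (\<integral>\<^sup>+a\<in>{0<..<pi}. f (cos a) \<partial>lborel) + (\<integral>\<^sup>+a\<in>{pi<..<2*pi}. f (cos a) \<partial>lborel)"
    by (subst nn_integral_add) auto
  also have "(\<integral>\<^sup>+a\<in>{pi<..<2*pi}. f (cos a) \<partial>lborel) = (\<integral>\<^sup>+a\<in>{0<..<pi}. f (cos a) \<partial>lborel)"
    by (subst nn_integral_real_affine[where c="-1" and t="2*pi"])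
      (auto intro!: nn_integral_cong simp: indicator_def cos_diff)
  finally have "(\<integral>\<^sup>+a\<in>{0..2*pi}. f (cos a) \<partial>lborel) = 2 * (\<integral>\<^sup>+a\<in>{0<..<pi}. f (cos a) \<partial>lborel)"
    by (simp only: mult_2)
  moreover have "2 * c / ennreal (2 * pi) = c / ennreal pi" for c :: ennreal
  proof (cases c)
    case (real r)
    then have "2 * c = ennreal (2 * r)" by (simp add: ennreal_mult)
    with real show ?thesis by (simp add: divide_ennreal)
  qed (simp add: ennreal_mult_top ennreal_top_divide)
  ultimately show ?thesis by (simp add: nn_integral_circ)
qed

section \<open>Jensen's formula for a linear polynomial\<close>

lemma integral_circle_mean:
  assumes f: "f holomorphic_on cball 0 1"
  shows "((\<lambda>t. f (cis t)) has_integral 2 * of_real pi * f 0) {0..2*pi}"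
proof -
  have "((\<lambda>u. f u / (u - 0)) has_contour_integral (2 * of_real pi * \<i> * f 0)) (circlepath 0 1)"
    by (rule Cauchy_integral_circlepath_simple[OF f]) simp
  then have "((\<lambda>t. f (cis t) / cis t * \<i> * cis t) has_integral 2 * of_real pi * \<i> * f 0) {0..2*pi}"
    by (simp add: circlepath_def has_contour_integral_part_circlepath_iff)
  then have "((\<lambda>t. f (cis t) * \<i>) has_integral 2 * of_real pi * \<i> * f 0) {0..2*pi}"
    by (rule has_integral_eq[rotated]) simp
  from has_integral_mult_left[OF this, of "-\<i>"] show ?thesis
    by (simp add: mult_ac)
qed

text \<open>\<open>Ln (1 + q * u)\<close> is holomorphic on the closed disc, where the real part of
  \<open>q * u\<close> stays above -1, and it vanishes at 0. Its circular mean is therefore zero,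
  and the real part of the logarithm is the log modulus.\<close>

lemma Jensen_linear_aux:
  assumes "cmod q < 1"
  shows "((\<lambda>t. ln (cmod (1 + q * cis t))) has_integral 0) {0..2*pi}"
    "\<And>t. 1 + q * cis t \<noteq> 0"
proof -
  have "(\<lambda>u. Ln (1 + q * u)) holomorphic_on cball 0 1"
  proof (intro holomorphic_intros)
    fix u :: complex assume "u \<in> cball 0 1"
    then have "cmod (q * u) < 1"
      using assms by (auto simp: norm_mult intro: le_less_trans[OF mult_left_le])
    then have "Re (q * u) > -1"
      by (smt (verit) abs_Re_le_cmod)
    then show "1 + q * u \<notin> \<real>\<^sub>\<le>\<^sub>0"
      by (auto simp: complex_nonpos_Reals_iff)
  qed
  from integral_circle_mean[OF this] have *: "((\<lambda>t. Ln (1 + q * cis t)) has_integral 0) {0..2*pi}"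
    by simp
  show nz: "1 + q * cis t \<noteq> 0" for t
  proof
    assume "1 + q * cis t = 0"
    then have "q * cis t = -1" by (simp add: add_eq_0_iff)
    then have "cmod (q * cis t) = 1" by simp
    then show False using assms by (simp add: norm_mult)
  qed
  from has_integral_Re[OF *] show "((\<lambda>t. ln (cmod (1 + q * cis t))) has_integral 0) {0..2*pi}"
    using nz by simp
qed

lemma Jensen_linear:
  assumes "cmod a \<noteq> r" "r > 0"
  shows "((\<lambda>t. ln (cmod (a + of_real r * cis t))) has_integral 2 * pi * ln (max r (cmod a))) {0..2*pi}"
    and "\<And>t. a + of_real r * cis t \<noteq> 0"
proof -
  \<comment> \<open>Factoring out the larger of the two moduli leaves 1 + q cis with |q| < 1. If
    \<open>r\<close> is the larger one the angle is reversed, and 2 pi - t is used instead of -t so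
    that the interval is mapped to itself.\<close>
  have *: "\<exists>q. cmod q < 1 \<and> (\<forall>t. cmod (a + of_real r * cis t) = max r (cmod a) * cmod (1 + q * cis t))
        \<or> cmod q < 1 \<and> (\<forall>t. cmod (a + of_real r * cis t) = max r (cmod a) * cmod (1 + q * cis (2*pi - t)))"
  proof (cases "cmod a < r")
    case True
    have "cmod (a + of_real r * cis t) = r * cmod (1 + a / r * cis (2*pi - t))" for t
    proof -
      have "a + of_real r * cis t = of_real r * cis t * (1 + a / r * cis (2*pi - t))"
      proof -
        have "cis (2*pi - t) = cis (- t)" by (simp add: complex_eq_iff cos_diff sin_diff)
        then have "of_real r * cis t * (1 + a / r * cis (2*pi - t)) = of_real r * cis t + a * (cis t * cis (- t))"
          using assms by (simp add: field_simps)
        then show ?thesis by (simp add: cis_mult)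
      qed
      then show ?thesis using assms by (simp add: norm_mult)
    qed
    then show ?thesis using True assms by (intro exI[of _ "a / r"]) (auto simp: norm_divide max_def)
  next
    case False
    have "cmod (a + of_real r * cis t) = cmod a * cmod (1 + r / a * cis t)" for t
      using False assms by (subst norm_mult[symmetric]) (auto simp: field_simps)
    then show ?thesis using False assms
      by (intro exI[of _ "r / a"]) (auto simp: norm_divide max_def divide_less_eq)
  qed
  then obtain q where q: "cmod q < 1" and or: "(\<forall>t. cmod (a + of_real r * cis t) = max r (cmod a) * cmod (1 + q * cis t))
        \<or> (\<forall>t. cmod (a + of_real r * cis t) = max r (cmod a) * cmod (1 + q * cis (2*pi - t)))"
    by blast
  note J = Jensen_linear_aux[OF q]
  have "((\<lambda>x. ln (cmod (1 + q * cis (- x + 2 * pi)))) has_integral 0) {0..2*pi}"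
    using has_integral_affinity[OF J(1)[folded cbox_interval], of "-1" "2*pi"] by (simp add: image_affinity_atLeastAtMost)
  then have J': "((\<lambda>x. ln (cmod (1 + q * cis (2 * pi - x)))) has_integral 0) {0..2*pi}"
    by simp
  have pos: "max r (cmod a) > 0" using assms by auto
  have c: "((\<lambda>t. ln (max r (cmod a))) has_integral 2 * pi * ln (max r (cmod a))) {0..2*pi}"
    using has_integral_const_real[of "ln (max r (cmod a))" 0 "2*pi"] by simp
  from or show "((\<lambda>t. ln (cmod (a + of_real r * cis t))) has_integral 2 * pi * ln (max r (cmod a))) {0..2*pi}"
  proof
    assume "\<forall>t. cmod (a + of_real r * cis t) = max r (cmod a) * cmod (1 + q * cis t)"
    then have "(\<lambda>t. ln (cmod (a + of_real r * cis t))) = (\<lambda>t. ln (max r (cmod a)) + ln (cmod (1 + q * cis t)))"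
      using pos J(2) by (auto simp: ln_mult)
    then show ?thesis using has_integral_add[OF c J(1)] by simp
  next
    assume "\<forall>t. cmod (a + of_real r * cis t) = max r (cmod a) * cmod (1 + q * cis (2*pi - t))"
    then have "(\<lambda>t. ln (cmod (a + of_real r * cis t))) = (\<lambda>t. ln (max r (cmod a)) + ln (cmod (1 + q * cis (2*pi - t))))"
      using pos J(2) by (auto simp: ln_mult)
    then show ?thesis using has_integral_add[OF c J'] by simp
  qed
  show "\<And>t. a + of_real r * cis t \<noteq> 0"
    using or J(2) pos by (metis mult_eq_0_iff norm_eq_zero less_irrefl)
qed

section \<open>Independent angles and null level sets\<close>

interpretation circ2: pair_sigma_finite circ circ
  by unfold_locales

interpretation circ2: finite_measure "circ \<Otimes>\<^sub>M circ"
  by (rule finite_measure_pair_measure) unfold_locales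

interpretation circ3: pair_sigma_finite circ "circ \<Otimes>\<^sub>M circ"
  by unfold_locales

interpretation circ3: finite_measure "circ \<Otimes>\<^sub>M (circ \<Otimes>\<^sub>M circ)"
  by (rule finite_measure_pair_measure) unfold_locales

lemma measure_circ2_UNIV[simp]: "measure (circ \<Otimes>\<^sub>M circ) UNIV = 1"
proof -
  have "emeasure (circ \<Otimes>\<^sub>M circ) (UNIV \<times> UNIV) = 1"
    by (subst circ.emeasure_pair_measure_Times) (auto simp: emeasure_circ_UNIV sets_circ)
  then show ?thesis by (simp add: measure_def)
qed

lemma measure_circ3_UNIV[simp]: "measure (circ \<Otimes>\<^sub>M (circ \<Otimes>\<^sub>M circ)) UNIV = 1"
proof -
  have 1: "emeasure (circ \<Otimes>\<^sub>M circ) UNIV = 1"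
    using measure_circ2_UNIV by (simp add: circ2.emeasure_eq_measure)
  have "UNIV \<in> sets (circ \<Otimes>\<^sub>M circ)"
    by (metis sets.top space_circ space_pair_measure UNIV_Times_UNIV)
  then have "emeasure (circ \<Otimes>\<^sub>M (circ \<Otimes>\<^sub>M circ)) (UNIV \<times> UNIV) = 1"
    by (subst circ2.emeasure_pair_measure_Times) (auto simp: emeasure_circ_UNIV 1 sets_circ)
  then show ?thesis by (simp add: measure_def)
qed

lemma cis_borel[measurable]: "cis \<in> borel_measurable borel"
  by (intro borel_measurable_continuous_onI continuous_intros)

text \<open>The law of cosines. It shows that the level sets of the modulus are countable, and it
  turns a condition on the modulus into one on a cosine.\<close>

lemma cmod_add_cis:
  "(cmod (a + of_real U * cis t))\<^sup>2 = (cmod a)\<^sup>2 + U\<^sup>2 + 2 * cmod a * U * cos (t - Arg a)"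
proof -
  have a: "Re a = cmod a * cos (Arg a)" "Im a = cmod a * sin (Arg a)"
    by (metis Re_rcis rcis_cmod_Arg) (metis Im_rcis rcis_cmod_Arg)
  have "(cmod (a + of_real U * cis t))\<^sup>2 = (Re a + U * cos t)\<^sup>2 + (Im a + U * sin t)\<^sup>2"
    by (simp add: cmod_power2)
  also have "\<dots> = (Re a)\<^sup>2 + (Im a)\<^sup>2 + U\<^sup>2 * ((cos t)\<^sup>2 + (sin t)\<^sup>2) + 2 * U * (Re a * cos t + Im a * sin t)"
    by algebra
  also have "\<dots> = (cmod a)\<^sup>2 + U\<^sup>2 + 2 * U * (Re a * cos t + Im a * sin t)"
    by (simp add: cmod_power2)
  also have "Re a * cos t + Im a * sin t = cmod a * cos (t - Arg a)"
    by (subst a(1), subst a(2)) (simp add: cos_diff algebra_simps)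
  finally show ?thesis by (simp add: mult_ac)
qed

lemma countable_cos_eq: "countable {t. cos (t - p) = (c::real)}"
proof -
  have "{t. cos (t - p) = c} \<subseteq> (\<lambda>k. p + arccos c + 2 * of_int k * pi) ` UNIV \<union> (\<lambda>k. p - arccos c + 2 * of_int k * pi) ` (UNIV::int set)"
  proof
    fix t assume "t \<in> {t. cos (t - p) = c}"
    then have "cos (t - p) = c" by simp
    then obtain k where "t - p = arccos c + 2 * of_int k * pi \<or> t - p = - arccos c + 2 * of_int k * pi"
      by (auto simp: cos_eq_arccos_Ex elim!: Ints_cases)
    then show "t \<in> (\<lambda>k. p + arccos c + 2 * of_int k * pi) ` UNIV \<union> (\<lambda>k. p - arccos c + 2 * of_int k * pi) ` (UNIV::int set)"
      by (auto simp: image_iff intro: exI[of _ k])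
  qed
  then show ?thesis by (rule countable_subset) auto
qed

lemma AE_circ_cmod_neq:
  assumes "a \<noteq> 0" "U > 0"
  shows "AE t in circ. cmod (a + of_real U * cis t) \<noteq> r"
proof (rule AE_circ_I[OF countable_cos_eq])
  let ?c = "(r\<^sup>2 - (cmod a)\<^sup>2 - U\<^sup>2) / (2 * cmod a * U)"
  fix t assume "t \<notin> {t. cos (t - Arg a) = ?c}"
  then have "cos (t - Arg a) \<noteq> ?c" by simp
  then show "cmod (a + of_real U * cis t) \<noteq> r"
    using cmod_add_cis[of a U t] assms by (auto simp: field_simps)
qed

lemma AE_circ_nonzero:
  assumes "Y > 0"
  shows "AE t in circ. 1 + of_real Y * cis t \<noteq> 0"
  using AE_circ_cmod_neq[of 1 Y 0] assms by simp

text \<open>Needed twice: Jensen's formula excludes equality of the two moduli, and the probability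
  of lying below a threshold is continuous in the threshold because no mass sits on it.\<close>

lemma AE_circ2_cmod_neq:
  assumes "Y > 0" "U > 0"
  shows "AE p in circ \<Otimes>\<^sub>M circ. cmod (1 + of_real Y * cis (fst p) + of_real U * cis (snd p)) \<noteq> r"
proof (rule circ2.AE_pair_measure)
  show "{p \<in> space (circ \<Otimes>\<^sub>M circ). cmod (1 + of_real Y * cis (fst p) + of_real U * cis (snd p)) \<noteq> r} \<in> sets (circ \<Otimes>\<^sub>M circ)"
    by measurable
  show "AE x in circ. AE y in circ. cmod (1 + of_real Y * cis (fst (x, y)) + of_real U * cis (snd (x, y))) \<noteq> r"
    using AE_circ_nonzero[OF assms(1)]
    by eventually_elim (use AE_circ_cmod_neq assms in simp)
qed

section \<open>Reduction of the Ronkin function to two angles\<close>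

lemma circ_density: "circ = density lborel (\<lambda>a. ennreal (indicator {0..2*pi} a / (2*pi)))"
  by (auto simp: circ_def uniform_measure_def indicator_def divide_ennreal ennreal_divide_times intro!: density_cong
      simp flip: divide_ennreal)

text \<open>The density is the normalising constant of the Ronkin integral up to powers of i, so the
  Ronkin function becomes an expectation over three independent angles.\<close>

lemma circ3_density:
  "circ \<Otimes>\<^sub>M (circ \<Otimes>\<^sub>M circ) =
    density lborel (\<lambda>\<theta>. ennreal (indicator (cbox (0, 0, 0) (2 * pi, 2 * pi, 2 * pi)) \<theta> / (2*pi)^3))"
proof -
  let ?d = "\<lambda>a. ennreal (indicator {0..2*pi} a / (2*pi))"
  have d1: "sigma_finite_measure (density lborel ?d)"
    unfolding circ_density[symmetric] by unfold_locales
  have 2: "circ \<Otimes>\<^sub>M circ = density lborel (\<lambda>(a, b). ?d a * ?d b)"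
    unfolding lborel_prod[symmetric]
    by (subst (1 2) circ_density, rule pair_measure_density) (use d1 in \<open>auto intro: lborel.sigma_finite_measure_axioms\<close>)
  have d2: "sigma_finite_measure (density lborel (\<lambda>(a, b). ?d a * ?d b))"
    unfolding 2[symmetric] by unfold_locales
  have m2: "(\<lambda>(a, b). ?d a * ?d b) \<in> borel_measurable lborel"
    by (simp add: lborel_prod[symmetric])
  have "circ \<Otimes>\<^sub>M (circ \<Otimes>\<^sub>M circ) = density lborel (\<lambda>(a, c). ?d a * (case c of (a, b) \<Rightarrow> ?d a * ?d b))"
    unfolding 2 unfolding lborel_prod[symmetric, where 'b="real \<times> real"]
    by (subst circ_density, rule pair_measure_density) (use d2 m2 in \<open>auto intro: lborel.sigma_finite_measure_axioms\<close>)
  also have "(\<lambda>(a, c). ?d a * (case c of (a, b) \<Rightarrow> ?d a * ?d b)) =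
      (\<lambda>\<theta>. ennreal (indicator (cbox (0, 0, 0) (2 * pi, 2 * pi, 2 * pi)) \<theta> / (2*pi)^3))"
  proof (rule ext)
    fix \<theta> :: "real \<times> real \<times> real"
    obtain a b c where \<theta>: "\<theta> = (a, b, c)" by (cases \<theta>)
    show "(\<lambda>(a, c). ?d a * (case c of (a, b) \<Rightarrow> ?d a * ?d b)) \<theta> = 
      ennreal (indicator (cbox (0, 0, 0) (2 * pi, 2 * pi, 2 * pi)) \<theta> / (2*pi)^3)"
      by (auto simp: \<theta> cbox_Pair_eq indicator_def power3_eq_cube simp flip: ennreal_mult)
  qed
  finally show ?thesis .
qed

lemma Ronkin_linear_eq:
  "Ronkin (\<lambda>(z, w, t). 1 + z + w + t) (x, y, u) =
    (\<integral>(a, b, c). ln (cmod (1 + of_real (exp x) * cis a + of_real (exp y) * cis b + of_real (exp u) * cis c))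
      \<partial>(circ \<Otimes>\<^sub>M (circ \<Otimes>\<^sub>M circ)))"
proof -
  let ?L = "\<lambda>(a, b, c). ln (cmod (1 + of_real (exp x) * cis a + of_real (exp y) * cis b + of_real (exp u) * cis c))"
  let ?C = "cbox (0, 0, 0) (2 * pi, 2 * pi, 2 * pi)"
  have m: "?L \<in> borel_measurable lborel"
    by (simp add: lborel_prod[symmetric])
  have eq: "(case \<theta> of (\<alpha>, \<beta>, \<delta>) \<Rightarrow>
             let z = exp (Complex x \<alpha>); w = exp (Complex y \<beta>); t = exp (Complex u \<delta>)
             in complex_of_real (ln (cmod (1 + z + w + t))) / (z * w * t)
                * ((\<i> * z) * (\<i> * w) * (\<i> * t))) = - \<i> * complex_of_real (?L \<theta>)" for \<theta>
    by (cases \<theta>) (simp add: Let_def exp_eq_polar cis_conv_exp[symmetric] field_simps)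
  have "(LINT \<theta>:?C|lborel. - \<i> * complex_of_real (?L \<theta>)) = - \<i> * complex_of_real (LINT \<theta>:?C|lborel. ?L \<theta>)"
    unfolding set_integral_mult_right set_integral_complex_of_real[symmetric] by simp
  \<comment> \<open>The powers of i cancel: dz, dw, dt contribute i^3 = -i, and the prefactor
    contributes 1 / i^3 = i.\<close>
  moreover have "(1 / (2 * complex_of_real pi * \<i>)) ^ 3 * (- \<i> * complex_of_real r) = complex_of_real (r / (2*pi)^3)" for r
    by (simp add: power_divide power_mult_distrib power3_eq_cube field_simps)
  ultimately have "Ronkin (\<lambda>(z, w, t). 1 + z + w + t) (x, y, u) = (LINT \<theta>:?C|lborel. ?L \<theta>) / (2*pi)^3"
    unfolding Ronkin_def prod.case eq by (simp only: Re_complex_of_real)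
  also have "\<dots> = (\<integral>\<theta>. ?L \<theta> \<partial>(circ \<Otimes>\<^sub>M (circ \<Otimes>\<^sub>M circ)))"
  proof -
    have "(\<integral>\<theta>. ?L \<theta> \<partial>(circ \<Otimes>\<^sub>M (circ \<Otimes>\<^sub>M circ))) = (\<integral>\<theta>. (indicator ?C \<theta> / (2*pi)^3) *\<^sub>R ?L \<theta> \<partial>lborel)"
      unfolding circ3_density by (rule integral_density) (use m in auto)
    also have "\<dots> = (\<integral>\<theta>. indicator ?C \<theta> *\<^sub>R ?L \<theta> / (2*pi)^3 \<partial>lborel)"
      by (intro Bochner_Integration.integral_cong) auto
    finally show ?thesis
      by (simp only: set_lebesgue_integral_def integral_divide_zero)
  qed
  finally show ?thesis .
qed


lemma ln_cmod_le:
  fixes X Y U a b c :: real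
  assumes "X > 0" "Y > 0" "U > 0"
  shows "ln (cmod (1 + of_real X * cis a + of_real Y * cis b + of_real U * cis c)) \<le> ln (1 + X + Y + U)"
proof -
  let ?f = "1 + of_real X * cis a + of_real Y * cis b + of_real U * cis c"
  have "cmod ?f \<le> cmod 1 + cmod (of_real X * cis a) + cmod (of_real Y * cis b) + cmod (of_real U * cis c)"
    by (intro norm_triangle_le order_refl add_mono)
  then have "cmod ?f \<le> 1 + X + Y + U" using assms by (simp add: norm_mult)
  \<comment> \<open>At a zero of the polynomial the default \<open>ln 0 = 0\<close> still lies below
    the bound, since 1 + X + Y + U exceeds 1.\<close>
  then show ?thesis using assms by (cases "?f = 0") (auto intro!: ln_mono)
qed

lemma nn_Jensen_linear:
  assumes "cmod a \<noteq> r" "r > 0" and le: "\<And>t. ln (cmod (a + of_real r * cis t)) \<le> M"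
  shows "(\<integral>\<^sup>+t. ennreal (M - ln (cmod (a + of_real r * cis t))) \<partial>circ) = ennreal (M - ln (max r (cmod a)))"
proof -
  have hi: "((\<lambda>t. M - ln (cmod (a + of_real r * cis t))) has_integral 2 * pi * (M - ln (max r (cmod a)))) {0..2*pi}"
    using has_integral_diff[OF has_integral_const_real[of M 0 "2*pi"] Jensen_linear(1)[OF assms(1,2)]]
    by (simp add: algebra_simps)
  have "(\<integral>\<^sup>+t. ennreal (if t \<in> {0..2*pi} then M - ln (cmod (a + of_real r * cis t)) else 0) \<partial>lborel)
      = ennreal (2 * pi * (M - ln (max r (cmod a))))"
    by (rule nn_integral_has_integral_lborel) (use hi le in \<open>auto simp only: has_integral_restrict_UNIV split: if_splits intro!: measurable_If\<close>, auto)
  moreover have "(\<integral>\<^sup>+t. ennreal (if t \<in> {0..2*pi} then M - ln (cmod (a + of_real r * cis t)) else 0) \<partial>lborel) =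
      (\<integral>\<^sup>+t\<in>{0..2*pi}. ennreal (M - ln (cmod (a + of_real r * cis t))) \<partial>lborel)"
    by (intro nn_integral_cong) (auto simp: indicator_def)
  moreover have "M - ln (max r (cmod a)) \<ge> 0"
  proof -
    have "0 \<le> 2 * pi * (M - ln (max r (cmod a)))"
      by (rule has_integral_nonneg[OF hi]) (use le in simp)
    then show ?thesis using pi_gt_zero by (simp add: zero_le_mult_iff)
  qed
  ultimately have "(\<integral>\<^sup>+t\<in>{0..2*pi}. ennreal (M - ln (cmod (a + of_real r * cis t))) \<partial>lborel) =
      ennreal (2 * pi * (M - ln (max r (cmod a))))" and "M - ln (max r (cmod a)) \<ge> 0"
    by simp_all
  then show ?thesis
    by (subst nn_integral_circ) (simp, simp add: divide_ennreal)
qed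

text \<open>The maximum is taken inside the logarithm, so that the junk value \<open>ln 0 = 0\<close> never occurs.\<close>
definition lnmax :: "real \<Rightarrow> real \<Rightarrow> real \<Rightarrow> real \<times> real \<Rightarrow> real" where
  "lnmax X Y U = (\<lambda>p. ln (max X (cmod (1 + of_real Y * cis (fst p) + of_real U * cis (snd p)))))"

lemma lnmax_borel[measurable]: "lnmax X Y U \<in> borel_measurable (circ \<Otimes>\<^sub>M circ)"
  unfolding lnmax_def by measurable

lemma lnmax_bounds:
  assumes "X > 0" "Y > 0" "U > 0"
  shows "ln X \<le> lnmax X Y U p" "lnmax X Y U p \<le> ln (1 + X + Y + U)"
proof -
  have "cmod (1 + of_real Y * cis (fst p) + of_real U * cis (snd p)) \<le> 1 + cmod (of_real Y * cis (fst p)) + cmod (of_real U * cis (snd p))"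
    by (intro norm_triangle_le add_mono) auto
  then have "cmod (1 + of_real Y * cis (fst p) + of_real U * cis (snd p)) \<le> 1 + Y + U"
    using assms by (simp add: norm_mult)
  then show "lnmax X Y U p \<le> ln (1 + X + Y + U)" using assms unfolding lnmax_def by (intro ln_mono) auto
  show "ln X \<le> lnmax X Y U p" using assms unfolding lnmax_def by (intro ln_mono) auto
qed

lemma integrable_lnmax:
  assumes "X > 0" "Y > 0" "U > 0"
  shows "integrable (circ \<Otimes>\<^sub>M circ) (lnmax X Y U)"
proof (rule circ2.integrable_const_bound[where B="\<bar>ln X\<bar> + \<bar>ln (1 + X + Y + U)\<bar>"])
  show "AE p in circ \<Otimes>\<^sub>M circ. norm (lnmax X Y U p) \<le> \<bar>ln X\<bar> + \<bar>ln (1 + X + Y + U)\<bar>"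
  proof (intro AE_I2)
    fix p show "norm (lnmax X Y U p) \<le> \<bar>ln X\<bar> + \<bar>ln (1 + X + Y + U)\<bar>"
      using lnmax_bounds[OF assms, of p] by (simp only: real_norm_def)
  qed
qed measurable

definition lnlin :: "real \<Rightarrow> real \<Rightarrow> real \<Rightarrow> real \<times> real \<times> real \<Rightarrow> real" where
  "lnlin X Y U = (\<lambda>(a, b, c). ln (cmod (1 + of_real X * cis a + of_real Y * cis b + of_real U * cis c)))"

lemma lnlin_borel[measurable]: "lnlin X Y U \<in> borel_measurable (circ \<Otimes>\<^sub>M (circ \<Otimes>\<^sub>M circ))"
  unfolding lnlin_def by measurable

text \<open>The logarithm is unbounded below near the zero locus but bounded above. Subtracting it
  from its upper bound gives a nonnegative function, so the order of integration can be changed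
  before integrability is known; the finite value found here then yields integrability.\<close>

lemma nn_integral_lnlin:
  assumes pos: "X > 0" "Y > 0" "U > 0"
  shows "(\<integral>\<^sup>+\<theta>. ennreal (ln (1 + X + Y + U) - lnlin X Y U \<theta>) \<partial>(circ \<Otimes>\<^sub>M (circ \<Otimes>\<^sub>M circ)))
       = ennreal (ln (1 + X + Y + U) - (\<integral>p. lnmax X Y U p \<partial>(circ \<Otimes>\<^sub>M circ)))"
proof -
  let ?M = "ln (1 + X + Y + U)"
  have le: "lnlin X Y U \<theta> \<le> ?M" for \<theta>
    using ln_cmod_le[OF pos] by (cases \<theta>) (simp add: lnlin_def)
  have "(\<integral>\<^sup>+\<theta>. ennreal (?M - lnlin X Y U \<theta>) \<partial>(circ \<Otimes>\<^sub>M (circ \<Otimes>\<^sub>M circ)))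
      = (\<integral>\<^sup>+p. \<integral>\<^sup>+a. ennreal (?M - lnlin X Y U (a, p)) \<partial>circ \<partial>(circ \<Otimes>\<^sub>M circ))"
    by (rule circ3.nn_integral_snd[symmetric, of "\<lambda>\<theta>. ennreal (?M - lnlin X Y U \<theta>)"]) measurable
  also have "\<dots> = (\<integral>\<^sup>+p. ennreal (?M - lnmax X Y U p) \<partial>(circ \<Otimes>\<^sub>M circ))"
  proof (rule nn_integral_cong_AE)
    show "AE p in circ \<Otimes>\<^sub>M circ. (\<integral>\<^sup>+a. ennreal (?M - lnlin X Y U (a, p)) \<partial>circ) = ennreal (?M - lnmax X Y U p)"
      using AE_circ2_cmod_neq[OF pos(2,3), of X]
    proof eventually_elim
      case (elim p)
      have eq: "lnlin X Y U (a, p) = ln (cmod (1 + of_real Y * cis (fst p) + of_real U * cis (snd p) + of_real X * cis a))" for a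
        by (simp add: lnlin_def case_prod_beta add_ac)
      show ?case
        using nn_Jensen_linear[OF elim pos(1), of ?M] le[of "(_, p)"] unfolding eq lnmax_def by simp
    qed
  qed
  also have "\<dots> = ennreal (\<integral>p. ?M - lnmax X Y U p \<partial>(circ \<Otimes>\<^sub>M circ))"
    by (rule nn_integral_eq_integral) (use lnmax_bounds[OF pos] integrable_lnmax[OF pos] in auto)
  also have "(\<integral>p. ?M - lnmax X Y U p \<partial>(circ \<Otimes>\<^sub>M circ)) = ?M - (\<integral>p. lnmax X Y U p \<partial>(circ \<Otimes>\<^sub>M circ))"
    using integrable_lnmax[OF pos] by (simp add: space_pair_measure)
  finally show ?thesis .
qed

lemma integral_lnlin:
  assumes pos: "X > 0" "Y > 0" "U > 0"
  shows "(\<integral>\<theta>. lnlin X Y U \<theta> \<partial>(circ \<Otimes>\<^sub>M (circ \<Otimes>\<^sub>M circ))) = (\<integral>p. lnmax X Y U p \<partial>(circ \<Otimes>\<^sub>M circ))"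
proof -
  let ?M = "ln (1 + X + Y + U)"
  have le: "0 \<le> ?M - lnlin X Y U \<theta>" for \<theta>
    using ln_cmod_le[OF pos] by (cases \<theta>) (simp add: lnlin_def)
  have int: "integrable (circ \<Otimes>\<^sub>M (circ \<Otimes>\<^sub>M circ)) (\<lambda>\<theta>. ?M - lnlin X Y U \<theta>)"
    by (rule integrableI_nonneg) (use le in \<open>auto simp: nn_integral_lnlin[OF pos]\<close>)
  have "(\<integral>p. lnmax X Y U p \<partial>(circ \<Otimes>\<^sub>M circ)) \<le> (\<integral>p. ?M \<partial>(circ \<Otimes>\<^sub>M circ))"
    by (intro integral_mono integrable_lnmax pos lnmax_bounds) simp
  then have le': "0 \<le> ?M - (\<integral>p. lnmax X Y U p \<partial>(circ \<Otimes>\<^sub>M circ))"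
    by (simp add: space_pair_measure)
  have I: "(\<integral>\<theta>. ?M - lnlin X Y U \<theta> \<partial>(circ \<Otimes>\<^sub>M (circ \<Otimes>\<^sub>M circ))) = ?M - (\<integral>p. lnmax X Y U p \<partial>(circ \<Otimes>\<^sub>M circ))"
    by (subst integral_eq_nn_integral) (use le le' in \<open>auto simp: nn_integral_lnlin[OF pos]\<close>)
  have "(\<integral>\<theta>. lnlin X Y U \<theta> \<partial>(circ \<Otimes>\<^sub>M (circ \<Otimes>\<^sub>M circ))) = (\<integral>\<theta>. ?M - (?M - lnlin X Y U \<theta>) \<partial>(circ \<Otimes>\<^sub>M (circ \<Otimes>\<^sub>M circ)))"
    by simp
  also have "\<dots> = ?M - (\<integral>\<theta>. ?M - lnlin X Y U \<theta> \<partial>(circ \<Otimes>\<^sub>M (circ \<Otimes>\<^sub>M circ)))"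
    by (subst Bochner_Integration.integral_diff) (use int in \<open>auto simp: space_pair_measure\<close>)
  finally show ?thesis by (simp add: I)
qed

lemma nn_integral_lnlin_swap:
  "(\<integral>\<^sup>+\<theta>. ennreal (M - lnlin X Y U \<theta>) \<partial>(circ \<Otimes>\<^sub>M (circ \<Otimes>\<^sub>M circ))) = (\<integral>\<^sup>+\<theta>. ennreal (M - lnlin Y X U \<theta>) \<partial>(circ \<Otimes>\<^sub>M (circ \<Otimes>\<^sub>M circ)))"
proof -
  have it: "(\<integral>\<^sup>+\<theta>. ennreal (M - lnlin X Y U \<theta>) \<partial>(circ \<Otimes>\<^sub>M (circ \<Otimes>\<^sub>M circ))) =
      (\<integral>\<^sup>+a. \<integral>\<^sup>+b. \<integral>\<^sup>+c. ennreal (M - lnlin X Y U (a, b, c)) \<partial>circ \<partial>circ \<partial>circ)" for X Y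
    by (subst circ2.nn_integral_fst[symmetric], measurable, subst circ.nn_integral_fst[symmetric]) auto
  have "(\<integral>\<^sup>+a. \<integral>\<^sup>+b. \<integral>\<^sup>+c. ennreal (M - lnlin X Y U (a, b, c)) \<partial>circ \<partial>circ \<partial>circ) =
      (\<integral>\<^sup>+b. \<integral>\<^sup>+a. \<integral>\<^sup>+c. ennreal (M - lnlin X Y U (a, b, c)) \<partial>circ \<partial>circ \<partial>circ)"
    by (rule circ2.Fubini') measurable
  also have "\<dots> = (\<integral>\<^sup>+b. \<integral>\<^sup>+a. \<integral>\<^sup>+c. ennreal (M - lnlin Y X U (b, a, c)) \<partial>circ \<partial>circ \<partial>circ)"
    by (simp add: lnlin_def add_ac)
  finally show ?thesis by (simp add: it)
qed

text \<open>Jensen's formula singles out one variable, and the symmetry between the first two is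
  invisible in \<open>lnmax\<close>. It is recovered from the threefold integral, so that either
  variable can be the one inside the maximum when it is differentiated.\<close>

lemma integral_lnmax_swap:
  assumes pos: "X > 0" "Y > 0" "U > 0"
  shows "(\<integral>p. lnmax X Y U p \<partial>(circ \<Otimes>\<^sub>M circ)) = (\<integral>p. lnmax Y X U p \<partial>(circ \<Otimes>\<^sub>M circ))"
proof -
  let ?M = "ln (1 + X + Y + U)"
  have M: "ln (1 + Y + X + U) = ?M" by (simp add: add_ac)
  have le: "0 \<le> ln (1 + X + Y + U) - (\<integral>p. lnmax X Y U p \<partial>(circ \<Otimes>\<^sub>M circ))" if "X > 0" "Y > 0" for X Y
  proof -
    have "(\<integral>p. lnmax X Y U p \<partial>(circ \<Otimes>\<^sub>M circ)) \<le> (\<integral>p. ln (1 + X + Y + U) \<partial>(circ \<Otimes>\<^sub>M circ))"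
      by (intro integral_mono integrable_lnmax that pos lnmax_bounds) simp
    then show ?thesis by (simp add: space_pair_measure)
  qed
  have "ennreal (?M - (\<integral>p. lnmax X Y U p \<partial>(circ \<Otimes>\<^sub>M circ))) = ennreal (?M - (\<integral>p. lnmax Y X U p \<partial>(circ \<Otimes>\<^sub>M circ)))"
    using nn_integral_lnlin[OF pos] nn_integral_lnlin[OF pos(2,1,3)] nn_integral_lnlin_swap[of ?M X Y U]
    unfolding M by simp
  then show ?thesis
    using le[OF pos(1,2)] le[OF pos(2,1)] unfolding M by (subst (asm) ennreal_inj) auto
qed

abbreviation (input) lin3 :: "complex \<times> complex \<times> complex \<Rightarrow> complex" where
  "lin3 \<equiv> \<lambda>(z, w, t). 1 + z + w + t"

lemma Ronkin_lnmax:
  "Ronkin lin3 (x, y, u) = (\<integral>p. lnmax (exp x) (exp y) (exp u) p \<partial>(circ \<Otimes>\<^sub>M circ))"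
  "Ronkin lin3 (x, y, u) = (\<integral>p. lnmax (exp y) (exp x) (exp u) p \<partial>(circ \<Otimes>\<^sub>M circ))"
proof -
  show 1: "Ronkin lin3 (x, y, u) = (\<integral>p. lnmax (exp x) (exp y) (exp u) p \<partial>(circ \<Otimes>\<^sub>M circ))"
    unfolding Ronkin_linear_eq by (subst integral_lnlin[symmetric]) (auto simp: lnlin_def)
  show "Ronkin lin3 (x, y, u) = (\<integral>p. lnmax (exp y) (exp x) (exp u) p \<partial>(circ \<Otimes>\<^sub>M circ))"
    unfolding 1 by (rule integral_lnmax_swap) auto
qed

section \<open>The first derivatives as probabilities\<close>

lemma distr_circ_cos:
  "distr circ borel cos = distr (density lborel (\<lambda>a. ennreal (indicator {0<..<pi} a / pi))) borel cos"
proof (rule measure_eqI)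
  fix S assume "S \<in> sets (distr circ borel cos)"
  then have [measurable]: "S \<in> sets borel" by simp
  have "emeasure (distr circ borel cos) S = (\<integral>\<^sup>+a. indicator S (cos a) \<partial>circ)"
    by (subst nn_integral_indicator[symmetric], simp, subst nn_integral_distr) auto
  also have "\<dots> = (\<integral>\<^sup>+a\<in>{0<..<pi}. indicator S (cos a) \<partial>lborel) / ennreal pi"
    by (rule nn_integral_circ_cos) simp
  also have "\<dots> = (\<integral>\<^sup>+a. ennreal (indicator {0<..<pi} a / pi) * indicator S (cos a) \<partial>lborel)"
  proof -
    have "1 / ennreal pi = ennreal (1 / pi)"
      by (metis divide_ennreal ennreal_1 pi_gt_zero zero_le_one)
    then show ?thesis
      by (subst nn_integral_divide[symmetric]) (auto intro!: nn_integral_cong simp: indicator_def)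
  qed
  also have "\<dots> = (\<integral>\<^sup>+a. indicator S (cos a) \<partial>(density lborel (\<lambda>a. ennreal (indicator {0<..<pi} a / pi))))"
    by (subst nn_integral_density) auto
  also have "\<dots> = emeasure (distr (density lborel (\<lambda>a. ennreal (indicator {0<..<pi} a / pi))) borel cos) S"
    by (subst nn_integral_indicator[symmetric], simp, subst nn_integral_distr) auto
  finally show "emeasure (distr circ borel cos) S = emeasure (distr (density lborel (\<lambda>a. ennreal (indicator {0<..<pi} a / pi))) borel cos) S" .
qed simp

text \<open>Transport through the law of the cosine carries the folding of the circle over to signed
  integrands.\<close>

lemma integral_circ_cos:
  fixes f :: "real \<Rightarrow> real"
  assumes [measurable]: "f \<in> borel_measurable borel"
  shows "integrable circ (\<lambda>a. f (cos a)) \<longleftrightarrow> set_integrable lborel {0<..<pi} (\<lambda>a. f (cos a))"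
    and "(\<integral>a. f (cos a) \<partial>circ) = (LINT a:{0<..<pi}|lborel. f (cos a)) / pi"
proof -
  let ?h = "density lborel (\<lambda>a. ennreal (indicator {0<..<pi} a / pi))"
  have eq: "(indicator {0<..<pi} a / pi) *\<^sub>R f (cos a) = (1 / pi) * (indicator {0<..<pi} a *\<^sub>R f (cos a))" for a
    by simp
  have "integrable circ (\<lambda>a. f (cos a)) \<longleftrightarrow> integrable (distr circ borel cos) f"
    by (subst integrable_distr_eq) auto
  also have "\<dots> \<longleftrightarrow> integrable ?h (\<lambda>a. f (cos a))"
    unfolding distr_circ_cos by (subst integrable_distr_eq) auto
  also have "\<dots> \<longleftrightarrow> integrable lborel (\<lambda>a. (indicator {0<..<pi} a / pi) *\<^sub>R f (cos a))"
    by (rule integrable_density) auto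
  also have "\<dots> \<longleftrightarrow> set_integrable lborel {0<..<pi} (\<lambda>a. f (cos a))"
    unfolding eq set_integrable_def by (subst integrable_mult_left_iff) auto
  finally show "integrable circ (\<lambda>a. f (cos a)) \<longleftrightarrow> set_integrable lborel {0<..<pi} (\<lambda>a. f (cos a))" .
  have "(\<integral>a. f (cos a) \<partial>circ) = integral\<^sup>L (distr circ borel cos) f"
    by (subst integral_distr) auto
  also have "\<dots> = (\<integral>a. f (cos a) \<partial>?h)"
    unfolding distr_circ_cos by (subst integral_distr) auto
  also have "\<dots> = (\<integral>a. (indicator {0<..<pi} a / pi) *\<^sub>R f (cos a) \<partial>lborel)"
    by (rule integral_density) auto
  also have "\<dots> = (LINT a:{0<..<pi}|lborel. f (cos a)) / pi"
    unfolding eq set_lebesgue_integral_def by (subst integral_mult_right_zero) (simp add: divide_simps)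
  finally show "(\<integral>a. f (cos a) \<partial>circ) = (LINT a:{0<..<pi}|lborel. f (cos a)) / pi" .
qed

text \<open>\<open>ang c / pi\<close> is the probability of \<open>cos t < c\<close> for a uniform angle \<open>t\<close>.\<close>
definition ang :: "real \<Rightarrow> real" where
  "ang c = pi - arccos (max (-1) (min 1 c))"

lemma continuous_on_ang: "continuous_on S ang"
  unfolding ang_def by (intro continuous_intros) auto

lemma ang_borel[measurable]: "ang \<in> borel_measurable borel"
  by (intro borel_measurable_continuous_onI continuous_on_ang)

lemma ang_bounds: "0 \<le> ang c" "ang c \<le> pi"
  unfolding ang_def using arccos_bounded[of "max (-1) (min 1 c)"] by auto

text \<open>The clamping makes \<open>ang\<close> constant outside [-1, 1]. The corners |c| = 1,
  left out here, are where the triangle of the law of cosines degenerates.\<close>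

lemma ang_deriv:
  "\<bar>c\<bar> < 1 \<Longrightarrow> (ang has_real_derivative 1 / sqrt (1 - c\<^sup>2)) (at c)"
  "\<bar>c\<bar> > 1 \<Longrightarrow> (ang has_real_derivative 0) (at c)"
proof -
  show "(ang has_real_derivative 1 / sqrt (1 - c\<^sup>2)) (at c)" if "\<bar>c\<bar> < 1"
  proof (rule has_field_derivative_transform_within_open)
    show "((\<lambda>c. pi - arccos c) has_real_derivative 1 / sqrt (1 - c\<^sup>2)) (at c)"
      using that by (auto intro!: derivative_eq_intros simp: divide_inverse)
    show "open {-1<..<1::real}" by simp
  qed (use that in \<open>auto simp: ang_def\<close>)
  show "(ang has_real_derivative 0) (at c)" if "\<bar>c\<bar> > 1"
  proof (cases "c > 1")
    case True
    show ?thesis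
      by (rule has_field_derivative_transform_within_open[where f="\<lambda>_. pi - arccos 1" and S="{1<..}"])
        (use True in \<open>auto simp: ang_def\<close>)
  next
    case False
    show ?thesis
      by (rule has_field_derivative_transform_within_open[where f="\<lambda>_. pi - arccos (-1)" and S="{..<-1}"])
        (use False that in \<open>auto simp: ang_def\<close>)
  qed
qed

lemma measure_cos_less:
  "(\<integral>t. (if cos t < c then 1 else 0) \<partial>circ) = ang c / pi"
proof -
  define k where "k = arccos (max (-1) (min 1 c))"
  have k: "0 \<le> k" "k \<le> pi" "cos k = max (-1) (min 1 c)"
    unfolding k_def using arccos[of "max (-1) (min 1 c)"] by auto
  have *: "cos t < c \<longleftrightarrow> k < t" if "t \<in> {0<..<pi}" for t
  proof -
    have "cos t < 1" "cos t > -1"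
      using that cos_monotone_0_pi[of 0 t] cos_monotone_0_pi[of t pi] by auto
    then have "cos t < c \<longleftrightarrow> cos t < cos k" unfolding k(3) by linarith
    also have "\<dots> \<longleftrightarrow> k < t" using k that by (intro cos_mono_less_eq) auto
    finally show ?thesis .
  qed
  have "(LINT t:{0<..<pi}|lborel. (if cos t < c then 1 else 0)) = (\<integral>t. indicator {k<..<pi} t \<partial>lborel)"
    unfolding set_lebesgue_integral_def using * k
    by (intro Bochner_Integration.integral_cong) (auto simp: indicator_def)
  also have "\<dots> = pi - k" using k by simp
  finally show ?thesis
    using integral_circ_cos(2)[of "\<lambda>x. if x < c then 1 else 0"] by (simp add: ang_def k_def)
qed

lemma measure_cmod_add_cis_less:
  assumes a: "a \<noteq> 0" and U: "U > 0" and r: "r > 0"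
  shows "(\<integral>t. (if cmod (a + of_real U * cis t) < r then 1 else 0) \<partial>circ)
    = ang ((r\<^sup>2 - U\<^sup>2 - (cmod a)\<^sup>2) / (2 * cmod a * U)) / pi"
proof -
  \<comment> \<open>\<open>Arg2pi\<close> takes values in [0, 2 pi), which puts the rotation angle
    in the range required by \<open>distr_circ_shift\<close>.\<close>
  define \<psi> where "\<psi> = 2*pi - Arg2pi a"
  have \<psi>: "0 \<le> \<psi>" "\<psi> \<le> 2*pi" using Arg2pi_ge_0[of a] Arg2pi_lt_2pi[of a] by (auto simp: \<psi>_def)
  have rot: "cmod (a + of_real U * cis t) = cmod (of_real (cmod a) + of_real U * cis (t + \<psi>))" for t
  proof -
    have 1: "a = of_real (cmod a) * cis (Arg2pi a)"
      using Arg2pi_eq[of a] by (simp add: cis_conv_exp)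
    have 2: "cis t = cis (Arg2pi a) * cis (t + \<psi>)"
      by (simp add: cis_mult \<psi>_def add_ac complex_eq_iff cos_add sin_add)
    have "a + of_real U * cis t = cis (Arg2pi a) * (of_real (cmod a) + of_real U * cis (t + \<psi>))"
      by (subst 1, subst 2) (simp add: algebra_simps)
    then show ?thesis by (simp add: norm_mult)
  qed
  define g where "g = (\<lambda>z. if cmod (of_real (cmod a) + of_real U * z) < r then 1 else (0::real))"
  have [measurable]: "g \<in> borel_measurable borel" unfolding g_def by measurable
  have "(\<integral>t. (if cmod (a + of_real U * cis t) < r then 1 else 0) \<partial>circ) = (\<integral>t. g (cis (t + \<psi>)) \<partial>circ)"
    by (simp add: rot g_def)
  also have "\<dots> = integral\<^sup>L (distr circ borel (\<lambda>t. cis (t + \<psi>))) g"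
    by (subst integral_distr) auto
  also have "\<dots> = integral\<^sup>L (distr circ borel cis) g"
    by (simp only: distr_circ_shift[OF \<psi>])
  also have "\<dots> = (\<integral>t. g (cis t) \<partial>circ)"
    by (subst integral_distr) auto
  also have "\<dots> = (\<integral>t. (if cos t < (r\<^sup>2 - U\<^sup>2 - (cmod a)\<^sup>2) / (2 * cmod a * U) then 1 else 0) \<partial>circ)"
  proof (intro Bochner_Integration.integral_cong refl)
    fix t
    have "cmod (of_real (cmod a) + of_real U * cis t) < r \<longleftrightarrow> (cmod (of_real (cmod a) + of_real U * cis t))\<^sup>2 < r\<^sup>2"
      using r by (auto intro: power_strict_mono dest: power_less_imp_less_base)
    also have "\<dots> \<longleftrightarrow> (cmod a)\<^sup>2 + U\<^sup>2 + 2 * cmod a * U * cos t < r\<^sup>2"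
      using a by (subst cmod_add_cis) (simp add: Arg_of_real)
    also have "\<dots> \<longleftrightarrow> cos t < (r\<^sup>2 - U\<^sup>2 - (cmod a)\<^sup>2) / (2 * cmod a * U)"
      using a U by (simp add: field_simps)
    finally show "g (cis t) = (if cos t < (r\<^sup>2 - U\<^sup>2 - (cmod a)\<^sup>2) / (2 * cmod a * U) then 1 else 0)"
      by (simp add: g_def)
  qed
  finally show ?thesis by (simp add: measure_cos_less)
qed

text \<open>The derivative of the Ronkin function in the logarithm of the first argument, which
  plays the role of the threshold.\<close>

definition prob3 :: "real \<Rightarrow> real \<Rightarrow> real \<Rightarrow> real" where
  "prob3 X Y U = (\<integral>p. (if cmod (1 + of_real Y * cis (fst p) + of_real U * cis (snd p)) < X then 1 else 0) \<partial>(circ \<Otimes>\<^sub>M circ))"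

lemma integrable_prob3:
  "integrable (circ \<Otimes>\<^sub>M circ) (\<lambda>p. (if cmod (1 + of_real Y * cis (fst p) + of_real U * cis (snd p)) < X then 1 else (0::real)))"
  by (rule circ2.integrable_const_bound[where B=1]) auto

text \<open>The square of \<open>\<bar>1 + X exp (i a)\<bar>\<close>.\<close>
definition cmod_sq :: "real \<Rightarrow> real \<Rightarrow> real" where
  "cmod_sq X a = 1 + X\<^sup>2 + 2 * X * cos a"

text \<open>The threshold from the law of cosines: measured from the argument of 1 + X cis a, the
  remaining angle b satisfies |1 + X cis a + U cis b| < Y exactly if its cosine is below this
  value.\<close>

definition cang :: "real \<Rightarrow> real \<Rightarrow> real \<Rightarrow> real \<Rightarrow> real" where
  "cang X Y U a = (Y\<^sup>2 - U\<^sup>2 - cmod_sq X a) / (2 * sqrt (cmod_sq X a) * U)"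

lemma prob3_eq:
  assumes "X > 0" "Y > 0" "U > 0"
  shows "prob3 Y X U = (\<integral>a. ang (cang X Y U a) / pi \<partial>circ)"
proof -
  let ?f = "\<lambda>a b. if cmod (1 + of_real X * cis a + of_real U * cis b) < Y then 1 else (0::real)"
  have "prob3 Y X U = (\<integral>a. (\<integral>b. ?f a b \<partial>circ) \<partial>circ)"
    unfolding prob3_def using circ2.integral_fst'[OF integrable_prob3[of X U Y]] by simp
  also have "\<dots> = (\<integral>a. ang (cang X Y U a) / pi \<partial>circ)"
  proof (rule integral_cong_AE)
    show "AE a in circ. (\<integral>b. ?f a b \<partial>circ) = ang (cang X Y U a) / pi"
      using AE_circ_nonzero[OF assms(1)]
    proof eventually_elim
      case (elim a)
      have cmod_sq: "(cmod (1 + of_real X * cis a))\<^sup>2 = cmod_sq X a"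
        using cmod_add_cis[of 1 X a] by (simp add: cmod_sq_def)
      then have "cmod (1 + of_real X * cis a) = sqrt (cmod_sq X a)"
        by (metis abs_norm_cancel real_sqrt_abs)
      then show ?case
        using measure_cmod_add_cis_less[OF elim assms(3,2)] cmod_sq by (simp add: cang_def)
    qed
  qed (auto simp: cang_def cmod_sq_def)
  finally show ?thesis .
qed

text \<open>Dominated convergence: the indicator jumps only when the modulus equals the threshold,
  which is a null event.\<close>

lemma continuous_prob3:
  assumes "Y > 0" "U > 0"
  shows "continuous_on S (\<lambda>t::real. prob3 (exp t) Y U)"
  unfolding continuous_on_sequentially
proof (intro allI ballI impI, elim conjE)
  fix x :: "nat \<Rightarrow> real" and a assume x: "x \<longlonglongrightarrow> a"
  let ?A = "\<lambda>p. cmod (1 + of_real Y * cis (fst p) + of_real U * cis (snd p))"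
  have ex: "(\<lambda>n. exp (x n)) \<longlonglongrightarrow> exp a" by (intro tendsto_intros x)
  show "((\<lambda>t. prob3 (exp t) Y U) \<circ> x) \<longlonglongrightarrow> prob3 (exp a) Y U"
    unfolding prob3_def comp_def
  proof (rule integral_dominated_convergence[where w="\<lambda>_. 1"])
    show "AE p in circ \<Otimes>\<^sub>M circ. (\<lambda>n. if ?A p < exp (x n) then 1 else (0::real)) \<longlonglongrightarrow> (if ?A p < exp a then 1 else 0)"
      using AE_circ2_cmod_neq[OF assms, of "exp a"]
    proof eventually_elim
      case (elim p)
      have "eventually (\<lambda>n. (?A p < exp (x n)) = (?A p < exp a)) sequentially"
      proof (cases "?A p < exp a")
        case True
        from order_tendstoD(1)[OF ex this] show ?thesis by eventually_elim (use True in auto)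
      next
        case False
        with elim have "exp a < ?A p" by simp
        from order_tendstoD(2)[OF ex this] show ?thesis by eventually_elim (use False in auto)
      qed
      then have "eventually (\<lambda>n. (if ?A p < exp (x n) then 1 else (0::real)) = (if ?A p < exp a then 1 else 0)) sequentially"
        by eventually_elim simp
      then show ?case by (rule tendsto_eventually)
    qed
  qed auto
qed

lemma lnmax_deriv:
  assumes "Y > 0" "U > 0"
  shows "((\<lambda>t. \<integral>p. lnmax (exp t) Y U p \<partial>(circ \<Otimes>\<^sub>M circ)) has_real_derivative prob3 (exp t0) Y U) (at t0)"
  unfolding prob3_def
proof (rule has_derivative_integral_Fubini[where a="t0 - 1" and b="t0 + 1" and C=1])
  let ?A = "\<lambda>p. cmod (1 + of_real Y * cis (fst p) + of_real U * cis (snd p))"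
  show "sigma_finite_measure (circ \<Otimes>\<^sub>M circ)" by unfold_locales
  show "AE w in circ \<Otimes>\<^sub>M circ. continuous_on {t0 - 1..t0 + 1} (\<lambda>t. lnmax (exp t) Y U w)"
    unfolding lnmax_def by (intro AE_I2 continuous_intros) (auto simp: max_def not_le dest: less_trans[OF exp_gt_zero])
  show "AE w in circ \<Otimes>\<^sub>M circ. \<exists>E. finite E \<and> (\<forall>t\<in>{t0 - 1<..<t0 + 1} - E.
         ((\<lambda>t. lnmax (exp t) Y U w) has_real_derivative (if ?A w < exp t then 1 else 0)) (at t))"
  proof (intro AE_I2 exI conjI ballI)
    \<comment> \<open>The excluded point is the corner of the maximum. If the modulus is zero,
      \<open>ln 0 = 0\<close> merely excludes one further harmless point.\<close>
    fix w t assume t: "t \<in> {t0 - 1<..<t0 + 1} - {ln (?A w)}"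
    show "((\<lambda>t. lnmax (exp t) Y U w) has_real_derivative (if ?A w < exp t then 1 else 0)) (at t)"
    proof (cases "?A w < exp t")
      case True
      have "((\<lambda>t. lnmax (exp t) Y U w) has_real_derivative 1) (at t)"
      proof (rule has_field_derivative_transform_within_open[where f="\<lambda>t. t" and S="{s. ?A w < exp s}"])
        show "open {s. ?A w < exp s}" by (intro open_Collect_less continuous_intros)
      qed (use True in \<open>auto simp: lnmax_def max_def\<close>)
      with True show ?thesis by simp
    next
      case False
      with t have gt: "exp t < ?A w" by (cases "exp t = ?A w") (auto, metis ln_exp)
      have "((\<lambda>t. lnmax (exp t) Y U w) has_real_derivative 0) (at t)"
      proof (rule has_field_derivative_transform_within_open[where f="\<lambda>t. ln (?A w)" and S="{s. exp s < ?A w}"])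
        show "open {s. exp s < ?A w}" by (intro open_Collect_less continuous_intros)
      qed (use gt in \<open>auto simp: lnmax_def max_def\<close>)
      with False show ?thesis by simp
    qed
  qed simp
  show "continuous_on {t0 - 1..t0 + 1} (\<lambda>t. \<integral>p. (if ?A p < exp t then 1 else (0::real)) \<partial>(circ \<Otimes>\<^sub>M circ))"
    using continuous_prob3[OF assms] unfolding prob3_def .
  show "(\<integral>p. \<bar>if ?A p < exp t then 1 else (0::real)\<bar> \<partial>(circ \<Otimes>\<^sub>M circ)) \<le> 1" for t
  proof -
    have "(\<integral>p. \<bar>if ?A p < exp t then 1 else (0::real)\<bar> \<partial>(circ \<Otimes>\<^sub>M circ)) \<le> (\<integral>p. 1 \<partial>(circ \<Otimes>\<^sub>M circ))"
      by (intro integral_mono integrable_abs integrable_prob3) auto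
    then show ?thesis by (simp add: space_pair_measure)
  qed
qed (auto intro!: integrable_lnmax integrable_prob3 assms)

lemma Ronkin_deriv:
  "((\<lambda>x. Ronkin lin3 (x, y, u)) has_real_derivative prob3 (exp x) (exp y) (exp u)) (at x)"
  "((\<lambda>y. Ronkin lin3 (x, y, u)) has_real_derivative prob3 (exp y) (exp x) (exp u)) (at y)"
  using lnmax_deriv[of "exp y" "exp u" x] lnmax_deriv[of "exp x" "exp u" y]
  unfolding Ronkin_lnmax(1)[of _ y u] Ronkin_lnmax(2)[of x _ u] by simp_all

section \<open>Abelian integrals with four real branch points\<close>

lemma denom_pos:
  assumes "0 \<le> c" "c < 1" "0 \<le> \<sigma>" "\<sigma> \<le> (1::real)"
  shows "1 - c * \<sigma> > 0"
proof -
  have "c * \<sigma> \<le> c" using assms by (simp add: mult_left_le)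
  then show ?thesis using assms by simp
qed

lemma sin2_bounds: "0 \<le> (sin \<phi>)\<^sup>2" "(sin \<phi>)\<^sup>2 \<le> (1::real)"
  by (auto simp: abs_square_le_1)

text \<open>The Moebius map below sends \<open>0\<close>, \<open>1\<close>, \<open>1 / elmod\<close>, \<open>\<infinity>\<close> to \<open>e2\<close>, \<open>e3\<close>, \<open>e4\<close>, \<open>e1\<close>;
  \<open>elchar\<close> is the reciprocal of its pole.\<close>
locale quartic =
  fixes e1 e2 e3 e4 :: real
  assumes e12: "e1 < e2" and e23: "e2 < e3" and e34: "e3 < e4"
begin

definition elchar :: real where "elchar = (e3 - e2) / (e3 - e1)"
text \<open>The squared modulus of Legendre's form, a cross ratio of the four branch points; it will
  turn out to be \<open>ksq\<close>, and \<open>elscale\<close> to be \<open>gfun\<close>.\<close>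

definition elmod :: real where "elmod = elchar * (e4 - e1) / (e4 - e2)"
definition elscale :: real where "elscale = 2 / sqrt ((e3 - e1) * (e4 - e2))"

definition moebius :: "real \<Rightarrow> real" where
  "moebius \<sigma> = e1 + (e2 - e1) / (1 - elchar * \<sigma>)"

definition quart :: "real \<Rightarrow> real" where
  "quart s = (s - e1) * (s - e2) * (e3 - s) * (e4 - s)"

text \<open>The pullback of ds / sqrt (quart s) under s = moebius (sin^2 of the angle).\<close>

definition elweight :: "real \<Rightarrow> real" where
  "elweight \<phi> = elscale / sqrt (1 - elmod * (sin \<phi>)\<^sup>2)"

lemma elchar_bounds: "0 < elchar" "elchar < 1"
  using e12 e23 by (auto simp: elchar_def)

lemma elmod_alt: "elmod = (e3 - e2) * (e4 - e1) / ((e3 - e1) * (e4 - e2))"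
  by (simp add: elmod_def elchar_def)

lemma elmod_bounds: "0 < elmod" "elmod < 1"
proof -
  show "0 < elmod" using e12 e23 e34 by (auto simp: elmod_alt)
  \<comment> \<open>The identity for the complementary cross ratio shows what 1 -
    \<open>elmod\<close> is: it vanishes only if an outer pair of branch points collides.\<close>
  have "(e3 - e1) * (e4 - e2) - (e3 - e2) * (e4 - e1) = (e2 - e1) * (e4 - e3)" by algebra
  also have "\<dots> > 0" using e12 e34 by simp
  finally show "elmod < 1" using e12 e23 e34 by (simp add: elmod_alt)
qed

lemma moebius_pos:
  assumes "0 \<le> \<sigma>" "\<sigma> \<le> 1"
  shows "1 - elchar * \<sigma> > 0" "1 - elmod * \<sigma> > 0"
  using denom_pos assms elchar_bounds elmod_bounds by auto

text \<open>Each factor of \<open>quart\<close> becomes a factor of Legendre's form over the same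
  pole factor, which will cancel against the derivative of the Moebius map.\<close>

lemma moebius_diff:
  assumes "0 \<le> \<sigma>" "\<sigma> \<le> 1"
  shows "moebius \<sigma> - e1 = (e2 - e1) / (1 - elchar * \<sigma>)"
    and "moebius \<sigma> - e2 = (e2 - e1) * elchar * \<sigma> / (1 - elchar * \<sigma>)"
    and "e3 - moebius \<sigma> = (e3 - e2) * (1 - \<sigma>) / (1 - elchar * \<sigma>)"
    and "e4 - moebius \<sigma> = (e4 - e2) * (1 - elmod * \<sigma>) / (1 - elchar * \<sigma>)"
proof -
  note D = moebius_pos(1)[OF assms]
  have n: "elchar * (e3 - e1) = e3 - e2" using e12 e23 by (simp add: elchar_def)
  have k: "elmod * (e4 - e2) = elchar * (e4 - e1)" using e12 e23 e34 by (simp add: elmod_def)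
  show "moebius \<sigma> - e1 = (e2 - e1) / (1 - elchar * \<sigma>)" by (simp add: moebius_def)
  have "(moebius \<sigma> - e2) * (1 - elchar * \<sigma>) = (e2 - e1) * elchar * \<sigma>"
    using D by (simp add: moebius_def field_simps)
  then show "moebius \<sigma> - e2 = (e2 - e1) * elchar * \<sigma> / (1 - elchar * \<sigma>)"
    using D by (simp add: eq_divide_eq)
  have "(e3 - moebius \<sigma>) * (1 - elchar * \<sigma>) = (e3 - e1) - (elchar * (e3 - e1)) * \<sigma> - (e2 - e1)"
    using D by (simp add: moebius_def field_simps)
  also have "\<dots> = (e3 - e2) * (1 - \<sigma>)" unfolding n by algebra
  finally show "e3 - moebius \<sigma> = (e3 - e2) * (1 - \<sigma>) / (1 - elchar * \<sigma>)"
    using D by (simp add: eq_divide_eq)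
  have "(e4 - moebius \<sigma>) * (1 - elchar * \<sigma>) = (e4 - e1) - (elchar * (e4 - e1)) * \<sigma> - (e2 - e1)"
    using D by (simp add: moebius_def field_simps)
  also have "\<dots> = (e4 - e2) * (1 - elmod * \<sigma>)" unfolding k[symmetric] by algebra
  finally show "e4 - moebius \<sigma> = (e4 - e2) * (1 - elmod * \<sigma>) / (1 - elchar * \<sigma>)"
    using D by (simp add: eq_divide_eq)
qed

lemma moebius_range:
  assumes "0 \<le> \<sigma>" "\<sigma> \<le> 1"
  shows "e2 \<le> moebius \<sigma>" "moebius \<sigma> \<le> e3"
proof -
  note D = moebius_pos(1)[OF assms]
  have "0 \<le> moebius \<sigma> - e2" unfolding moebius_diff(2)[OF assms]
    using D assms elchar_bounds e12 by simp
  then show "e2 \<le> moebius \<sigma>" by simp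
  have "0 \<le> e3 - moebius \<sigma>" unfolding moebius_diff(3)[OF assms]
    using D assms e23 by simp
  then show "moebius \<sigma> \<le> e3" by simp
qed

lemma moebius_range_strict:
  assumes "0 < \<sigma>" "\<sigma> < 1"
  shows "e2 < moebius \<sigma>" "moebius \<sigma> < e3"
proof -
  have D: "1 - elchar * \<sigma> > 0" using moebius_pos(1)[of \<sigma>] assms by simp
  have "0 < moebius \<sigma> - e2" using moebius_diff(2)[of \<sigma>] D assms elchar_bounds e12 by simp
  then show "e2 < moebius \<sigma>" by simp
  have "0 < e3 - moebius \<sigma>" using moebius_diff(3)[of \<sigma>] D assms e23 by simp
  then show "moebius \<sigma> < e3" by simp
qed

lemma moebius_surj:
  assumes "e2 < s" "s < e3"
  obtains \<sigma> where "0 < \<sigma>" "\<sigma> < 1" "moebius \<sigma> = s"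
proof
  \<comment> \<open>The quotient of the second difference in \<open>moebius_diff\<close> by the
    first is \<open>elchar * \<sigma>\<close>; solving for \<open>\<sigma>\<close> gives this
    inverse.\<close>
  let ?\<sigma> = "(s - e2) / (elchar * (s - e1))"
  have p: "s - e1 > 0" "s - e2 > 0" using assms e12 by auto
  have d: "1 - elchar * ?\<sigma> = (e2 - e1) / (s - e1)" using p elchar_bounds by (simp add: field_simps)
  show "0 < ?\<sigma>" using p elchar_bounds by simp
  show "moebius ?\<sigma> = s" unfolding moebius_def d using e12 p by simp
  have "(s - e2) * (e3 - e1) < (e3 - e2) * (s - e1)"
  proof -
    have "(e3 - e2) * (s - e1) - (s - e2) * (e3 - e1) = (e2 - e1) * (e3 - s)" by algebra
    also have "\<dots> > 0" using assms e12 by simp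
    finally show ?thesis by simp
  qed
  then have "s - e2 < elchar * (s - e1)"
    using e12 e23 by (simp add: elchar_def field_simps)
  then show "?\<sigma> < 1" using p elchar_bounds by (simp add: divide_less_eq)
qed

lemma continuous_on_moebius: "continuous_on S (\<lambda>\<phi>. moebius ((sin \<phi>)\<^sup>2))"
proof -
  have "1 - elchar * (sin x)\<^sup>2 \<noteq> 0" for x
    using moebius_pos(1)[OF sin2_bounds, of x] by simp
  then show ?thesis unfolding moebius_def by (intro continuous_intros) auto
qed

lemma continuous_on_elweight: "continuous_on S elweight"
proof -
  have "1 - elmod * (sin x)\<^sup>2 > 0" for x
    using moebius_pos(2)[OF sin2_bounds, of x] by simp
  then show ?thesis unfolding elweight_def[abs_def] by (intro continuous_intros) (auto simp: less_le)
qed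

lemma moebius_deriv:
  "((\<lambda>\<phi>. moebius ((sin \<phi>)\<^sup>2)) has_real_derivative
     (e2 - e1) * elchar * (2 * sin \<phi> * cos \<phi>) / (1 - elchar * (sin \<phi>)\<^sup>2)\<^sup>2) (at \<phi> within S)"
  unfolding moebius_def using moebius_pos(1)[OF sin2_bounds, of \<phi>]
  by (auto intro!: derivative_eq_intros simp: power2_eq_square)

text \<open>The square root of \<open>quart\<close> carries the pole factor to the power -2 and the
  factor sin cos, exactly as the derivative does; both cancel and only Legendre's radical
  survives.\<close>

lemma moebius_weight:
  assumes "\<phi> \<in> {0<..<pi/2}"
  shows "\<bar>(e2 - e1) * elchar * (2 * sin \<phi> * cos \<phi>) / (1 - elchar * (sin \<phi>)\<^sup>2)\<^sup>2\<bar> / sqrt (quart (moebius ((sin \<phi>)\<^sup>2))) = elweight \<phi>"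
proof -
  have sc: "sin \<phi> > 0" "cos \<phi> > 0" using assms by (auto intro: sin_gt_zero cos_gt_zero)
  let ?s = "(sin \<phi>)\<^sup>2"
  let ?D = "1 - elchar * ?s"
  note b = sin2_bounds[of \<phi>]
  note D = moebius_pos[OF b]
  note pos = elchar_bounds elmod_bounds e12 e23 e34
  have c: "1 - ?s = (cos \<phi>)\<^sup>2" by (simp add: cos_squared_eq)
  have "quart (moebius ?s) = ((e2 - e1) * elchar * sin \<phi> * cos \<phi> / ?D\<^sup>2)\<^sup>2 * ((e3 - e1) * (e4 - e2) * (1 - elmod * ?s))"
  proof -
    have n: "e3 - e2 = elchar * (e3 - e1)" using e12 e23 by (simp add: elchar_def)
    have "quart (moebius ?s) = ((e2 - e1) / ?D) * ((e2 - e1) * elchar * ?s / ?D) * (elchar * (e3 - e1) * (cos \<phi>)\<^sup>2 / ?D) * ((e4 - e2) * (1 - elmod * ?s) / ?D)"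
      unfolding quart_def moebius_diff[OF b] c n[symmetric] ..
    also have "\<dots> = ((e2 - e1) * elchar * sin \<phi> * cos \<phi> / ?D\<^sup>2)\<^sup>2 * ((e3 - e1) * (e4 - e2) * (1 - elmod * ?s))"
      using D(1) by (simp add: divide_simps) (simp add: power2_eq_square power4_eq_xxxx)
    finally show ?thesis .
  qed
  then have q: "sqrt (quart (moebius ?s)) = ((e2 - e1) * elchar * sin \<phi> * cos \<phi> / ?D\<^sup>2) * (sqrt ((e3 - e1) * (e4 - e2)) * sqrt (1 - elmod * ?s))"
    using sc pos by (simp add: real_sqrt_mult)
  have "\<bar>(e2 - e1) * elchar * (2 * sin \<phi> * cos \<phi>) / ?D\<^sup>2\<bar> = 2 * ((e2 - e1) * elchar * sin \<phi> * cos \<phi> / ?D\<^sup>2)"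
    using sc pos by simp
  moreover have "(e2 - e1) * elchar * sin \<phi> * cos \<phi> / ?D\<^sup>2 > 0" using sc pos D by simp
  moreover have "2 * T / (T * (a * b)) = 2 / a / b" if "T > 0" for T a b :: real
    using that by simp
  ultimately show ?thesis
    unfolding q elweight_def elscale_def by (simp only:)
qed

text \<open>The substitution absorbs the endpoint singularities: in the angle the integrand is
  continuous up to 0 and pi/2, hence absolutely integrable. Injectivity and the formula for the
  weight are needed only in the open interval.\<close>

lemma integral_quartic:
  assumes P: "continuous_on {e2..e3} P"
  shows "(\<lambda>s. P s / sqrt (quart s)) absolutely_integrable_on {e2<..<e3}"
    and "integral {e2<..<e3} (\<lambda>s. P s / sqrt (quart s)) = integral {0..pi/2} (\<lambda>\<phi>. P (moebius ((sin \<phi>)\<^sup>2)) * elweight \<phi>)"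
proof -
  let ?g = "\<lambda>\<phi>. moebius ((sin \<phi>)\<^sup>2)"
  let ?g' = "\<lambda>\<phi>. (e2 - e1) * elchar * (2 * sin \<phi> * cos \<phi>) / (1 - elchar * (sin \<phi>)\<^sup>2)\<^sup>2"
  let ?f = "\<lambda>s. P s / sqrt (quart s)"
  let ?I = "{0<..<pi/2}"
  have sb: "0 < (sin \<phi>)\<^sup>2" "(sin \<phi>)\<^sup>2 < 1" if "\<phi> \<in> ?I" for \<phi>
  proof -
    have "sin \<phi> > 0" "cos \<phi> > 0" using that by (auto intro: sin_gt_zero cos_gt_zero)
    then show "0 < (sin \<phi>)\<^sup>2" "(sin \<phi>)\<^sup>2 < 1"
      using sin_cos_squared_add[of \<phi>] zero_less_power[of "sin \<phi>" 2] zero_less_power[of "cos \<phi>" 2] by linarith+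
  qed
  have img: "?g ` ?I = {e2<..<e3}"
  proof (intro equalityI subsetI)
    fix s assume "s \<in> ?g ` ?I"
    then show "s \<in> {e2<..<e3}" using moebius_range_strict sb by auto
  next
    fix s assume "s \<in> {e2<..<e3}"
    then obtain \<sigma> where \<sigma>: "0 < \<sigma>" "\<sigma> < 1" "moebius \<sigma> = s" using moebius_surj by auto
    let ?p = "arcsin (sqrt \<sigma>)"
    have "sin ?p = sqrt \<sigma>" using \<sigma> by (intro sin_arcsin order_trans[of "-1" 0 "sqrt \<sigma>"]) auto
    moreover have "?p \<in> ?I"
      using arcsin_less_arcsin[of 0 "sqrt \<sigma>"] arcsin_less_arcsin[of "sqrt \<sigma>" 1] \<sigma>
        order_trans[of "-1" 0 "sqrt \<sigma>"] by auto
    ultimately show "s \<in> ?g ` ?I" using \<sigma> by (intro image_eqI[of _ _ ?p]) auto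
  qed
  have inj: "inj_on ?g ?I"
  proof (rule inj_onI)
    fix p q assume pq: "p \<in> ?I" "q \<in> ?I" "?g p = ?g q"
    have "1 - elchar * (sin p)\<^sup>2 > 0" "1 - elchar * (sin q)\<^sup>2 > 0" using moebius_pos(1)[OF sin2_bounds] by auto
    with pq(3) e12 elchar_bounds have "(sin p)\<^sup>2 = (sin q)\<^sup>2" by (simp add: moebius_def frac_eq_eq)
    moreover have "sin p > 0" "sin q > 0" using pq by (auto intro: sin_gt_zero)
    ultimately have "sin p = sin q" by (simp add: power2_eq_iff)
    then show "p = q" using sin_inj_pi[of p q] pq by auto
  qed
  have cont: "continuous_on {0..pi/2} (\<lambda>\<phi>. P (?g \<phi>) * elweight \<phi>)"
    by (intro continuous_intros continuous_on_elweight continuous_on_compose2[OF P continuous_on_moebius])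
      (use moebius_range[OF sin2_bounds] in auto)
  then have "(\<lambda>\<phi>. P (?g \<phi>) * elweight \<phi>) absolutely_integrable_on {0..pi/2}"
    by (rule absolutely_integrable_continuous_real)
  then have ai: "(\<lambda>\<phi>. P (?g \<phi>) * elweight \<phi>) absolutely_integrable_on ?I"
    by (rule set_integrable_subset) auto
  have eq: "\<bar>?g' \<phi>\<bar> * ?f (?g \<phi>) = P (?g \<phi>) * elweight \<phi>" if "\<phi> \<in> ?I" for \<phi>
    unfolding moebius_weight[OF that, symmetric] by simp
  have ai': "(\<lambda>\<phi>. \<bar>?g' \<phi>\<bar> * ?f (?g \<phi>)) absolutely_integrable_on ?I"
    using ai by (rule set_integrable_cong[THEN iffD1, rotated -1]) (use eq in auto)
  have int: "integral ?I (\<lambda>\<phi>. \<bar>?g' \<phi>\<bar> * ?f (?g \<phi>)) = integral {0..pi/2} (\<lambda>\<phi>. P (?g \<phi>) * elweight \<phi>)"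
  proof -
    have "integral ?I (\<lambda>\<phi>. \<bar>?g' \<phi>\<bar> * ?f (?g \<phi>)) = integral ?I (\<lambda>\<phi>. P (?g \<phi>) * elweight \<phi>)"
      by (rule integral_cong) (use eq in auto)
    also have "\<dots> = integral {0..pi/2} (\<lambda>\<phi>. P (?g \<phi>) * elweight \<phi>)"
      by (rule integral_open_interval_real[symmetric])
    finally show ?thesis .
  qed
  have "?I \<in> sets lebesgue" by simp
  \<comment> \<open>The equivalence is read from the angle, where integrability is clear, back to
    the singular integrand in s.\<close>
  from has_absolute_integral_change_of_variables_1'[OF this moebius_deriv inj, THEN iffD1, OF conjI[OF ai' int]]
  show "?f absolutely_integrable_on {e2<..<e3}"
    "integral {e2<..<e3} ?f = integral {0..pi/2} (\<lambda>\<phi>. P (?g \<phi>) * elweight \<phi>)"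
    unfolding img by auto
qed

end


text \<open>The branch points; off the contour they are listed in strictly increasing order.\<close>
definition E1 :: "real \<Rightarrow> real \<Rightarrow> real \<Rightarrow> real" where "E1 X Y U = min ((1 - X)\<^sup>2) ((Y - U)\<^sup>2)"
definition E2 :: "real \<Rightarrow> real \<Rightarrow> real \<Rightarrow> real" where "E2 X Y U = max ((1 - X)\<^sup>2) ((Y - U)\<^sup>2)"
definition E3 :: "real \<Rightarrow> real \<Rightarrow> real \<Rightarrow> real" where "E3 X Y U = min ((1 + X)\<^sup>2) ((Y + U)\<^sup>2)"
definition E4 :: "real \<Rightarrow> real \<Rightarrow> real \<Rightarrow> real" where "E4 X Y U = max ((1 + X)\<^sup>2) ((Y + U)\<^sup>2)"

text \<open>Heron's expression: sixteen times the squared area of a triangle with sides sqrt s, Y,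
  U. It is positive exactly if the triangle exists and is nondegenerate.\<close>

definition Wsq :: "real \<Rightarrow> real \<Rightarrow> real \<Rightarrow> real" where
  "Wsq Y U s = (s - (Y - U)\<^sup>2) * ((Y + U)\<^sup>2 - s)"

locale quartic_XYU = quartic "E1 X Y U" "E2 X Y U" "E3 X Y U" "E4 X Y U" for X Y U :: real +
  assumes pos: "X > 0" "Y > 0" "U > 0"
begin

lemma quart_eq: "quart s = ((s - (1 - X)\<^sup>2) * ((1 + X)\<^sup>2 - s)) * Wsq Y U s"
proof -
  have "(s - E1 X Y U) * (s - E2 X Y U) = (s - (1 - X)\<^sup>2) * (s - (Y - U)\<^sup>2)"
    and "(E3 X Y U - s) * (E4 X Y U - s) = ((1 + X)\<^sup>2 - s) * ((Y + U)\<^sup>2 - s)"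
    by (auto simp: E1_def E2_def E3_def E4_def min_def max_def)
  then show ?thesis unfolding quart_def Wsq_def by algebra
qed

lemma E2_pos: "E2 X Y U > 0"
  using e12 by (simp add: E1_def E2_def) (smt (verit) zero_le_power2)

lemma cmod_sq_gt:
  assumes "a \<in> {0<..<pi}"
  shows "(1 - X)\<^sup>2 < cmod_sq X a" "cmod_sq X a < (1 + X)\<^sup>2"
proof -
  have "cos a < 1" "cos a > -1"
    using assms cos_monotone_0_pi[of 0 a] cos_monotone_0_pi[of a pi] by auto
  then have "0 < 2 * X * (1 + cos a)" "0 < 2 * X * (1 - cos a)" using pos by auto
  moreover have "cmod_sq X a - (1 - X)\<^sup>2 = 2 * X * (1 + cos a)" "(1 + X)\<^sup>2 - cmod_sq X a = 2 * X * (1 - cos a)"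
    unfolding cmod_sq_def by algebra+
  ultimately show "(1 - X)\<^sup>2 < cmod_sq X a" "cmod_sq X a < (1 + X)\<^sup>2" by linarith+
qed

lemma cmod_sq_diff: "(cmod_sq X a - (1 - X)\<^sup>2) * ((1 + X)\<^sup>2 - cmod_sq X a) = (2 * X * sin a)\<^sup>2"
proof -
  have "(cmod_sq X a - (1 - X)\<^sup>2) * ((1 + X)\<^sup>2 - cmod_sq X a) = 4 * X\<^sup>2 * (1 - (cos a)\<^sup>2)"
    unfolding cmod_sq_def by algebra
  then show ?thesis by (simp add: sin_squared_eq[symmetric] power_mult_distrib)
qed

text \<open>With s = \<open>cmod_sq X a\<close> the derivative -2 X sin a is, up to sign, the root
  of (s - (1 - X)^2) ((1 + X)^2 - s). The law of s under \<open>circ\<close> thus supplies the two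
  factors of the quartic that \<open>Wsq\<close> lacks.\<close>

lemma integral_circ_quartic:
  assumes Pm: "P \<in> borel_measurable borel" and P: "continuous_on {E2 X Y U..E3 X Y U} P"
  defines "h \<equiv> \<lambda>a. if (Y - U)\<^sup>2 < cmod_sq X a \<and> cmod_sq X a < (Y + U)\<^sup>2 then P (cmod_sq X a) / sqrt (Wsq Y U (cmod_sq X a)) else 0"
  shows "integrable circ h"
    and "(\<integral>a. h a \<partial>circ) = integral {0..pi/2} (\<lambda>\<phi>. P (moebius ((sin \<phi>)\<^sup>2)) * elweight \<phi>) / pi"
proof -
  let ?J = "{E2 X Y U<..<E3 X Y U}"
  \<comment> \<open>The angles for which s lies between the middle branch points. On the rest of (0,
    pi) the function \<open>h\<close> vanishes, because s is confined between (1 - X)^2 and (1 +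
    X)^2 anyway.\<close>
  let ?A = "{0<..<pi} \<inter> {a. E2 X Y U < cmod_sq X a \<and> cmod_sq X a < E3 X Y U}"
  let ?f = "\<lambda>s. P s / sqrt (quart s)"
  let ?g' = "\<lambda>a. - 2 * X * sin a"
  have csq: "continuous_on UNIV (cmod_sq X)" unfolding cmod_sq_def[abs_def] by (intro continuous_intros)
  have "open ?A"
    by (intro open_Int open_Collect_conj open_Collect_less continuous_intros csq)
  then have Aleb: "?A \<in> sets lebesgue" by (intro sets_completionI_sets) simp
  have der: "(cmod_sq X has_real_derivative ?g' a) (at a within ?A)" for a
    unfolding cmod_sq_def[abs_def] by (auto intro!: derivative_eq_intros)
  have inj: "inj_on (cmod_sq X) ?A"
  proof (rule inj_onI)
    fix a b assume "a \<in> ?A" "b \<in> ?A" "cmod_sq X a = cmod_sq X b"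
    then show "a = b" using pos cos_inj_pi[of a b] by (auto simp: cmod_sq_def)
  qed
  have img: "cmod_sq X ` ?A = ?J"
  proof (intro equalityI subsetI)
    fix s assume s: "s \<in> ?J"
    then have b: "(1 - X)\<^sup>2 < s" "s < (1 + X)\<^sup>2" by (auto simp: E2_def E3_def)
    let ?c = "(s - 1 - X\<^sup>2) / (2 * X)"
    have c: "-1 < ?c" "?c < 1" using b pos by (auto simp: field_simps power2_eq_square)
    have "cmod_sq X (arccos ?c) = s" using c pos by (simp add: cmod_sq_def)
    moreover have "arccos ?c \<in> {0<..<pi}" using arccos_lt_bounded[OF c] by auto
    ultimately show "s \<in> cmod_sq X ` ?A" using s by (intro image_eqI[of _ _ "arccos ?c"]) auto
  qed auto
  have eq: "\<bar>?g' a\<bar> * ?f (cmod_sq X a) = h a" if a: "a \<in> ?A" for a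
  proof -
    have sa: "sin a > 0" using a by (auto intro: sin_gt_zero)
    have "sqrt (quart (cmod_sq X a)) = 2 * X * sin a * sqrt (Wsq Y U (cmod_sq X a))"
      unfolding quart_eq cmod_sq_diff using sa pos by (simp add: real_sqrt_mult)
    moreover have "\<bar>?g' a\<bar> = 2 * X * sin a" using sa pos by simp
    ultimately show ?thesis using a sa pos by (auto simp: h_def E2_def E3_def)
  qed
  have h0: "h a = (if a \<in> ?A then h a else 0)" if "a \<in> {0<..<pi}" for a
    using that cmod_sq_gt[OF that] by (auto simp: h_def E2_def E3_def)
  note I = integral_quartic[OF P]
  from has_absolute_integral_change_of_variables_1'[OF Aleb der inj, THEN iffD2, unfolded img, OF conjI[OF I]]
  have 1: "(\<lambda>a. \<bar>?g' a\<bar> * ?f (cmod_sq X a)) absolutely_integrable_on ?A"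
    and 2: "integral ?A (\<lambda>a. \<bar>?g' a\<bar> * ?f (cmod_sq X a)) = integral {0..pi/2} (\<lambda>\<phi>. P (moebius ((sin \<phi>)\<^sup>2)) * elweight \<phi>)"
    by auto
  have 3: "h absolutely_integrable_on ?A"
    using 1 by (rule set_integrable_cong[THEN iffD1, rotated -1]) (use eq in auto)
  have 4: "integral ?A h = integral {0..pi/2} (\<lambda>\<phi>. P (moebius ((sin \<phi>)\<^sup>2)) * elweight \<phi>)"
    unfolding 2[symmetric] by (rule integral_cong) (use eq in auto)
  have restr: "(if a \<in> {0<..<pi} then h a else 0) = (if a \<in> ?A then h a else 0)" for a
    using h0[of a] by auto
  have 5: "h absolutely_integrable_on {0<..<pi}"
    using 3 unfolding absolutely_integrable_restrict_UNIV[symmetric, of _ h] restr .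
  have 6: "integral {0<..<pi} h = integral {0..pi/2} (\<lambda>\<phi>. P (moebius ((sin \<phi>)\<^sup>2)) * elweight \<phi>)"
    unfolding 4[symmetric] unfolding integral_restrict_UNIV[symmetric, of _ h] restr ..
  \<comment> \<open>\<open>h\<close> depends on the angle only through its cosine; \<open>H\<close>
    makes this explicit for \<open>integral_circ_cos\<close>.\<close>
  define H where "H = (\<lambda>c. if (Y - U)\<^sup>2 < 1 + X\<^sup>2 + 2 * X * c \<and> 1 + X\<^sup>2 + 2 * X * c < (Y + U)\<^sup>2
     then P (1 + X\<^sup>2 + 2 * X * c) / sqrt (Wsq Y U (1 + X\<^sup>2 + 2 * X * c)) else 0)"
  note [measurable] = Pm
  have [measurable]: "H \<in> borel_measurable borel" unfolding H_def Wsq_def by measurable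
  have hH: "h = (\<lambda>a. H (cos a))" unfolding h_def H_def cmod_sq_def ..
  have hm[measurable]: "h \<in> borel_measurable borel" unfolding hH by measurable
  have 7: "set_integrable lborel {0<..<pi} h"
    using 5 unfolding set_integrable_def by (subst (asm) integrable_completion) auto
  show "integrable circ h"
    using 7 integral_circ_cos(1)[of H] by (simp add: hH)
  have "(LINT a:{0<..<pi}|lborel. h a) = integral {0<..<pi} h"
    using set_borel_integral_eq_integral(2)[OF 7] .
  then show "(\<integral>a. h a \<partial>circ) = integral {0..pi/2} (\<lambda>\<phi>. P (moebius ((sin \<phi>)\<^sup>2)) * elweight \<phi>) / pi"
    using integral_circ_cos(2)[of H] by (simp add: hH[symmetric] 6)
qed

end

section \<open>The hypergeometric series as complete elliptic integrals\<close>

text \<open>The central binomial coefficient (2j choose j) / 4^j: both the Taylor coefficient of (1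
  - z)^(-1/2) and the normalised Wallis integral.\<close>

definition binc :: "nat \<Rightarrow> real" where "binc j = pochhammer (1/2) j / fact j"

lemma binc_0[simp]: "binc 0 = 1" by (simp add: binc_def)

lemma binc_Suc: "binc (Suc j) = binc j * (2 * real j + 1) / (2 * real j + 2)"
  by (simp add: binc_def pochhammer_Suc field_simps)

lemma binc_nonneg: "0 \<le> binc j"
  by (induction j) (auto simp: binc_Suc)

text \<open>The reduction formula comes from differentiating -cos x sin^(2j+1) x, which vanishes at
  both endpoints.\<close>

lemma Wallis_integral:
  "((\<lambda>\<phi>. (sin \<phi>) ^ (2 * j)) has_integral pi / 2 * binc j) {0..pi/2}"
proof (induction j)
  case 0
  show ?case using has_integral_const_real[of "1::real" 0 "pi/2"] by simp
next
  case (Suc j)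
  have "((\<lambda>\<phi>. (2 * real j + 2) * (sin \<phi>) ^ (2 * Suc j) - (2 * real j + 1) * (sin \<phi>) ^ (2 * j)) has_integral
      (- cos (pi/2) * sin (pi/2) ^ Suc (2 * j) - - cos 0 * sin 0 ^ Suc (2 * j))) {0..pi/2}"
  proof (rule fundamental_theorem_of_calculus)
    fix x :: real
    have "((\<lambda>x. sin x ^ Suc (2 * j)) has_real_derivative (1 + real (2 * j)) * (cos x * sin x ^ (2 * j))) (at x within {0..pi/2})"
      by (rule DERIV_power_Suc) (auto intro!: derivative_eq_intros)
    from DERIV_mult[OF DERIV_minus[OF DERIV_subset[OF DERIV_cos]] this]
    have "((\<lambda>x. - cos x * sin x ^ Suc (2 * j)) has_real_derivative
        sin x * sin x ^ Suc (2 * j) - (2 * real j + 1) * (cos x)\<^sup>2 * sin x ^ (2 * j)) (at x within {0..pi/2})"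
      by (simp add: power2_eq_square algebra_simps)
    also have "sin x * sin x ^ Suc (2 * j) - (2 * real j + 1) * (cos x)\<^sup>2 * sin x ^ (2 * j)
        = (2 * real j + 2) * (sin x) ^ (2 * Suc j) - (2 * real j + 1) * (sin x) ^ (2 * j)"
    proof -
      have *: "sin x ^ (2 * Suc j) = (sin x)\<^sup>2 * sin x ^ (2 * j)" "sin x * sin x ^ Suc (2 * j) = (sin x)\<^sup>2 * sin x ^ (2 * j)"
        by (simp_all add: power2_eq_square)
      show ?thesis unfolding cos_squared_eq * by algebra
    qed
    finally show "((\<lambda>x. - cos x * sin x ^ Suc (2 * j)) has_vector_derivative
        (2 * real j + 2) * (sin x) ^ (2 * Suc j) - (2 * real j + 1) * (sin x) ^ (2 * j)) (at x within {0..pi/2})"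
      by (simp only: has_real_derivative_iff_has_vector_derivative)
  qed simp
  from has_integral_add[OF this has_integral_mult_right[OF Suc, of "2 * real j + 1"]]
  have "((\<lambda>\<phi>. (2 * real j + 2) * (sin \<phi>) ^ (2 * Suc j)) has_integral (2 * real j + 1) * (pi / 2 * binc j)) {0..pi/2}"
    by simp
  from has_integral_mult_right[OF this, of "1 / (2 * real j + 2)"]
  have "((\<lambda>\<phi>. (sin \<phi>) ^ (2 * Suc j)) has_integral (1 / (2 * real j + 2)) * ((2 * real j + 1) * (pi / 2 * binc j))) {0..pi/2}"
    by (rule has_integral_eq[rotated]) (simp add: add_nonneg_eq_0_iff)
  then show ?case by (simp add: binc_Suc mult_ac)
qed

lemma binc_sums:
  assumes "\<bar>z\<bar> < 1"
  shows "(\<lambda>l. binc l * z ^ l) sums (1 / sqrt (1 - z))"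
proof -
  have "(\<lambda>n. ((-1/2) gchoose n) * (-z)^n) sums (1 + (-z)) powr (-1/2)"
    by (rule gen_binomial_real) (use assms in auto)
  moreover have "((-1/2) gchoose n) * (-z)^n = binc n * z ^ n" for n
    by (simp add: gbinomial_pochhammer binc_def flip: power_mult_distrib)
  moreover have "(1 + (-z)) powr (-1/2) = 1 / sqrt (1 - z)"
  proof -
    have "(1 - z) powr (- (1/2)) = inverse (sqrt (1 - z))"
      using assms by (subst powr_minus, subst powr_half_sqrt) auto
    then show ?thesis by (simp add: inverse_eq_divide)
  qed
  ultimately show ?thesis by simp
qed

lemma sums_integral_uniform:
  fixes f :: "nat \<Rightarrow> real \<Rightarrow> real"
  assumes cont: "\<And>n. continuous_on {a..b} (f n)"
    and bd: "\<And>n x. x \<in> {a..b} \<Longrightarrow> \<bar>f n x\<bar> \<le> M n" and M: "summable M"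
    and s: "\<And>x. x \<in> {a..b} \<Longrightarrow> (\<lambda>n. f n x) sums g x"
  shows "(\<lambda>n. integral {a..b} (f n)) sums integral {a..b} g"
proof -
  have "uniform_limit {a..b} (\<lambda>n x. \<Sum>i<n. f i x) (\<lambda>x. suminf (\<lambda>i. f i x)) sequentially"
    by (rule Weierstrass_m_test) (use bd M in auto)
  then have "uniform_limit {a..b} (\<lambda>n x. \<Sum>i<n. f i x) g sequentially"
    by (rule uniform_limit_cong'[THEN iffD1, rotated -1]) (use s in \<open>auto simp: sums_iff\<close>)
  then obtain I J where IJ: "\<And>n. ((\<lambda>x. \<Sum>i<n. f i x) has_integral I n) {a..b}" "(g has_integral J) {a..b}" "I \<longlonglongrightarrow> J"
    by (rule uniform_limit_integral) (auto intro!: continuous_intros cont)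
  have "I n = (\<Sum>i<n. integral {a..b} (f i))" for n
  proof -
    have "((\<lambda>x. \<Sum>i<n. f i x) has_integral (\<Sum>i<n. integral {a..b} (f i))) {a..b}"
      by (intro has_integral_sum integrable_integral integrable_continuous_real cont) auto
    with IJ(1) show ?thesis by (rule has_integral_unique)
  qed
  then have "I = (\<lambda>n. \<Sum>i<n. integral {a..b} (f i))" by (rule ext)
  with IJ(3) show ?thesis by (simp only: sums_def integral_unique[OF IJ(2)])
qed

text \<open>Parameter convention, here and for \<open>ellPi\<close>: \<open>k\<close> stands for the
  squared modulus, so it enters the radical without a further square.\<close>

definition ellK :: "real \<Rightarrow> real" where
  "ellK k = integral {0..pi/2} (\<lambda>\<phi>. 1 / sqrt (1 - k * (sin \<phi>)\<^sup>2))"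

definition ellPi :: "real \<Rightarrow> real \<Rightarrow> real" where
  "ellPi n k = integral {0..pi/2} (\<lambda>\<phi>. 1 / (1 - n * (sin \<phi>)\<^sup>2) / sqrt (1 - k * (sin \<phi>)\<^sup>2))"

lemma mult_sin2_le:
  fixes \<phi> k :: real
  assumes "0 \<le> k"
  shows "0 \<le> k * (sin \<phi>)\<^sup>2" "k * (sin \<phi>)\<^sup>2 \<le> k"
  using assms sin2_bounds[of \<phi>] by (auto simp: mult_left_le)

text \<open>The power of the sine anticipates the geometric expansion of the characteristic factor
  in \<open>ellPi\<close>; m = 0 gives the series of \<open>ellK\<close>.\<close>

lemma elliptic_inner_sums:
  assumes "0 \<le> k" "k < 1"
  shows "(\<lambda>l. k ^ l * binc l * (pi / 2 * binc (m + l))) sums integral {0..pi/2} (\<lambda>\<phi>. (sin \<phi>) ^ (2 * m) / sqrt (1 - k * (sin \<phi>)\<^sup>2))"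
proof -
  have b: "\<bar>k * (sin \<phi>)\<^sup>2\<bar> < 1" for \<phi>
    using mult_sin2_le[OF assms(1), of \<phi>] assms by simp
  have I: "(\<lambda>l. integral {0..pi/2} (\<lambda>\<phi>. binc l * (k * (sin \<phi>)\<^sup>2) ^ l * (sin \<phi>) ^ (2 * m))) sums
      integral {0..pi/2} (\<lambda>\<phi>. 1 / sqrt (1 - k * (sin \<phi>)\<^sup>2) * (sin \<phi>) ^ (2 * m))"
  proof (rule sums_integral_uniform)
    show "summable (\<lambda>l. binc l * k ^ l)" using binc_sums[of k] assms by (simp add: sums_iff)
    show "(\<lambda>l. binc l * (k * (sin x)\<^sup>2) ^ l * (sin x) ^ (2 * m)) sums (1 / sqrt (1 - k * (sin x)\<^sup>2) * (sin x) ^ (2 * m))" for x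
      by (rule sums_mult2[OF binc_sums[OF b]])
    show "\<bar>binc l * (k * (sin x)\<^sup>2) ^ l * (sin x) ^ (2 * m)\<bar> \<le> binc l * k ^ l" for l x
    proof -
      have "\<bar>binc l * (k * (sin x)\<^sup>2) ^ l * (sin x) ^ (2 * m)\<bar> = binc l * (k * (sin x)\<^sup>2) ^ l * ((sin x)\<^sup>2) ^ m"
        using binc_nonneg assms by (simp add: power_mult)
      also have "\<dots> \<le> binc l * k ^ l * 1"
        by (intro mult_mono power_mono mult_sin2_le assms binc_nonneg mult_nonneg_nonneg power_le_one sin2_bounds order_refl zero_le_power)
      finally show ?thesis by simp
    qed
  qed (intro continuous_intros)
  have h: "integral {0..pi/2} (\<lambda>\<phi>. binc l * (k * (sin \<phi>)\<^sup>2) ^ l * (sin \<phi>) ^ (2 * m)) = k ^ l * binc l * (pi / 2 * binc (m + l))" for l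
  proof -
    have "(\<lambda>\<phi>. binc l * (k * (sin \<phi>)\<^sup>2) ^ l * (sin \<phi>) ^ (2 * m)) = (\<lambda>\<phi>. k ^ l * binc l * (sin \<phi>) ^ (2 * (m + l)))"
      by (simp add: power_mult_distrib power_add power_mult fun_eq_iff)
    then show ?thesis
      by (simp only:) (rule integral_unique, rule has_integral_mult_right, rule Wallis_integral)
  qed
  from I show ?thesis unfolding h by (simp add: mult.commute)
qed

lemma ellK_has_sum:
  assumes "0 \<le> k" "k < 1"
  shows "((\<lambda>l. pi / 2 * (binc l * binc l * k ^ l)) has_sum ellK k) UNIV"
  using elliptic_inner_sums[OF assms, of 0] unfolding ellK_def
  by (intro sums_nonneg_imp_has_sum) (auto simp: binc_nonneg mult_ac assms)

text \<open>The characteristic factor is expanded first as a geometric series, the radical second as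
  a binomial series. All terms are nonnegative, so the iterated sum is an unconditional double sum,
  as the definition of the hypergeometric series requires.\<close>

lemma ellPi_has_sum:
  assumes n: "0 \<le> n" "n < 1" and k: "0 \<le> k" "k < 1"
  shows "((\<lambda>(m, l). pi / 2 * (n ^ m * k ^ l * binc l * binc (m + l))) has_sum ellPi n k) UNIV"
proof -
  let ?I = "\<lambda>m. integral {0..pi/2} (\<lambda>\<phi>. (sin \<phi>) ^ (2 * m) / sqrt (1 - k * (sin \<phi>)\<^sup>2))"
  have b: "1 - k * (sin \<phi>)\<^sup>2 \<ge> 1 - k" for \<phi>
    using mult_sin2_le[OF k(1), of \<phi>] by simp
  then have b0: "1 - k * (sin \<phi>)\<^sup>2 > 0" for \<phi> using k by (smt (verit))
  have inner: "((\<lambda>l. n ^ m * (k ^ l * binc l * (pi / 2 * binc (m + l)))) has_sum n ^ m * ?I m) UNIV" for m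
    by (intro sums_nonneg_imp_has_sum sums_mult elliptic_inner_sums k mult_nonneg_nonneg binc_nonneg zero_le_power n) auto
  have "(\<lambda>m. integral {0..pi/2} (\<lambda>\<phi>. (n * (sin \<phi>)\<^sup>2) ^ m / sqrt (1 - k * (sin \<phi>)\<^sup>2))) sums ellPi n k"
    unfolding ellPi_def
  proof (rule sums_integral_uniform)
    show "summable (\<lambda>m. n ^ m / sqrt (1 - k))" using n by (intro summable_divide summable_geometric) auto
    show "\<bar>(n * (sin x)\<^sup>2) ^ m / sqrt (1 - k * (sin x)\<^sup>2)\<bar> \<le> n ^ m / sqrt (1 - k)" for m x
    proof -
      have "\<bar>(n * (sin x)\<^sup>2) ^ m / sqrt (1 - k * (sin x)\<^sup>2)\<bar> = (n * (sin x)\<^sup>2) ^ m / sqrt (1 - k * (sin x)\<^sup>2)"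
        using n b0[of x] by simp
      also have "\<dots> \<le> n ^ m / sqrt (1 - k)"
        using k b[of x] b0[of x] mult_sin2_le[OF n(1), of x] by (intro frac_le power_mono zero_le_power n) auto
      finally show ?thesis .
    qed
    show "(\<lambda>m. (n * (sin x)\<^sup>2) ^ m / sqrt (1 - k * (sin x)\<^sup>2)) sums (1 / (1 - n * (sin x)\<^sup>2) / sqrt (1 - k * (sin x)\<^sup>2))" for x
      using mult_sin2_le[OF n(1), of x] n by (intro sums_divide geometric_sums) auto
    show "continuous_on {0..pi / 2} (\<lambda>\<phi>. (n * (sin \<phi>)\<^sup>2) ^ m / sqrt (1 - k * (sin \<phi>)\<^sup>2))" for m
      using b0 by (intro continuous_intros) (auto simp: less_le)
  qed
  moreover have "integral {0..pi/2} (\<lambda>\<phi>. (n * (sin \<phi>)\<^sup>2) ^ m / sqrt (1 - k * (sin \<phi>)\<^sup>2)) = n ^ m * ?I m" for m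
    by (subst integral_mult_right[symmetric]) (simp add: power_mult_distrib power_mult)
  ultimately have "(\<lambda>m. n ^ m * ?I m) sums ellPi n k" by simp
  then have outer: "((\<lambda>m. n ^ m * ?I m) has_sum ellPi n k) UNIV"
  proof (rule sums_nonneg_imp_has_sum)
    show "0 \<le> n ^ m * ?I m" for m
      using has_sum_nonneg[OF inner[of m]] by (simp add: binc_nonneg n k)
  qed
  have "((\<lambda>(m, l). n ^ m * (k ^ l * binc l * (pi / 2 * binc (m + l)))) has_sum ellPi n k) (Sigma UNIV (\<lambda>_. UNIV))"
  proof (rule has_sum_SigmaI[OF _ outer])
    show "(\<lambda>(m, l). n ^ m * (k ^ l * binc l * (pi / 2 * binc (m + l)))) summable_on Sigma UNIV (\<lambda>_. UNIV)"
      using inner outer by (intro summable_on_SigmaI[where g="\<lambda>m. n ^ m * ?I m"])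
        (auto simp: binc_nonneg n k has_sum_imp_summable)
  qed (use inner in simp)
  then show ?thesis by (simp add: mult_ac case_prod_unfold)
qed

section \<open>Gamma factors and identification of the two series\<close>

lemma rGamma_half_minus:
  "rGamma (1/2 - of_nat m :: complex) = of_real ((-1) ^ m * pochhammer (1/2) m / sqrt pi)"
proof (induction m)
  case 0
  show ?case by (simp add: rGamma_inverse_Gamma Gamma_one_half_complex inverse_eq_divide)
next
  case (Suc m)
  have "rGamma (1/2 - of_nat (Suc m) :: complex) = (1/2 - of_nat (Suc m)) * rGamma (1/2 - of_nat (Suc m) + 1)"
    by (rule rGamma_plus1[symmetric])
  also have "1/2 - of_nat (Suc m) + 1 = (1/2 - of_nat m :: complex)" by simp
  also have "(1/2 - of_nat (Suc m) :: complex) * rGamma (1/2 - of_nat m) = of_real ((-1) ^ Suc m * pochhammer (1/2) (Suc m) / sqrt pi)"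
    unfolding Suc by (simp add: pochhammer_Suc field_simps)
  finally show ?case .
qed

lemma rGamma_Suc_nat: "rGamma (of_nat m + 1 :: complex) = of_real (1 / fact m)"
  using Gamma_fact[of m, where 'a=complex] by (simp add: rGamma_inverse_Gamma add.commute divide_inverse)

lemma rGamma_neg_int:
  assumes "i < (0::int)"
  shows "rGamma (of_int i + 1 :: complex) = 0"
proof -
  have "rGamma (of_int (i + 1) :: complex) = 0" using assms by (subst rGamma_of_int) auto
  then show ?thesis by simp
qed

abbreviation (input) Phi1 :: "complex \<Rightarrow> complex" where
  "Phi1 z \<equiv> hyp_Phi [-1/2, -1/2, 0] [[-1], [-1], [1], [1]] [1, 1, 1, z]"

abbreviation (input) Phi2 :: "complex \<Rightarrow> complex \<Rightarrow> complex" where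
  "Phi2 z1 z2 \<equiv> hyp_Phi_tilde [-1, 0, -1/2, -1/2]
     [[-1, 0], [1, 1], [0, -1], [-1, -1], [1, 0], [0, 1]] [1, 1, 1, 1, z1, z2]"

text \<open>The two signs from Gamma (1/2 - m)^2 cancel and leave \<open>binc m\<close> squared over
  pi. The constant is (1 / pi) (2 / pi): the first factor comes from Gamma (1/2)^2 = pi, the second
  undoes the Wallis constant.\<close>

lemma Phi1_eq:
  assumes "0 < k" "k < 1"
  shows "Phi1 (of_real k) = of_real (2 / pi\<^sup>2 * ellK k)"
proof -
  let ?T = "\<lambda>\<kappa>. hyp_monomial [-1/2, -1/2, 0] [[-1], [-1], [1], [1]] [1, 1, 1, of_real k] \<kappa> *
      (\<Prod>j<length [-1/2, -1/2, 0::complex]. rGamma ([-1/2, -1/2, 0::complex] ! j + of_int (row_dot ([[-1], [-1], [1], [1]] ! j) \<kappa>) + 1)) *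
      inv_fact \<kappa>"
  have T: "?T [int m] = of_real (2 / pi\<^sup>2 * (pi / 2 * (binc m * binc m * k ^ m)))" for m
  proof -
    have g: "rGamma (-1/2 - of_nat m + 1 :: complex) = of_real ((-1) ^ m * pochhammer (1/2) m / sqrt pi)"
      using rGamma_half_minus[of m] by (simp add: algebra_simps)
    have g': "rGamma (-1/2 + of_int (- int m) + 1 :: complex) = of_real ((-1) ^ m * pochhammer (1/2) m / sqrt pi)"
      using g by simp
    \<comment> \<open>Positivity of \<open>k\<close> matters: with \<open>0 powr 0 = 0\<close> even
      the term m = 0 would vanish at k = 0.\<close>
    have mon: "hyp_monomial [-1/2, -1/2, 0] [[-1], [-1], [1], [1]] [1, 1, 1, of_real k] [int m] = of_real k ^ m"
      using assms by (simp add: hyp_monomial_def row_dot_def lessThan_Suc powr_nat')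
    have gam: "(\<Prod>j<length [-1/2, -1/2, 0::complex]. rGamma ([-1/2, -1/2, 0::complex] ! j + of_int (row_dot ([[-1], [-1], [1], [1]] ! j) [int m]) + 1))
      = of_real (1 / fact m) * (of_real ((-1) ^ m * pochhammer (1/2) m / sqrt pi) * of_real ((-1) ^ m * pochhammer (1/2) m / sqrt pi))"
      using g' by (simp add: row_dot_def lessThan_Suc rGamma_Suc_nat)
    have inv: "inv_fact [int m] = of_real (1 / fact m)"
      by (simp add: inv_fact_def lessThan_Suc rGamma_Suc_nat)
    have "?T [int m] = of_real (k ^ m * (1 / fact m * (((-1) ^ m * pochhammer (1/2) m / sqrt pi) * ((-1) ^ m * pochhammer (1/2) m / sqrt pi))) * (1 / fact m))"
      unfolding mon gam inv by (simp only: of_real_mult of_real_power)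
    also have "k ^ m * (1 / fact m * (((-1) ^ m * pochhammer (1/2) m / sqrt pi) * ((-1) ^ m * pochhammer (1/2) m / sqrt pi))) * (1 / fact m)
      = 2 / pi\<^sup>2 * (pi / 2 * (binc m * binc m * k ^ m))"
    proof -
      have "((-1) ^ m * pochhammer (1/2) m / sqrt pi) * ((-1) ^ m * pochhammer (1/2) m / sqrt pi) = (pochhammer (1/2) m)\<^sup>2 / pi"
        by (simp add: power2_eq_square flip: power_mult_distrib)
      then show ?thesis by (simp only:) (simp add: binc_def power2_eq_square mult_ac)
    qed
    finally show ?thesis .
  qed
  have "((\<lambda>m. of_real (2 / pi\<^sup>2 * (pi / 2 * (binc m * binc m * k ^ m)))) has_sum (of_real (2 / pi\<^sup>2 * ellK k) :: complex)) UNIV"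
    by (intro has_sum_of_real has_sum_cmult_right ellK_has_sum) (use assms in auto)
  then have "((?T \<circ> (\<lambda>m. [int m])) has_sum (of_real (2 / pi\<^sup>2 * ellK k) :: complex)) UNIV"
    using T by (simp add: comp_def)
  then have "(?T has_sum (of_real (2 / pi\<^sup>2 * ellK k) :: complex)) (range (\<lambda>m. [int m]))"
    by (subst has_sum_reindex) (auto simp: inj_on_def)
  also have "?this \<longleftrightarrow> (?T has_sum (of_real (2 / pi\<^sup>2 * ellK k) :: complex)) {\<kappa>. length \<kappa> = 1}"
  proof (rule has_sum_cong_neutral)
    fix \<kappa> :: "int list" assume \<kappa>: "\<kappa> \<in> {\<kappa>. length \<kappa> = 1} - range (\<lambda>m. [int m])"
    then obtain i where i: "\<kappa> = [i]" by (cases \<kappa>) auto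
    with \<kappa> have "i < 0" by (cases i) auto
    then have "inv_fact \<kappa> = 0" by (simp add: i inv_fact_def rGamma_neg_int)
    then show "?T \<kappa> = 0" by simp
  qed auto
  finally show ?thesis
    unfolding hyp_Phi_def by (simp add: infsumI)
qed


text \<open>The alternating prefactor (-1)^m cancels the signs (-1)^l and (-1)^(m+l) of the
  half-integer Gamma factors, and Gamma (1 + m) cancels m!; what remains is the coefficient of the
  double series of \<open>ellPi\<close>.\<close>

lemma Phi2_eq:
  assumes "0 < n" "n < 1" "0 < k" "k < 1"
  shows "Phi2 (of_real n) (of_real k) = of_real (2 / pi\<^sup>2 * ellPi n k)"
proof -
  let ?\<gamma> = "[-1, 0, -1/2, -1/2] :: complex list"
  let ?B = "[[-1, 0], [1, 1], [0, -1], [-1, -1], [1, 0], [0, 1]] :: int list list"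
  let ?T = "\<lambda>\<kappa>. (-1) powi row_dot (?B ! 0) \<kappa> * Gamma (- (?\<gamma> ! 0) - of_int (row_dot (?B ! 0) \<kappa>)) *
      hyp_monomial ?\<gamma> ?B [1, 1, 1, 1, of_real n, of_real k] \<kappa> *
      (\<Prod>j\<in>{1..<length ?\<gamma>}. rGamma (?\<gamma> ! j + of_int (row_dot (?B ! j) \<kappa>) + 1)) *
      inv_fact \<kappa>"
  let ?p = "\<lambda>j. pochhammer (1/2) j :: real"
  have T: "?T [int m, int l] = of_real (2 / pi\<^sup>2 * (pi / 2 * (n ^ m * k ^ l * binc l * binc (m + l))))" for m l
  proof -
    have g: "rGamma (-1/2 + of_int (- int j) + 1 :: complex) = of_real ((-1) ^ j * ?p j / sqrt pi)" for j
      using rGamma_half_minus[of j] by simp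
    have dots: "row_dot (?B ! 0) [int m, int l] = - int m" "row_dot (?B ! 1) [int m, int l] = int (m + l)"
      "row_dot (?B ! 2) [int m, int l] = - int l" "row_dot (?B ! 3) [int m, int l] = - int (m + l)"
      by (simp_all add: row_dot_def lessThan_Suc)
    have mon: "hyp_monomial ?\<gamma> ?B [1, 1, 1, 1, of_real n, of_real k] [int m, int l] = of_real (n ^ m * k ^ l)"
      using assms by (simp add: hyp_monomial_def row_dot_def lessThan_Suc powr_nat')
    have s: "{1..<length ?\<gamma>} = {1, 2, 3}" by auto
    have gam: "(\<Prod>j\<in>{1..<length ?\<gamma>}. rGamma (?\<gamma> ! j + of_int (row_dot (?B ! j) [int m, int l]) + 1))
      = of_real (1 / fact (m + l) * (((-1) ^ l * ?p l / sqrt pi) * ((-1) ^ (m + l) * ?p (m + l) / sqrt pi)))"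
    proof -
      have "(\<Prod>j\<in>{1..<length ?\<gamma>}. rGamma (?\<gamma> ! j + of_int (row_dot (?B ! j) [int m, int l]) + 1))
        = rGamma (of_nat (m + l) + 1) * (rGamma (-1/2 + of_int (- int l) + 1) * rGamma (-1/2 + of_int (- int (m + l)) + 1))"
        unfolding s by (simp add: dots[simplified])
      then show ?thesis unfolding g rGamma_Suc_nat by (simp only: of_real_mult)
    qed
    have inv: "inv_fact [int m, int l] = of_real (1 / fact m * (1 / fact l))"
      by (simp add: inv_fact_def lessThan_Suc rGamma_Suc_nat)
    have Gam: "Gamma (- (?\<gamma> ! 0) - of_int (row_dot (?B ! 0) [int m, int l])) = of_real (fact m)"
      using Gamma_fact[of m, where 'a=complex] unfolding dots by simp
    have sg: "(-1 :: complex) powi row_dot (?B ! 0) [int m, int l] = of_real ((-1) ^ m)"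
      unfolding dots by (simp add: power_int_minus power_inverse[symmetric])
    have "?T [int m, int l] = of_real ((-1) ^ m * fact m * (n ^ m * k ^ l) *
        (1 / fact (m + l) * (((-1) ^ l * ?p l / sqrt pi) * ((-1) ^ (m + l) * ?p (m + l) / sqrt pi))) * (1 / fact m * (1 / fact l)))"
      unfolding mon gam inv Gam sg by (simp only: of_real_mult)
    also have "(-1) ^ m * fact m * (n ^ m * k ^ l) *
        (1 / fact (m + l) * (((-1) ^ l * ?p l / sqrt pi) * ((-1) ^ (m + l) * ?p (m + l) / sqrt pi))) * (1 / fact m * (1 / fact l))
      = 2 / pi\<^sup>2 * (pi / 2 * (n ^ m * k ^ l * binc l * binc (m + l)))"
    proof -
      have "((-1) ^ m * (-1) ^ l) * (-1) ^ (m + l) = (1::real)"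
        by (simp flip: power_add power_mult_distrib)
      then have "(-1) ^ m * (((-1) ^ l * ?p l / sqrt pi) * ((-1) ^ (m + l) * ?p (m + l) / sqrt pi)) = ?p l * ?p (m + l) / pi"
        by (simp add: field_simps flip: power_add power_mult_distrib)
      then have "fact m * (n ^ m * k ^ l) * (1 / fact (m + l)) * (1 / fact m * (1 / fact l)) *
          ((-1) ^ m * (((-1) ^ l * ?p l / sqrt pi) * ((-1) ^ (m + l) * ?p (m + l) / sqrt pi)))
        = fact m * (n ^ m * k ^ l) * (1 / fact (m + l)) * (1 / fact m * (1 / fact l)) * (?p l * ?p (m + l) / pi)"
        by (simp only:)
      also have "\<dots> = 2 / pi\<^sup>2 * (pi / 2 * (n ^ m * k ^ l * binc l * binc (m + l)))"
        by (simp add: binc_def power2_eq_square mult_ac)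
      finally show ?thesis by (simp only: mult_ac)
    qed
    finally show ?thesis .
  qed
  have "((\<lambda>(m, l). of_real (2 / pi\<^sup>2 * (pi / 2 * (n ^ m * k ^ l * binc l * binc (m + l))))) has_sum (of_real (2 / pi\<^sup>2 * ellPi n k) :: complex)) UNIV"
    using has_sum_of_real[OF has_sum_cmult_right[OF ellPi_has_sum[of n k], of "2 / pi\<^sup>2"], where 'a=complex] assms
    by (simp only: case_prod_unfold less_imp_le)
  then have "((?T \<circ> (\<lambda>(m, l). [int m, int l])) has_sum (of_real (2 / pi\<^sup>2 * ellPi n k) :: complex)) UNIV"
    unfolding comp_def case_prod_unfold T .
  then have "(?T has_sum (of_real (2 / pi\<^sup>2 * ellPi n k) :: complex)) (range (\<lambda>(m, l). [int m, int l]))"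
    by (subst has_sum_reindex) (auto simp: inj_on_def)
  also have "?this \<longleftrightarrow> (?T has_sum (of_real (2 / pi\<^sup>2 * ellPi n k) :: complex)) {\<kappa>. length \<kappa> = 2}"
  proof (rule has_sum_cong_neutral)
    fix \<kappa> :: "int list" assume \<kappa>: "\<kappa> \<in> {\<kappa>. length \<kappa> = 2} - range (\<lambda>(m, l). [int m, int l])"
    then obtain i j where i: "\<kappa> = [i, j]" by (auto simp: numeral_2_eq_2 length_Suc_conv)
    have "i < 0 \<or> j < 0"
    proof (rule ccontr)
      assume "\<not> (i < 0 \<or> j < 0)"
      then have "\<kappa> = (\<lambda>(m, l). [int m, int l]) (nat i, nat j)" using i by simp
      with \<kappa> show False by blast
    qed
    then have "inv_fact \<kappa> = 0" by (auto simp: i inv_fact_def rGamma_neg_int lessThan_Suc)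
    then show "?T \<kappa> = 0" by simp
  qed auto
  finally have "(?T has_sum (of_real (2 / pi\<^sup>2 * ellPi n k) :: complex)) {\<kappa>. length \<kappa> = 2}" .
  moreover have "length ?B - length ?\<gamma> = 2" by simp
  ultimately show ?thesis
    unfolding hyp_Phi_tilde_def by (simp only: infsumI)
qed

section \<open>The second derivatives as elliptic integrals\<close>

text \<open>By \<open>integral_quartic\<close>, the integral of R s / sqrt (quart s) between the
  middle branch points. The locale constants are used in exported form, so that \<open>X\<close>,
  \<open>Y\<close>, \<open>U\<close> can vary with a parameter.\<close>

definition ellint :: "(real \<Rightarrow> real) \<Rightarrow> real \<Rightarrow> real \<Rightarrow> real \<Rightarrow> real" where
  "ellint R X Y U = integral {0..pi/2} (\<lambda>\<phi>. R (quartic.moebius (E1 X Y U) (E2 X Y U) (E3 X Y U) ((sin \<phi>)\<^sup>2)) *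
     quartic.elweight (E1 X Y U) (E2 X Y U) (E3 X Y U) (E4 X Y U) \<phi>)"

text \<open>After the substitution the interval is fixed and the integrand jointly continuous, so
  collisions are the only danger. Continuity of \<open>R\<close> for s > 0 is enough because the
  second branch point is positive, even where the first one is 0.\<close>

lemma continuous_on_ellint:
  fixes X Y U :: "'p::topological_space \<Rightarrow> real"
  assumes X[continuous_intros]: "continuous_on S X" and Y[continuous_intros]: "continuous_on S Y"
    and U[continuous_intros]: "continuous_on S U"
    and nc: "\<And>p. p \<in> S \<Longrightarrow> quartic_XYU (X p) (Y p) (U p)"
    and R: "continuous_on (S \<times> {0<..}) (\<lambda>(p, s). R p s)"
  shows "continuous_on S (\<lambda>p. ellint (R p) (X p) (Y p) (U p))"
proof -
  define e1 e2 e3 e4 where e: "e1 = (\<lambda>p. E1 (X p) (Y p) (U p))" "e2 = (\<lambda>p. E2 (X p) (Y p) (U p))"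
    "e3 = (\<lambda>p. E3 (X p) (Y p) (U p))" "e4 = (\<lambda>p. E4 (X p) (Y p) (U p))"
  have qx: "quartic_XYU (X p) (Y p) (U p)" if "p \<in> S" for p using nc[OF that] .
  have q: "quartic (e1 p) (e2 p) (e3 p) (e4 p)" if "p \<in> S" for p
    using qx[OF that] unfolding e quartic_XYU_def by simp
  have c: "continuous_on (S \<times> cbox 0 (pi/2)) (\<lambda>x. X (fst x))" "continuous_on (S \<times> cbox 0 (pi/2)) (\<lambda>x. Y (fst x))"
    "continuous_on (S \<times> cbox 0 (pi/2)) (\<lambda>x. U (fst x))"
    by (auto intro!: continuous_on_compose2[OF X] continuous_on_compose2[OF Y] continuous_on_compose2[OF U] continuous_intros)
  have ce: "continuous_on (S \<times> cbox 0 (pi/2)) (\<lambda>x. e1 (fst x))" "continuous_on (S \<times> cbox 0 (pi/2)) (\<lambda>x. e2 (fst x))"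
    "continuous_on (S \<times> cbox 0 (pi/2)) (\<lambda>x. e3 (fst x))" "continuous_on (S \<times> cbox 0 (pi/2)) (\<lambda>x. e4 (fst x))"
    unfolding e E1_def E2_def E3_def E4_def by (intro continuous_intros c)+
  have cs: "continuous_on (S \<times> cbox 0 (pi/2)) (\<lambda>x. sin (snd x))"
    by (rule continuous_on_compose2[of UNIV sin]) (auto intro!: continuous_on_sin continuous_on_id continuous_on_snd)
  define m where "m = (\<lambda>x. quartic.moebius (e1 (fst x)) (e2 (fst x)) (e3 (fst x)) ((sin (snd x))\<^sup>2))"
  define w where "w = (\<lambda>x. quartic.elweight (e1 (fst x)) (e2 (fst x)) (e3 (fst x)) (e4 (fst x)) (snd x))"
  have cm: "continuous_on (S \<times> cbox 0 (pi/2)) m"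
  proof (rule continuous_on_eq)
    let ?n = "\<lambda>x. (e3 (fst x) - e2 (fst x)) / (e3 (fst x) - e1 (fst x))"
    have ne: "e3 (fst x) - e1 (fst x) \<noteq> 0" "1 - ?n x * (sin (snd x))\<^sup>2 \<noteq> 0"
      and eq: "e1 (fst x) + (e2 (fst x) - e1 (fst x)) / (1 - ?n x * (sin (snd x))\<^sup>2) = m x"
      if "x \<in> S \<times> cbox 0 (pi/2)" for x
    proof -
      interpret quartic "e1 (fst x)" "e2 (fst x)" "e3 (fst x)" "e4 (fst x)" using q that by auto
      show "e3 (fst x) - e1 (fst x) \<noteq> 0" using e12 e23 by simp
      show "1 - ?n x * (sin (snd x))\<^sup>2 \<noteq> 0" using moebius_pos(1)[OF sin2_bounds, of "snd x"]
        unfolding elchar_def by (rule less_imp_neq[THEN not_sym])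
      show "e1 (fst x) + (e2 (fst x) - e1 (fst x)) / (1 - ?n x * (sin (snd x))\<^sup>2) = m x"
        by (simp add: m_def moebius_def elchar_def)
    qed
    show "continuous_on (S \<times> cbox 0 (pi/2)) (\<lambda>x. e1 (fst x) + (e2 (fst x) - e1 (fst x)) / (1 - ?n x * (sin (snd x))\<^sup>2))"
      by (intro continuous_intros ce cs ballI ne)
    show "\<And>x. x \<in> S \<times> cbox 0 (pi/2) \<Longrightarrow> e1 (fst x) + (e2 (fst x) - e1 (fst x)) / (1 - ?n x * (sin (snd x))\<^sup>2) = m x"
      by (rule eq)
  qed
  have cw: "continuous_on (S \<times> cbox 0 (pi/2)) w"
  proof (rule continuous_on_eq)
    let ?n = "\<lambda>x. (e3 (fst x) - e2 (fst x)) / (e3 (fst x) - e1 (fst x))"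
    let ?k = "\<lambda>x. ?n x * (e4 (fst x) - e1 (fst x)) / (e4 (fst x) - e2 (fst x))"
    let ?w = "\<lambda>x. 2 / sqrt ((e3 (fst x) - e1 (fst x)) * (e4 (fst x) - e2 (fst x))) / sqrt (1 - ?k x * (sin (snd x))\<^sup>2)"
    have ne: "e3 (fst x) - e1 (fst x) \<noteq> 0" "e4 (fst x) - e2 (fst x) \<noteq> 0" "sqrt (1 - ?k x * (sin (snd x))\<^sup>2) \<noteq> 0"
      "sqrt ((e3 (fst x) - e1 (fst x)) * (e4 (fst x) - e2 (fst x))) \<noteq> 0"
      and eq: "?w x = w x"
      if "x \<in> S \<times> cbox 0 (pi/2)" for x
    proof -
      interpret quartic "e1 (fst x)" "e2 (fst x)" "e3 (fst x)" "e4 (fst x)" using q that by auto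
      show "e3 (fst x) - e1 (fst x) \<noteq> 0" "e4 (fst x) - e2 (fst x) \<noteq> 0" using e12 e23 e34 by auto
      show "sqrt ((e3 (fst x) - e1 (fst x)) * (e4 (fst x) - e2 (fst x))) \<noteq> 0" using e12 e23 e34 by auto
      show "sqrt (1 - ?k x * (sin (snd x))\<^sup>2) \<noteq> 0"
      proof -
        have "sqrt (1 - elmod * (sin (snd x))\<^sup>2) > 0" using moebius_pos(2)[OF sin2_bounds, of "snd x"] by simp
        then show ?thesis unfolding elchar_def elmod_def by (rule less_imp_neq[THEN not_sym])
      qed
      show "?w x = w x"
        by (simp add: w_def elweight_def elchar_def elmod_def elscale_def)
    qed
    show "continuous_on (S \<times> cbox 0 (pi/2)) ?w"
      by (intro continuous_intros ce cs ballI ne)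
    show "\<And>x. x \<in> S \<times> cbox 0 (pi/2) \<Longrightarrow> ?w x = w x"
      by (rule eq)
  qed
  have mpos: "m x > 0" if "x \<in> S \<times> cbox 0 (pi/2)" for x
  proof -
    interpret quartic_XYU "X (fst x)" "Y (fst x)" "U (fst x)" using qx that by auto
    show ?thesis using E2_pos moebius_range(1)[OF sin2_bounds, of "snd x"] unfolding m_def e by linarith
  qed
  have "continuous_on (S \<times> cbox 0 (pi/2)) (\<lambda>x. (\<lambda>(p, s). R p s) (fst x, m x) * w x)"
    by (intro continuous_on_mult cw continuous_on_compose2[OF R] continuous_on_Pair cm continuous_intros) (use mpos in auto)
  then have "continuous_on (S \<times> cbox 0 (pi/2)) (\<lambda>(p, \<phi>). R p (m (p, \<phi>)) * w (p, \<phi>))"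
    by (simp add: case_prod_unfold)
  from integral_continuous_on_param[OF this]
  show ?thesis by (simp add: ellint_def m_def w_def e)
qed

section \<open>Differentiating the conditional angle along a path\<close>

lemma Wsq_iff:
  assumes "Y > 0" "U > 0"
  shows "Wsq Y U s > 0 \<longleftrightarrow> (Y - U)\<^sup>2 < s \<and> s < (Y + U)\<^sup>2"
    and "Wsq Y U s = 0 \<longleftrightarrow> s = (Y - U)\<^sup>2 \<or> s = (Y + U)\<^sup>2"
proof -
  have "(Y + U)\<^sup>2 - (Y - U)\<^sup>2 = 4 * Y * U" by algebra
  then have "(Y - U)\<^sup>2 < (Y + U)\<^sup>2" using assms by (smt (verit) mult_pos_pos)
  then show "Wsq Y U s > 0 \<longleftrightarrow> (Y - U)\<^sup>2 < s \<and> s < (Y + U)\<^sup>2"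
    by (auto simp: Wsq_def zero_less_mult_iff)
  show "Wsq Y U s = 0 \<longleftrightarrow> s = (Y - U)\<^sup>2 \<or> s = (Y + U)\<^sup>2" by (auto simp: Wsq_def)
qed

text \<open>The squared sine of an angle of the triangle, by Heron's formula. Hence the sign of
  \<open>Wsq\<close> decides whether \<open>cang\<close> lies inside or outside [-1, 1].\<close>

lemma cang_sq:
  assumes "cmod_sq X a > 0" "U > 0"
  shows "1 - (cang X Y U a)\<^sup>2 = Wsq Y U (cmod_sq X a) / (2 * sqrt (cmod_sq X a) * U)\<^sup>2"
proof -
  have "(cang X Y U a)\<^sup>2 = (Y\<^sup>2 - U\<^sup>2 - cmod_sq X a)\<^sup>2 / (2 * sqrt (cmod_sq X a) * U)\<^sup>2"
    by (simp add: cang_def power_divide)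
  moreover have "(2 * sqrt (cmod_sq X a) * U)\<^sup>2 = 4 * cmod_sq X a * U\<^sup>2"
    using assms by (simp add: power_mult_distrib)
  moreover have "4 * cmod_sq X a * U\<^sup>2 - (Y\<^sup>2 - U\<^sup>2 - cmod_sq X a)\<^sup>2 = Wsq Y U (cmod_sq X a)"
    unfolding Wsq_def by algebra
  moreover have "4 * cmod_sq X a * U\<^sup>2 \<noteq> 0" using assms by simp
  ultimately show ?thesis by (simp add: diff_divide_eq_iff)
qed

lemma cmod_sq_pos:
  assumes "X > 0" "cos a \<noteq> -1"
  shows "cmod_sq X a > 0"
proof -
  have "cmod_sq X a = (1 - X)\<^sup>2 + 2 * X * (1 + cos a)" unfolding cmod_sq_def by algebra
  moreover have "cos a > -1" using assms(2) cos_ge_minus_one[of a] by linarith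
  then have "2 * X * (1 + cos a) > 0" using assms(1) by simp
  ultimately show ?thesis by (smt (verit) zero_le_power2)
qed

text \<open>\<open>D\<close> is the derivative of \<open>cang\<close> multiplied by its denominator;
  that denominator reappears in sqrt (1 - c^2) and cancels, leaving
  \<open>D / sqrt Wsq\<close>.\<close>

lemma ang_cang_deriv:
  assumes c': "((\<lambda>t. cang (X t) (Y t) U a) has_real_derivative D / (2 * sqrt (cmod_sq (X t) a) * U)) (at t)"
    and s: "cmod_sq (X t) a > 0" and pos: "Y t > 0" "U > 0"
    and ne: "cmod_sq (X t) a \<noteq> (Y t - U)\<^sup>2" "cmod_sq (X t) a \<noteq> (Y t + U)\<^sup>2"
  shows "((\<lambda>t. ang (cang (X t) (Y t) U a)) has_real_derivative
    (if (Y t - U)\<^sup>2 < cmod_sq (X t) a \<and> cmod_sq (X t) a < (Y t + U)\<^sup>2 then D / sqrt (Wsq (Y t) U (cmod_sq (X t) a)) else 0)) (at t)"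
proof -
  let ?c = "cang (X t) (Y t) U a" and ?W = "Wsq (Y t) U (cmod_sq (X t) a)" and ?d = "2 * sqrt (cmod_sq (X t) a) * U"
  have d: "?d > 0" using s pos by simp
  note W = Wsq_iff[OF pos, of "cmod_sq (X t) a"] and csq = cang_sq[OF s pos(2), of "Y t"]
  show ?thesis
  proof (cases "?W > 0")
    case True
    then have "1 - ?c\<^sup>2 > 0" unfolding csq by (intro divide_pos_pos zero_less_power d)
    then have "\<bar>?c\<bar> < 1" by (simp add: abs_square_less_1)
    from DERIV_chain2[OF ang_deriv(1)[OF this] c']
    have "((\<lambda>t. ang (cang (X t) (Y t) U a)) has_real_derivative 1 / sqrt (1 - ?c\<^sup>2) * (D / ?d)) (at t)" .
    also have "1 / sqrt (1 - ?c\<^sup>2) * (D / ?d) = D / sqrt ?W"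
    proof -
      have "sqrt (?W / ?d\<^sup>2) = sqrt ?W / ?d"
        by (simp only: real_sqrt_divide real_sqrt_abs abs_of_pos[OF d])
      moreover have "1 / (w / e) * (D / e) = D / w" if "e > 0" for w e :: real
        using that by simp
      ultimately show ?thesis unfolding csq using d by (simp only:)
    qed
    finally show ?thesis using True W(1) by simp
  next
    case False
    with W ne have "?W < 0" by auto
    then have "1 - ?c\<^sup>2 < 0" unfolding csq by (intro divide_neg_pos zero_less_power d)
    then have "\<bar>?c\<bar> > 1" using abs_square_le_1[of ?c] by linarith
    from DERIV_chain2[OF ang_deriv(2)[OF this] c']
    have "((\<lambda>t. ang (cang (X t) (Y t) U a)) has_real_derivative 0) (at t)" by simp
    then show ?thesis using False unfolding W(1) by (simp only: if_False)
  qed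
qed

lemma AE_circ_cos: "AE a in circ. cos a \<noteq> -1"
  by (rule AE_circ_I[OF countable_cos_eq[of 0 "-1"]]) auto

text \<open>Serves both second derivatives: either the threshold \<open>Y\<close> or the radius
  \<open>X\<close> moves. For a fixed angle, \<open>fin\<close> says that s meets a moving branch
  point at only finitely many times, and these are the exceptional points of the fundamental
  theorem.\<close>

lemma prob3_path_deriv:
  fixes X Y :: "real \<Rightarrow> real" and R :: "real \<Rightarrow> real \<Rightarrow> real"
  assumes ab: "a < b"
    and X: "continuous_on UNIV X" and Y: "continuous_on UNIV Y"
    and nc: "\<And>t. t \<in> {a..b} \<Longrightarrow> quartic_XYU (X t) (Y t) U"
    and R: "continuous_on ({a..b} \<times> {0<..}) (\<lambda>(t, s). R t s)"
    and Rm: "(\<lambda>(t, s). R t s) \<in> borel_measurable (borel \<Otimes>\<^sub>M borel)"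
    and deriv: "\<And>t \<alpha>. t \<in> {a<..<b} \<Longrightarrow> cos \<alpha> \<noteq> -1 \<Longrightarrow>
      ((\<lambda>t. cang (X t) (Y t) U \<alpha>) has_real_derivative R t (cmod_sq (X t) \<alpha>) / (2 * sqrt (cmod_sq (X t) \<alpha>) * U)) (at t)"
    and fin: "\<And>\<alpha>. finite {t. cmod_sq (X t) \<alpha> = (Y t - U)\<^sup>2}" "\<And>\<alpha>. finite {t. cmod_sq (X t) \<alpha> = (Y t + U)\<^sup>2}"
    and t: "t \<in> {a<..<b}"
  shows "((\<lambda>t. prob3 (Y t) (X t) U) has_real_derivative ellint (R t) (X t) (Y t) U / pi\<^sup>2) (at t)"
proof -
  define h where "h = (\<lambda>t \<alpha>. (if (Y t - U)\<^sup>2 < cmod_sq (X t) \<alpha> \<and> cmod_sq (X t) \<alpha> < (Y t + U)\<^sup>2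
     then R t (cmod_sq (X t) \<alpha>) / sqrt (Wsq (Y t) U (cmod_sq (X t) \<alpha>)) else 0) / pi)"
  have psn: "X t > 0" "Y t > 0" "U > 0" if "t \<in> {a..b}" for t
    using nc[OF that] by (auto simp: quartic_XYU_def quartic_XYU_axioms_def)
  have [measurable]: "X \<in> borel_measurable borel" "Y \<in> borel_measurable borel"
    using X Y by (auto intro: borel_measurable_continuous_onI)
  have Rt: "continuous_on {E2 (X t) (Y t) U..E3 (X t) (Y t) U} (R t)" and Rtm: "R t \<in> borel_measurable borel" if "t \<in> {a..b}" for t
  proof -
    interpret quartic_XYU "X t" "Y t" U by (rule nc[OF that])
    have "continuous_on {E2 (X t) (Y t) U..E3 (X t) (Y t) U} (\<lambda>s. (\<lambda>(t, s). R t s) (t, s))"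
      by (rule continuous_on_compose2[OF R]) (use that E2_pos in \<open>auto intro!: continuous_intros\<close>)
    then show "continuous_on {E2 (X t) (Y t) U..E3 (X t) (Y t) U} (R t)" by simp
    show "R t \<in> borel_measurable borel" using measurable_Pair2[OF Rm, of t] by simp
  qed
  have int: "integrable circ (h t)" "(\<integral>\<alpha>. h t \<alpha> \<partial>circ) = ellint (R t) (X t) (Y t) U / pi\<^sup>2"
    "(\<integral>\<alpha>. \<bar>h t \<alpha>\<bar> \<partial>circ) = ellint (\<lambda>s. \<bar>R t s\<bar>) (X t) (Y t) U / pi\<^sup>2" if "t \<in> {a..b}" for t
  proof -
    interpret quartic_XYU "X t" "Y t" U by (rule nc[OF that])
    note I = integral_circ_quartic[OF Rtm[OF that] Rt[OF that]]
    have "(\<lambda>s. \<bar>R t s\<bar>) \<in> borel_measurable borel" using Rtm[OF that] by measurable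
    note I' = integral_circ_quartic[OF this continuous_on_rabs[OF Rt[OF that]]]
    show "integrable circ (h t)" unfolding h_def by (intro integrable_divide I)
    show "(\<integral>\<alpha>. h t \<alpha> \<partial>circ) = ellint (R t) (X t) (Y t) U / pi\<^sup>2"
      unfolding h_def integral_divide_zero I(2) ellint_def by (simp add: power2_eq_square)
    have "\<bar>h t \<alpha>\<bar> = (if (Y t - U)\<^sup>2 < cmod_sq (X t) \<alpha> \<and> cmod_sq (X t) \<alpha> < (Y t + U)\<^sup>2
     then \<bar>R t (cmod_sq (X t) \<alpha>)\<bar> / sqrt (Wsq (Y t) U (cmod_sq (X t) \<alpha>)) else 0) / pi" for \<alpha>
      using Wsq_iff(1)[OF psn(2,3)[OF that], of "cmod_sq (X t) \<alpha>"] by (auto simp: h_def abs_divide)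
    then show "(\<integral>\<alpha>. \<bar>h t \<alpha>\<bar> \<partial>circ) = ellint (\<lambda>s. \<bar>R t s\<bar>) (X t) (Y t) U / pi\<^sup>2"
      by (simp only: integral_divide_zero I'(2) ellint_def) (simp add: power2_eq_square)
  qed
  have Xc: "continuous_on {a..b} X" "continuous_on {a..b} Y" using X Y by (auto intro: continuous_on_subset)
  have ce: "continuous_on {a..b} (\<lambda>t. ellint (R t) (X t) (Y t) U)"
    by (rule continuous_on_ellint[OF Xc continuous_on_const nc R])
  have "continuous_on ({a..b} \<times> {0<..}) (\<lambda>(t, s). \<bar>R t s\<bar>)"
    using continuous_on_rabs[OF R] by (simp add: case_prod_unfold)
  from continuous_on_ellint[OF Xc continuous_on_const nc this]
  have ce': "continuous_on {a..b} (\<lambda>t. ellint (\<lambda>s. \<bar>R t s\<bar>) (X t) (Y t) U / pi\<^sup>2)"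
    by (intro continuous_intros) auto
  \<comment> \<open>The uniform L1 bound comes from compactness: the L1 norm of \<open>h t\<close>
    is itself an \<open>ellint\<close>, hence continuous in t.\<close>
  then have "bounded ((\<lambda>t. ellint (\<lambda>s. \<bar>R t s\<bar>) (X t) (Y t) U / pi\<^sup>2) ` {a..b})"
    by (intro compact_imp_bounded compact_continuous_image) auto
  then obtain C where "\<forall>x\<in>(\<lambda>t. ellint (\<lambda>s. \<bar>R t s\<bar>) (X t) (Y t) U / pi\<^sup>2) ` {a..b}. norm x \<le> C"
    unfolding bounded_iff by blast
  then have C: "\<bar>ellint (\<lambda>s. \<bar>R t s\<bar>) (X t) (Y t) U / pi\<^sup>2\<bar> \<le> C" if "t \<in> {a..b}" for t
    using that by simp
  have m: "(\<lambda>(t, w). h t w) \<in> borel_measurable (borel \<Otimes>\<^sub>M circ)"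
  proof -
    have "(\<lambda>x. (\<lambda>(t, s). R t s) (fst x, cmod_sq (X (fst x)) (snd x))) \<in> borel_measurable (borel \<Otimes>\<^sub>M circ)"
      by (rule measurable_compose[OF _ Rm]) (simp add: cmod_sq_def)
    then have [measurable]: "(\<lambda>x. R (fst x) (cmod_sq (X (fst x)) (snd x))) \<in> borel_measurable (borel \<Otimes>\<^sub>M circ)" by simp
    show ?thesis unfolding h_def case_prod_unfold Wsq_def cmod_sq_def
      using \<open>(\<lambda>x. R (fst x) (cmod_sq (X (fst x)) (snd x))) \<in> _\<close>[unfolded cmod_sq_def] by measurable
  qed
  have "((\<lambda>t. \<integral>\<alpha>. ang (cang (X t) (Y t) U \<alpha>) / pi \<partial>circ) has_real_derivative (\<integral>\<alpha>. h t \<alpha> \<partial>circ)) (at t)"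
  proof (rule has_derivative_integral_Fubini[OF _ ab m _ _ _ int(1) _ _ t, where C=C])
    show "sigma_finite_measure circ" by unfold_locales
    show "integrable circ (\<lambda>\<alpha>. ang (cang (X t) (Y t) U \<alpha>) / pi)" if "t \<in> {a..b}" for t
    proof (rule circ.integrable_const_bound[where B=1])
      show "AE \<alpha> in circ. norm (ang (cang (X t) (Y t) U \<alpha>) / pi) \<le> 1"
        using ang_bounds by (intro AE_I2) (auto simp: abs_le_iff divide_le_eq)
    qed (auto simp: cang_def cmod_sq_def)
    show "AE \<alpha> in circ. continuous_on {a..b} (\<lambda>t. ang (cang (X t) (Y t) U \<alpha>) / pi)"
      using AE_circ_cos
    proof eventually_elim
      case (elim \<alpha>)
      have "cmod_sq (X t) \<alpha> > 0" if "t \<in> {a..b}" for t using cmod_sq_pos[OF psn(1)[OF that] elim] .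
      moreover have "continuous_on {a..b} (\<lambda>t. cmod_sq (X t) \<alpha>)" unfolding cmod_sq_def by (intro continuous_intros Xc)
      ultimately have "continuous_on {a..b} (\<lambda>t. cang (X t) (Y t) U \<alpha>)"
        unfolding cang_def using psn(3)[of a] ab by (intro continuous_intros Xc) (auto simp: less_le)
      then show ?case
        by (intro continuous_on_divide continuous_on_compose2[OF continuous_on_ang[of UNIV]] continuous_intros) auto
    qed
    show "AE \<alpha> in circ. \<exists>E. finite E \<and> (\<forall>t\<in>{a<..<b} - E. ((\<lambda>t. ang (cang (X t) (Y t) U \<alpha>) / pi) has_real_derivative h t \<alpha>) (at t))"
      using AE_circ_cos
    proof eventually_elim
      case (elim \<alpha>)
      let ?E = "{t. cmod_sq (X t) \<alpha> = (Y t - U)\<^sup>2} \<union> {t. cmod_sq (X t) \<alpha> = (Y t + U)\<^sup>2}"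
      have "((\<lambda>t. ang (cang (X t) (Y t) U \<alpha>) / pi) has_real_derivative h t \<alpha>) (at t)" if "t \<in> {a<..<b} - ?E" for t
        unfolding h_def
        by (intro DERIV_cdivide ang_cang_deriv deriv cmod_sq_pos psn elim) (use that in auto)
      then show ?case using fin by (intro exI[of _ ?E]) auto
    qed
    show "(\<integral>\<alpha>. \<bar>h t \<alpha>\<bar> \<partial>circ) \<le> C" if "t \<in> {a..b}" for t
      using C[OF that] int(3)[OF that] by linarith
    show "continuous_on {a..b} (\<lambda>t. \<integral>\<alpha>. h t \<alpha> \<partial>circ)"
      by (rule continuous_on_eq[of _ "\<lambda>t. ellint (R t) (X t) (Y t) U / pi\<^sup>2"])
        (use int(2) in \<open>auto intro!: continuous_intros ce\<close>)
  qed
  then have "((\<lambda>t. \<integral>\<alpha>. ang (cang (X t) (Y t) U \<alpha>) / pi \<partial>circ) has_real_derivative ellint (R t) (X t) (Y t) U / pi\<^sup>2) (at t)"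
    using int(2)[of t] t by simp
  then show ?thesis
  proof (rule has_field_derivative_transform_within_open)
    show "(\<integral>\<alpha>. ang (cang (X s) (Y s) U \<alpha>) / pi \<partial>circ) = prob3 (Y s) (X s) U" if "s \<in> {a<..<b}" for s
      using psn[of s] that by (simp add: prob3_eq)
  qed (use t in auto)
qed

text \<open>The lengths 1, X, Y, U are the sides of a nondegenerate quadrilateral, and no two of
  them have the same sum as the other two.\<close>

definition noncrit :: "real \<Rightarrow> real \<Rightarrow> real \<Rightarrow> bool" where
  "noncrit X Y U \<longleftrightarrow> X > 0 \<and> Y > 0 \<and> U > 0 \<and>
     1 < X + Y + U \<and> X < 1 + Y + U \<and> Y < 1 + X + U \<and> U < 1 + X + Y \<and>
     1 + X \<noteq> Y + U \<and> 1 + Y \<noteq> X + U \<and> 1 + U \<noteq> X + Y"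

lemma noncrit_swap: "noncrit X Y U \<longleftrightarrow> noncrit Y X U"
  by (auto simp: noncrit_def)

text \<open>Differences of the squares factor into the linear forms of \<open>noncrit\<close>: the
  polygon inequalities separate the lower pair of branch points from the upper one, and the three
  inequations separate the points within each pair.\<close>

lemma noncrit_quartic:
  assumes "noncrit X Y U"
  shows "quartic_XYU X Y U"
proof -
  note n = assms[unfolded noncrit_def]
  have 1: "(1 - X)\<^sup>2 \<noteq> (Y - U)\<^sup>2" using n by (auto simp: power2_eq_iff)
  have 2: "(1 + X)\<^sup>2 \<noteq> (Y + U)\<^sup>2" using n by (auto simp: power2_eq_iff)
  have less: "a < b" if "b - a = c" "0 < c" for a b c :: real
    using that by simp
  have 3: "(1 - X)\<^sup>2 < (1 + X)\<^sup>2" "(1 - X)\<^sup>2 < (Y + U)\<^sup>2" "(Y - U)\<^sup>2 < (1 + X)\<^sup>2" "(Y - U)\<^sup>2 < (Y + U)\<^sup>2"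
  proof -
    show "(1 - X)\<^sup>2 < (1 + X)\<^sup>2" by (rule less[of _ _ "4 * X"], algebra) (use n in auto)
    show "(1 - X)\<^sup>2 < (Y + U)\<^sup>2"
      by (rule less[of _ _ "(Y + U - 1 + X) * (Y + U + 1 - X)"], algebra, rule mult_pos_pos) (use n in auto)
    show "(Y - U)\<^sup>2 < (1 + X)\<^sup>2"
      by (rule less[of _ _ "(1 + X - Y + U) * (1 + X + Y - U)"], algebra, rule mult_pos_pos) (use n in auto)
    show "(Y - U)\<^sup>2 < (Y + U)\<^sup>2"
      by (rule less[of _ _ "4 * (Y * U)"], algebra) (use n in auto)
  qed
  have mm: "min a b < max a b" if "a \<noteq> b" for a b :: real
    using that by (auto simp: min_def max_def)
  show ?thesis
  proof unfold_locales
    show "E1 X Y U < E2 X Y U" unfolding E1_def E2_def by (rule mm[OF 1])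
    show "E3 X Y U < E4 X Y U" unfolding E3_def E4_def by (rule mm[OF 2])
    show "E2 X Y U < E3 X Y U" unfolding E2_def E3_def max_less_iff_conj min_less_iff_conj by (intro conjI 3)
  qed (use n in auto)
qed

text \<open>Four complex numbers with sum zero satisfy the polygon inequalities; equality in them,
  and the three balanced equations, are excluded by the contour.\<close>

lemma noncrit_amoeba:
  assumes "(x, y, u) \<in> amoeba lin3 - contour lin3"
  shows "noncrit (exp x) (exp y) (exp u)"
proof -
  from assms obtain z w t where z: "z \<noteq> 0" "w \<noteq> 0" "t \<noteq> 0" "1 + z + w + t = 0"
    and xyu: "x = ln (cmod z)" "y = ln (cmod w)" "u = ln (cmod t)"
    by (auto simp: amoeba_def zero_locus_def Log3_def)
  have e: "exp x = cmod z" "exp y = cmod w" "exp u = cmod t" using z xyu by auto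
  have tri: "cmod a \<le> cmod b + cmod c + cmod d" if "a + b + c + d = 0" for a b c d
  proof -
    have "a = - (b + c + d)" using that by (metis add.assoc eq_neg_iff_add_eq_0)
    then have "cmod a = cmod (b + c + d)" by (simp only: norm_minus_cancel)
    also have "\<dots> \<le> cmod b + cmod c + cmod d" by (intro norm_triangle_le add_mono order_refl norm_triangle_ineq)
    finally show ?thesis .
  qed
  have "cmod 1 \<le> cmod z + cmod w + cmod t" "cmod z \<le> cmod 1 + cmod w + cmod t"
    "cmod w \<le> cmod 1 + cmod z + cmod t" "cmod t \<le> cmod 1 + cmod z + cmod w"
    by (rule tri, use z(4) in \<open>simp add: add_ac\<close>)+
  with assms show ?thesis
    unfolding noncrit_def e[symmetric] Diff_iff contour_linear_polynomial by (auto simp: less_le)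
qed

lemma open_noncrit_exp: "open {(x, y, u). noncrit (exp x) (exp y) (exp u)}"
proof -
  have "open {p. noncrit (exp (fst p)) (exp (fst (snd p))) (exp (snd (snd p)))}"
    unfolding noncrit_def
    by (intro open_Collect_conj open_Collect_less open_Collect_neq continuous_intros)
  then show ?thesis by (simp add: case_prod_unfold)
qed

lemma noncrit_interval:
  assumes "noncrit (exp x) Y U"
  obtains a b where "a < x" "x < b" "\<And>t. t \<in> {a..b} \<Longrightarrow> noncrit (exp t) Y U"
proof -
  have "open {t. noncrit (exp t) Y U}"
    unfolding noncrit_def
    by (intro open_Collect_conj open_Collect_less open_Collect_neq continuous_intros)
  then obtain e where e: "e > 0" "cball x e \<subseteq> {t. noncrit (exp t) Y U}"
    using assms open_contains_cball by (metis mem_Collect_eq)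
  show ?thesis
    by (rule that[of "x - e" "x + e"]) (use e in \<open>auto simp: subset_iff dist_real_def abs_le_iff\<close>)
qed

section \<open>The second derivatives of the Ronkin function\<close>

lemma finite_exp_vimage: "finite S \<Longrightarrow> finite {t. exp t \<in> (S :: real set)}"
  using finite_vimageI[of S exp] by (simp add: inj_on_def vimage_def)

lemma finite_sqr: "finite {x::real. (x + p)\<^sup>2 = q}"
proof -
  have "{x::real. (x + p)\<^sup>2 = q} \<subseteq> {- p + sqrt q, - p - sqrt q}"
  proof
    fix x assume "x \<in> {x::real. (x + p)\<^sup>2 = q}"
    then have "\<bar>x + p\<bar> = sqrt q" by auto
    then show "x \<in> {- p + sqrt q, - p - sqrt q}" by auto
  qed
  then show ?thesis by (rule finite_subset) simp
qed

text \<open>Only the threshold moves, and it enters the numerator of \<open>cang\<close> through its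
  square, whose logarithmic derivative does not involve s.\<close>

lemma prob3_deriv_1:
  assumes nc: "noncrit X (exp t0) U"
  shows "((\<lambda>t. prob3 (exp t) X U) has_real_derivative ellint (\<lambda>s. 2 * (exp t0)\<^sup>2) X (exp t0) U / pi\<^sup>2) (at t0)"
proof -
  obtain a b where ab: "a < t0" "t0 < b" and n: "\<And>t. t \<in> {a..b} \<Longrightarrow> noncrit (exp t) X U"
    using noncrit_interval nc noncrit_swap by blast
  show ?thesis
  proof (rule prob3_path_deriv[where X="\<lambda>_. X" and Y=exp and a=a and b=b and R="\<lambda>t s. 2 * (exp t)\<^sup>2"])
    show "quartic_XYU X (exp t) U" if "t \<in> {a..b}" for t
      using n[OF that] noncrit_swap noncrit_quartic by blast
    have U: "U > 0" "X > 0" using nc by (auto simp: noncrit_def)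
    show "((\<lambda>t. cang X (exp t) U \<alpha>) has_real_derivative 2 * (exp t)\<^sup>2 / (2 * sqrt (cmod_sq X \<alpha>) * U)) (at t)"
      if "cos \<alpha> \<noteq> -1" for t \<alpha>
      unfolding cang_def using U cmod_sq_pos[OF U(2) that]
      by (auto intro!: derivative_eq_intros simp: power2_eq_square)
    show "finite {t. cmod_sq X \<alpha> = (exp t - U)\<^sup>2}" for \<alpha>
      using finite_exp_vimage[OF finite_sqr[of "-U" "cmod_sq X \<alpha>"]] by (simp add: eq_commute)
    show "finite {t. cmod_sq X \<alpha> = (exp t + U)\<^sup>2}" for \<alpha>
      using finite_exp_vimage[OF finite_sqr[of "U" "cmod_sq X \<alpha>"]] by (simp add: eq_commute)
    show "continuous_on ({a..b} \<times> {0<..}) (\<lambda>(t::real, s::real). 2 * (exp t)\<^sup>2)"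
      unfolding case_prod_unfold by (intro continuous_intros)
  qed (use ab in \<open>auto intro!: continuous_intros\<close>)
qed

text \<open>A chain rule product: s + X^2 - 1 is the derivative of s in log X, and -(s + Y^2 - U^2)
  / (2 s) is the derivative of \<open>cang\<close> in s times the denominator of
  \<open>cang\<close>.\<close>

definition Rxy :: "real \<Rightarrow> real \<Rightarrow> real \<Rightarrow> real \<Rightarrow> real" where
  "Rxy X Y U s = - ((s + Y\<^sup>2 - U\<^sup>2) * (s + X\<^sup>2 - 1) / (2 * s))"

lemma prob3_deriv_2:
  assumes nc: "noncrit (exp t0) Y U"
  shows "((\<lambda>t. prob3 Y (exp t) U) has_real_derivative ellint (Rxy (exp t0) Y U) (exp t0) Y U / pi\<^sup>2) (at t0)"
proof -
  obtain a b where ab: "a < t0" "t0 < b" and n: "\<And>t. t \<in> {a..b} \<Longrightarrow> noncrit (exp t) Y U"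
    using noncrit_interval nc by blast
  show ?thesis
  proof (rule prob3_path_deriv[where X=exp and Y="\<lambda>_. Y" and a=a and b=b and R="\<lambda>t. Rxy (exp t) Y U"])
    show "quartic_XYU (exp t) Y U" if "t \<in> {a..b}" for t
      using n[OF that] noncrit_quartic by blast
    have U: "U > 0" using nc by (auto simp: noncrit_def)
    show "((\<lambda>t. cang (exp t) Y U \<alpha>) has_real_derivative Rxy (exp t) Y U (cmod_sq (exp t) \<alpha>) / (2 * sqrt (cmod_sq (exp t) \<alpha>) * U)) (at t)"
      if "cos \<alpha> \<noteq> -1" for t \<alpha>
    proof -
      have s: "cmod_sq (exp t) \<alpha> > 0" using cmod_sq_pos[OF _ that] by simp
      define r where "r = sqrt (cmod_sq (exp t) \<alpha>)"
      have r: "r > 0" "cmod_sq (exp t) \<alpha> = r\<^sup>2" using s by (auto simp: r_def)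
      let ?d = "(exp t)\<^sup>2 - 1 + cmod_sq (exp t) \<alpha>"
      have ds: "((\<lambda>t. cmod_sq (exp t) \<alpha>) has_real_derivative ?d) (at t)"
        unfolding cmod_sq_def by (auto intro!: derivative_eq_intros simp: power2_eq_square)
      have dr: "((\<lambda>t. sqrt (cmod_sq (exp t) \<alpha>)) has_real_derivative ?d / (2 * r)) (at t)"
      proof -
        have "inverse (sqrt (cmod_sq (exp t) \<alpha>)) / 2 * ?d = ?d / (2 * r)"
          unfolding r_def[symmetric] by (simp add: inverse_eq_divide)
        then show ?thesis using DERIV_chain2[OF DERIV_real_sqrt[OF s] ds] by (simp only:)
      qed
      have dn: "((\<lambda>t. Y\<^sup>2 - U\<^sup>2 - cmod_sq (exp t) \<alpha>) has_real_derivative - ?d) (at t)"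
        using DERIV_diff[OF DERIV_const ds, of "Y\<^sup>2 - U\<^sup>2"] by simp
      have dd: "((\<lambda>t. 2 * sqrt (cmod_sq (exp t) \<alpha>) * U) has_real_derivative ?d / r * U) (at t)"
      proof -
        have "2 * (?d / (2 * r)) * U = ?d / r * U" using r(1) by (simp add: field_simps)
        then show ?thesis using DERIV_cmult_right[OF DERIV_cmult[OF dr, of 2], of U] by (simp only:)
      qed
      have "((\<lambda>t. cang (exp t) Y U \<alpha>) has_real_derivative
         (- ?d * (2 * r * U) - (Y\<^sup>2 - U\<^sup>2 - r\<^sup>2) * (?d / r * U)) / ((2 * r * U) * (2 * r * U))) (at t)"
        using DERIV_divide[OF dn dd] s U unfolding cang_def r_def by simp
      also have "(- ?d * (2 * r * U) - (Y\<^sup>2 - U\<^sup>2 - r\<^sup>2) * (?d / r * U)) / ((2 * r * U) * (2 * r * U)) =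
         Rxy (exp t) Y U (cmod_sq (exp t) \<alpha>) / (2 * sqrt (cmod_sq (exp t) \<alpha>) * U)"
        unfolding Rxy_def r_def[symmetric] r(2) using r(1) U by (simp add: field_simps power2_eq_square)
      finally show ?thesis .
    qed
    have fin: "finite {t. cmod_sq (exp t) \<alpha> = c}" for c \<alpha>
    proof -
      \<comment> \<open>Completing the square in the radius: for a fixed angle s is quadratic in it,
        so each value is taken at most twice.\<close>
      have "cmod_sq x \<alpha> = c \<longleftrightarrow> (x + cos \<alpha>)\<^sup>2 = c - 1 + (cos \<alpha>)\<^sup>2" for x
      proof -
        have "cmod_sq x \<alpha> - c = (x + cos \<alpha>)\<^sup>2 - (c - 1 + (cos \<alpha>)\<^sup>2)" unfolding cmod_sq_def by algebra
        then show ?thesis by (metis eq_iff_diff_eq_0)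
      qed
      then show ?thesis using finite_exp_vimage[OF finite_sqr[of "cos \<alpha>" "c - 1 + (cos \<alpha>)\<^sup>2"]] by simp
    qed
    show "finite {t. cmod_sq (exp t) \<alpha> = (Y - U)\<^sup>2}" "finite {t. cmod_sq (exp t) \<alpha> = (Y + U)\<^sup>2}" for \<alpha>
      by (rule fin)+
    show "continuous_on ({a..b} \<times> {0<..}) (\<lambda>(t, s). Rxy (exp t) Y U s)"
      unfolding case_prod_unfold Rxy_def by (intro continuous_intros) auto
    show "(\<lambda>(t, s). Rxy (exp t) Y U s) \<in> borel_measurable (borel \<Otimes>\<^sub>M borel)"
      unfolding Rxy_def by measurable
  qed (use ab in \<open>auto intro!: continuous_intros\<close>)
qed

section \<open>Reduction to complete integrals of the first and third kind\<close>

context quartic_XYU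
begin

lemma ellint_const: "ellint (\<lambda>s. c) X Y U = c * elscale * ellK elmod"
proof -
  have "(\<lambda>\<phi>. c * elweight \<phi>) = (\<lambda>\<phi>. (c * elscale) * (1 / sqrt (1 - elmod * (sin \<phi>)\<^sup>2)))"
    by (simp add: elweight_def)
  then show ?thesis unfolding ellint_def ellK_def by (simp only: integral_mult_right)
qed

text \<open>The reciprocal of the zero of the Moebius map, hence the characteristic belonging to \<open>1 / s\<close>.\<close>
definition elchar2 :: real where "elchar2 = elchar * E1 X Y U / E2 X Y U"

lemma E1_nonneg: "E1 X Y U \<ge> 0" by (simp add: E1_def)

lemma elchar2_bounds: "0 \<le> elchar2" "elchar2 < 1"
proof -
  show "0 \<le> elchar2" using elchar_bounds E1_nonneg E2_pos by (simp add: elchar2_def)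
  have "elchar * E1 X Y U \<le> 1 * E1 X Y U" using elchar_bounds E1_nonneg by (intro mult_right_mono) auto
  also have "\<dots> < E2 X Y U" using e12 by simp
  finally show "elchar2 < 1" using E2_pos by (simp add: elchar2_def)
qed

text \<open>Partial fractions in the squared sine: s has its pole where 1 - \<open>elchar\<close>
  sin^2 vanishes, 1 / s where 1 - \<open>elchar2\<close> sin^2 does. The coefficient of
  \<open>ellK\<close> is the value of s + A + B + A B / s at s = E1, the image of infinity, which is
  why E1 must not be 0.\<close>

lemma ellint_Rxy:
  assumes "E1 X Y U > 0"
  defines "A \<equiv> Y\<^sup>2 - U\<^sup>2" and "B \<equiv> X\<^sup>2 - 1"
  shows "ellint (Rxy X Y U) X Y U = - (elscale / 2) *
    ((E1 X Y U + A + B + A * B / E1 X Y U) * ellK elmod + (E2 X Y U - E1 X Y U) * ellPi elchar elmod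
      - A * B * (E2 X Y U - E1 X Y U) / (E1 X Y U * E2 X Y U) * ellPi elchar2 elmod)"
proof -
  let ?e1 = "E1 X Y U" and ?e2 = "E2 X Y U"
  let ?k = "\<lambda>\<phi>. 1 / sqrt (1 - elmod * (sin \<phi>)\<^sup>2)"
  let ?p = "\<lambda>n \<phi>. 1 / (1 - n * (sin \<phi>)\<^sup>2) / sqrt (1 - elmod * (sin \<phi>)\<^sup>2)"
  let ?c0 = "?e1 + A + B + A * B / ?e1" and ?c1 = "?e2 - ?e1" and ?c2 = "A * B * (?e2 - ?e1) / (?e1 * ?e2)"
  have ck: "continuous_on {0..pi/2} ?k"
    using moebius_pos(2)[OF sin2_bounds] by (intro continuous_intros) (auto simp: less_le)
  have cp: "continuous_on {0..pi/2} (?p n)" if "0 \<le> n" "n < 1" for n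
    using moebius_pos(2)[OF sin2_bounds] denom_pos[OF that sin2_bounds] by (intro continuous_intros) (auto simp: less_le)
  have eq: "Rxy X Y U (moebius ((sin \<phi>)\<^sup>2)) * elweight \<phi> = - (elscale / 2) * (?c0 * ?k \<phi> + ?c1 * ?p elchar \<phi> - ?c2 * ?p elchar2 \<phi>)" for \<phi>
  proof -
    let ?\<sigma> = "(sin \<phi>)\<^sup>2"
    have D: "1 - elchar * ?\<sigma> > 0" "1 - elchar2 * ?\<sigma> > 0"
      using moebius_pos(1)[OF sin2_bounds, of \<phi>] denom_pos[OF elchar2_bounds sin2_bounds, of \<phi>] by auto
    have s: "moebius ?\<sigma> = ?e1 + ?c1 * (1 / (1 - elchar * ?\<sigma>))" by (simp add: moebius_def)
    have s2: "moebius ?\<sigma> = ?e2 * (1 - elchar2 * ?\<sigma>) / (1 - elchar * ?\<sigma>)"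
      using D(1) E2_pos by (simp add: moebius_def elchar2_def field_simps)
    have "1 / moebius ?\<sigma> = (1 - elchar * ?\<sigma>) / (?e2 * (1 - elchar2 * ?\<sigma>))"
      unfolding s2 by simp
    also have "1 - elchar * ?\<sigma> = ?e2 / ?e1 * (1 - elchar2 * ?\<sigma>) - (?e2 - ?e1) / ?e1"
      using assms(1) E2_pos by (simp add: elchar2_def field_simps)
    also have "(?e2 / ?e1 * (1 - elchar2 * ?\<sigma>) - (?e2 - ?e1) / ?e1) / (?e2 * (1 - elchar2 * ?\<sigma>))
       = 1 / ?e1 - (?e2 - ?e1) / (?e1 * ?e2) * (1 / (1 - elchar2 * ?\<sigma>))"
      using assms(1) E2_pos D(2) by (simp add: diff_divide_distrib)
    finally have inv: "1 / moebius ?\<sigma> = 1 / ?e1 - (?e2 - ?e1) / (?e1 * ?e2) * (1 / (1 - elchar2 * ?\<sigma>))" .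
    have mp: "moebius ?\<sigma> > 0" using moebius_range(1)[OF sin2_bounds, of \<phi>] E2_pos by linarith
    have "Rxy X Y U (moebius ?\<sigma>) = - (1/2) * (moebius ?\<sigma> + A + B + A * B * (1 / moebius ?\<sigma>))"
      using mp by (simp add: Rxy_def A_def B_def field_simps power2_eq_square)
    also have "moebius ?\<sigma> + A + B + A * B * (1 / moebius ?\<sigma>) = ?c0 + ?c1 * (1 / (1 - elchar * ?\<sigma>)) - ?c2 * (1 / (1 - elchar2 * ?\<sigma>))"
      unfolding inv unfolding s by (simp add: right_diff_distrib)
    finally have R: "Rxy X Y U (moebius ?\<sigma>) = - (1/2) * (?c0 + ?c1 * (1 / (1 - elchar * ?\<sigma>)) - ?c2 * (1 / (1 - elchar2 * ?\<sigma>)))" .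
    have elweight: "elweight \<phi> = elscale * ?k \<phi>" and p: "?p n \<phi> = 1 / (1 - n * ?\<sigma>) * ?k \<phi>" for n
      by (simp_all add: elweight_def)
    have "- (1/2) * (c0 + c1 * a - c2 * b) * (c * K) = - (c / 2) * (c0 * K + c1 * (a * K) - c2 * (b * K))"
      for c0 c1 c2 a b c K :: real by algebra
    then show ?thesis unfolding R elweight p .
  qed
  have i: "?k integrable_on {0..pi/2}" "?p elchar integrable_on {0..pi/2}" "?p elchar2 integrable_on {0..pi/2}"
    using elchar_bounds elchar2_bounds by (intro integrable_continuous_real ck cp; simp)+
  have "((\<lambda>\<phi>. - (elscale / 2) * (?c0 * ?k \<phi> + ?c1 * ?p elchar \<phi> - ?c2 * ?p elchar2 \<phi>)) has_integral
     - (elscale / 2) * (?c0 * ellK elmod + ?c1 * ellPi elchar elmod - ?c2 * ellPi elchar2 elmod)) {0..pi/2}"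
    unfolding ellK_def ellPi_def
    by (intro has_integral_mult_right has_integral_add has_integral_diff integrable_integral i)
  then show ?thesis
    unfolding ellint_def eq by (rule integral_unique)
qed

end

section \<open>Chambers\<close>

definition xi_poly :: "real \<Rightarrow> real \<Rightarrow> real \<Rightarrow> real" where
  "xi_poly X Y U = (1 + X + Y - U) * (1 + X - Y + U) * (1 - X + Y + U) * (- 1 + X + Y + U)"

text \<open>Its sign is the product of the three chamber signs; it is positive exactly in the
  chambers where \<open>gfun\<close> is 1 / (2 sqrt (X Y U)).\<close>

definition chamber_sign :: "real \<Rightarrow> real \<Rightarrow> real \<Rightarrow> real" where
  "chamber_sign X Y U = (1 + X - Y - U) * ((1 + Y - X - U) * (1 + U - X - Y))"

lemma xi_poly_swap: "xi_poly X Y U = xi_poly Y X U"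
  unfolding xi_poly_def by algebra

lemma chamber_sign_swap: "chamber_sign X Y U = chamber_sign Y X U"
  unfolding chamber_sign_def by algebra

lemma E_order:
  assumes "noncrit X Y U"
  shows "(1 + Y - X - U) * (1 + U - X - Y) > 0 \<Longrightarrow> E1 X Y U = (Y - U)\<^sup>2 \<and> E2 X Y U = (1 - X)\<^sup>2"
    and "(1 + Y - X - U) * (1 + U - X - Y) < 0 \<Longrightarrow> E1 X Y U = (1 - X)\<^sup>2 \<and> E2 X Y U = (Y - U)\<^sup>2"
    and "1 + X - Y - U > 0 \<Longrightarrow> E3 X Y U = (Y + U)\<^sup>2 \<and> E4 X Y U = (1 + X)\<^sup>2"
    and "1 + X - Y - U < 0 \<Longrightarrow> E3 X Y U = (1 + X)\<^sup>2 \<and> E4 X Y U = (Y + U)\<^sup>2"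
proof -
  have d1: "(1 - X)\<^sup>2 - (Y - U)\<^sup>2 = (1 + Y - X - U) * (1 + U - X - Y)" by algebra
  have d2: "(1 + X)\<^sup>2 - (Y + U)\<^sup>2 = (1 + X - Y - U) * (1 + X + Y + U)" by algebra
  have p: "1 + X + Y + U > 0" using assms by (auto simp: noncrit_def)
  show "E1 X Y U = (Y - U)\<^sup>2 \<and> E2 X Y U = (1 - X)\<^sup>2" if "(1 + Y - X - U) * (1 + U - X - Y) > 0"
    using that unfolding d1[symmetric] E1_def E2_def by linarith
  show "E1 X Y U = (1 - X)\<^sup>2 \<and> E2 X Y U = (Y - U)\<^sup>2" if "(1 + Y - X - U) * (1 + U - X - Y) < 0"
    using that unfolding d1[symmetric] E1_def E2_def by linarith
  show "E3 X Y U = (Y + U)\<^sup>2 \<and> E4 X Y U = (1 + X)\<^sup>2" if "1 + X - Y - U > 0"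
    using mult_pos_pos[OF that p] unfolding d2[symmetric] E3_def E4_def by linarith
  show "E3 X Y U = (1 + X)\<^sup>2 \<and> E4 X Y U = (Y + U)\<^sup>2" if "1 + X - Y - U < 0"
    using mult_neg_pos[OF that p] unfolding d2[symmetric] E3_def E4_def by linarith
qed

lemma chamber_factor_cases:
  assumes "noncrit X Y U"
  obtains "(1 + Y - X - U) * (1 + U - X - Y) > 0" "1 + X - Y - U > 0"
    | "(1 + Y - X - U) * (1 + U - X - Y) > 0" "1 + X - Y - U < 0"
    | "(1 + Y - X - U) * (1 + U - X - Y) < 0" "1 + X - Y - U < 0"
    | "(1 + Y - X - U) * (1 + U - X - Y) < 0" "1 + X - Y - U > 0"
proof -
  have "(1 + Y - X - U) * (1 + U - X - Y) \<noteq> 0" "1 + X - Y - U \<noteq> 0"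
    using assms by (auto simp: noncrit_def)
  then show ?thesis using that by (meson linorder_neqE_linordered_idom)
qed

text \<open>The differences join either branch points of the same kind, with product 4 Y U * 4 X, or
  of different kinds, with product \<open>xi_poly\<close>. The parity of the two order choices, that
  is \<open>chamber_sign\<close>, decides which pairing occurs.\<close>

lemma E_products:
  assumes nc: "noncrit X Y U"
  shows "(E3 X Y U - E1 X Y U) * (E4 X Y U - E2 X Y U) = (if chamber_sign X Y U > 0 then 16 * (X * Y * U) else xi_poly X Y U)"
    and "(E3 X Y U - E2 X Y U) * (E4 X Y U - E1 X Y U) = (if chamber_sign X Y U > 0 then xi_poly X Y U else 16 * (X * Y * U))"
proof -
  note E = E_order[OF nc]
  have i1: "((Y + U)\<^sup>2 - (Y - U)\<^sup>2) * ((1 + X)\<^sup>2 - (1 - X)\<^sup>2) = 16 * (X * Y * U)" by algebra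
  have i2: "((Y + U)\<^sup>2 - (1 - X)\<^sup>2) * ((1 + X)\<^sup>2 - (Y - U)\<^sup>2) = xi_poly X Y U" unfolding xi_poly_def by algebra
  note i = i1 i2 i1[unfolded mult.commute[of "(Y + U)\<^sup>2 - _"]] i2[unfolded mult.commute[of "(Y + U)\<^sup>2 - _"]]
  have "(E3 X Y U - E1 X Y U) * (E4 X Y U - E2 X Y U) = (if chamber_sign X Y U > 0 then 16 * (X * Y * U) else xi_poly X Y U)
     \<and> (E3 X Y U - E2 X Y U) * (E4 X Y U - E1 X Y U) = (if chamber_sign X Y U > 0 then xi_poly X Y U else 16 * (X * Y * U))"
  proof (cases rule: chamber_factor_cases[OF nc])
    case 1
    have s: "chamber_sign X Y U > 0" unfolding chamber_sign_def by (rule mult_pos_pos[OF 1(2,1)])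
    show ?thesis using E(1)[OF 1(1)] E(3)[OF 1(2)] by (simp only: if_P[OF s] i)
  next
    case 2
    have "chamber_sign X Y U < 0" unfolding chamber_sign_def by (rule mult_neg_pos[OF 2(2,1)])
    then have s: "\<not> chamber_sign X Y U > 0" by simp
    show ?thesis using E(1)[OF 2(1)] E(4)[OF 2(2)] by (simp only: if_not_P[OF s] i)
  next
    case 3
    have s: "chamber_sign X Y U > 0" unfolding chamber_sign_def by (rule mult_neg_neg[OF 3(2,1)])
    show ?thesis using E(2)[OF 3(1)] E(4)[OF 3(2)] by (simp only: if_P[OF s] i)
  next
    case 4
    have "chamber_sign X Y U < 0" unfolding chamber_sign_def by (rule mult_pos_neg[OF 4(2,1)])
    then have s: "\<not> chamber_sign X Y U > 0" by simp
    show ?thesis using E(2)[OF 4(1)] E(3)[OF 4(2)] by (simp only: if_not_P[OF s] i)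
  qed
  then show "(E3 X Y U - E1 X Y U) * (E4 X Y U - E2 X Y U) = (if chamber_sign X Y U > 0 then 16 * (X * Y * U) else xi_poly X Y U)"
    and "(E3 X Y U - E2 X Y U) * (E4 X Y U - E1 X Y U) = (if chamber_sign X Y U > 0 then xi_poly X Y U else 16 * (X * Y * U))"
    by blast+
qed

text \<open>The eight sign patterns collapse to two binary choices: the product of the last two
  signs orders the lower pair of branch points, the first sign orders the upper pair.\<close>

lemma chamber_case_eq:
  assumes nc: "noncrit (exp x) (exp y) (exp u)"
  shows "chamber_case (x, y, u) A B C D =
    (if (1 + exp y - exp x - exp u) * (1 + exp u - exp x - exp y) > 0
     then (if 1 + exp x - exp y - exp u > 0 then A else B)
     else (if 1 + exp x - exp y - exp u > 0 then D else C))"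
proof -
  define a b c where abc: "a = 1 + exp x - exp y - exp u" "b = 1 + exp y - exp x - exp u" "c = 1 + exp u - exp x - exp y"
  have nz: "a \<noteq> 0" "b \<noteq> 0" "c \<noteq> 0" using nc by (auto simp: noncrit_def abc)
  then have s: "sgn a = (if a > 0 then 1 else -1)" "sgn b = (if b > 0 then 1 else -1)" "sgn c = (if c > 0 then 1 else -1)"
    by (auto simp: sgn_real_def)
  have bc: "b * c > 0 \<longleftrightarrow> (b > 0) = (c > 0)" using nz by (auto simp: zero_less_mult_iff)
  show ?thesis
    unfolding chamber_case_def chamber_def prod.case abc[symmetric] s bc
    by (cases "a > 0"; cases "b > 0"; cases "c > 0"; simp)
qed

lemma gfun_ksq_eq:
  assumes nc: "noncrit (exp x) (exp y) (exp u)"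
  defines "X \<equiv> exp x" and "Y \<equiv> exp y" and "U \<equiv> exp u"
  shows "gfun (x, y, u) = 2 / sqrt ((E3 X Y U - E1 X Y U) * (E4 X Y U - E2 X Y U))"
    and "ksq (x, y, u) = (E3 X Y U - E2 X Y U) * (E4 X Y U - E1 X Y U) / ((E3 X Y U - E1 X Y U) * (E4 X Y U - E2 X Y U))"
proof -
  have xi: "xi (x, y, u) = xi_poly X Y U" by (simp add: xi_def xi_poly_def X_def Y_def U_def)
  have e: "exp (x + y + u) = X * Y * U" by (simp add: X_def Y_def U_def exp_add)
  have pos: "X > 0" "Y > 0" "U > 0" by (simp_all add: X_def Y_def U_def)
  have nc': "noncrit X Y U" using nc by (simp add: X_def Y_def U_def)
  have cs: "chamber_case (x, y, u) A B A B = (if chamber_sign X Y U > 0 then A else B)" for A B :: real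
    unfolding chamber_case_eq[OF nc, folded X_def Y_def U_def]
  proof (cases rule: chamber_factor_cases[OF nc'])
  qed (auto simp: chamber_sign_def zero_less_mult_iff[of "1 + X - Y - U"])
  have cmod_sq: "2 / sqrt (16 * m) = 1 / (2 * sqrt m)" for m :: real
    by (simp add: real_sqrt_mult)
  show "gfun (x, y, u) = 2 / sqrt ((E3 X Y U - E1 X Y U) * (E4 X Y U - E2 X Y U))"
    unfolding gfun_def prod.case xi e E_products[OF nc'] cs
    by (cases "chamber_sign X Y U > 0") (simp_all only: if_True if_False cmod_sq)
  show "ksq (x, y, u) = (E3 X Y U - E2 X Y U) * (E4 X Y U - E1 X Y U) / ((E3 X Y U - E1 X Y U) * (E4 X Y U - E2 X Y U))"
    unfolding ksq_def prod.case xi e E_products[OF nc'] cs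
    by (cases "chamber_sign X Y U > 0") (simp_all only: if_True if_False)
qed

text \<open>Both functions depend only on \<open>xi_poly\<close>, the product X Y U and
  \<open>chamber_sign\<close>, all symmetric in X and Y. The second x-derivative needs this, since
  it is computed with the two variables exchanged.\<close>

lemma gfun_ksq_swap:
  assumes nc: "noncrit (exp x) (exp y) (exp u)"
  shows "gfun (y, x, u) = gfun (x, y, u)" "ksq (y, x, u) = ksq (x, y, u)"
  using gfun_ksq_eq[OF nc] gfun_ksq_eq[OF nc[unfolded noncrit_swap[of "exp x"]]]
    E_products[OF nc] E_products[OF nc[unfolded noncrit_swap[of "exp x"]]]
    xi_poly_swap[of "exp x" "exp y" "exp u"] chamber_sign_swap[of "exp x" "exp y" "exp u"]
  by (simp_all only: mult.commute[of "exp y" "exp x"])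

text \<open>In every order of the branch points the chamber functions are the characteristics and
  coefficients of \<open>ellint_Rxy\<close>. Regularity enters through positivity of the lowest
  branch point.\<close>

lemma Q_alpha_eq:
  assumes nc: "noncrit (exp x) (exp y) (exp u)" and reg: "(x, y, u) \<in> regular_pts"
  defines "X \<equiv> exp x" and "Y \<equiv> exp y" and "U \<equiv> exp u"
  shows "E1 X Y U > 0"
    and "alpha1sq (x, y, u) = (E3 X Y U - E2 X Y U) / (E3 X Y U - E1 X Y U)"
    and "alpha2sq (x, y, u) = (E3 X Y U - E2 X Y U) / (E3 X Y U - E1 X Y U) * E1 X Y U / E2 X Y U"
    and "Q1 (x, y, u) = E1 X Y U + (Y\<^sup>2 - U\<^sup>2) + (X\<^sup>2 - 1) + (Y\<^sup>2 - U\<^sup>2) * (X\<^sup>2 - 1) / E1 X Y U"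
    and "Q2 (x, y, u) = E2 X Y U - E1 X Y U"
    and "Q3 (x, y, u) = - ((Y\<^sup>2 - U\<^sup>2) * (X\<^sup>2 - 1) * (E2 X Y U - E1 X Y U) / (E1 X Y U * E2 X Y U))"
proof -
  have nc': "noncrit X Y U" using nc by (simp add: X_def Y_def U_def)
  have r: "X - 1 \<noteq> 0" "Y - U \<noteq> 0" using reg by (auto simp: regular_pts_def X_def Y_def U_def)
  have pos: "X > 0" "Y > 0" "U > 0" by (simp_all add: X_def Y_def U_def)
  have e: "exp (2 * x) = X\<^sup>2" "exp (2 * y) = Y\<^sup>2" "exp (2 * u) = U\<^sup>2" "exp (y + u) = Y * U"
    by (simp_all add: X_def Y_def U_def exp_add exp_double)
  note chc = chamber_case_eq[OF nc, folded X_def Y_def U_def]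
  note E = E_order[OF nc']
  have X1: "(1 - X)\<^sup>2 \<noteq> 0" "(Y - U)\<^sup>2 \<noteq> 0" using r by auto
  show "E1 X Y U > 0" using r by (simp add: E1_def)
  have A1: "(Y + U)\<^sup>2 - (Y - U)\<^sup>2 = 4 * (Y * U)" "(1 + X)\<^sup>2 - (1 - X)\<^sup>2 = 4 * X"
    "(Y + U)\<^sup>2 - (1 - X)\<^sup>2 = (1 - X + Y + U) * (- 1 + X + Y + U)"
    "(1 + X)\<^sup>2 - (Y - U)\<^sup>2 = (1 + X + Y - U) * (1 + X - Y + U)"
    "(1 - X)\<^sup>2 - (Y - U)\<^sup>2 = (1 - X + Y - U) * (1 - X - Y + U)"
    by algebra+
  have frac: "a / b = c / d" if "a * d = c * b" "b \<noteq> 0" "d \<noteq> 0" for a b c d :: real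
    using that by (simp add: frac_eq_eq)
  have comb: "a + b / d = (a * d + b) / d" if "d \<noteq> 0" for a b d :: real
    using that by (simp add: field_simps)
  note D = alpha1sq_def alpha2sq_def Q1_def Q2_def Q3_def Q3_base_def
  \<comment> \<open>When the lowest branch point is (Y - U)^2, one factor Y - U of Y^2 - U^2 cancels
    and a simple pole remains; \<open>q1b\<close> is the same computation for (1 - X)^2 and X^2 -
    1.\<close>
  have q1a: "2 * (Y * (X\<^sup>2 + Y\<^sup>2 + U\<^sup>2 - 1 - 2 * (Y * U)) / (Y - U)) = (Y - U)\<^sup>2 + (Y\<^sup>2 - U\<^sup>2) + (X\<^sup>2 - 1) + (Y\<^sup>2 - U\<^sup>2) * (X\<^sup>2 - 1) / (Y - U)\<^sup>2"
  proof -
    have "(Y\<^sup>2 - U\<^sup>2) * (X\<^sup>2 - 1) / (Y - U)\<^sup>2 = (Y + U) * (X\<^sup>2 - 1) / (Y - U)"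
      by (rule frac, algebra) (use r X1 in auto)
    moreover have "2 * (Y * (X\<^sup>2 + Y\<^sup>2 + U\<^sup>2 - 1 - 2 * (Y * U)) / (Y - U)) = ((Y - U)\<^sup>2 + (Y\<^sup>2 - U\<^sup>2) + (X\<^sup>2 - 1)) + (Y + U) * (X\<^sup>2 - 1) / (Y - U)"
    proof -
      have "((Y - U)\<^sup>2 + (Y\<^sup>2 - U\<^sup>2) + (X\<^sup>2 - 1)) + (Y + U) * (X\<^sup>2 - 1) / (Y - U) =
         (((Y - U)\<^sup>2 + (Y\<^sup>2 - U\<^sup>2) + (X\<^sup>2 - 1)) * (Y - U) + (Y + U) * (X\<^sup>2 - 1)) / (Y - U)"
        by (rule comb[OF r(2)])
      also have "((Y - U)\<^sup>2 + (Y\<^sup>2 - U\<^sup>2) + (X\<^sup>2 - 1)) * (Y - U) + (Y + U) * (X\<^sup>2 - 1) = 2 * (Y * (X\<^sup>2 + Y\<^sup>2 + U\<^sup>2 - 1 - 2 * (Y * U)))"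
        by algebra
      finally show ?thesis by simp
    qed
    ultimately show ?thesis by simp
  qed
  have q1b: "2 * (X * (X\<^sup>2 + Y\<^sup>2 - U\<^sup>2 + 1 - 2 * X) / (X - 1)) = (1 - X)\<^sup>2 + (Y\<^sup>2 - U\<^sup>2) + (X\<^sup>2 - 1) + (Y\<^sup>2 - U\<^sup>2) * (X\<^sup>2 - 1) / (1 - X)\<^sup>2"
  proof -
    have "(Y\<^sup>2 - U\<^sup>2) * (X\<^sup>2 - 1) / (1 - X)\<^sup>2 = (Y\<^sup>2 - U\<^sup>2) * (X + 1) / (X - 1)"
      by (rule frac, algebra) (use r X1 in auto)
    moreover have "2 * (X * (X\<^sup>2 + Y\<^sup>2 - U\<^sup>2 + 1 - 2 * X) / (X - 1)) = ((1 - X)\<^sup>2 + (Y\<^sup>2 - U\<^sup>2) + (X\<^sup>2 - 1)) + (Y\<^sup>2 - U\<^sup>2) * (X + 1) / (X - 1)"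
    proof -
      have "((1 - X)\<^sup>2 + (Y\<^sup>2 - U\<^sup>2) + (X\<^sup>2 - 1)) + (Y\<^sup>2 - U\<^sup>2) * (X + 1) / (X - 1) =
         (((1 - X)\<^sup>2 + (Y\<^sup>2 - U\<^sup>2) + (X\<^sup>2 - 1)) * (X - 1) + (Y\<^sup>2 - U\<^sup>2) * (X + 1)) / (X - 1)"
        by (rule comb[OF r(1)])
      also have "((1 - X)\<^sup>2 + (Y\<^sup>2 - U\<^sup>2) + (X\<^sup>2 - 1)) * (X - 1) + (Y\<^sup>2 - U\<^sup>2) * (X + 1) = 2 * (X * (X\<^sup>2 + Y\<^sup>2 - U\<^sup>2 + 1 - 2 * X))"
        by algebra
      finally show ?thesis by simp
    qed
    ultimately show ?thesis by simp
  qed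
  have q1c: "- 2 * (X * (X\<^sup>2 + Y\<^sup>2 - U\<^sup>2 + 1 - 2 * X) / (1 - X)) = 2 * (X * (X\<^sup>2 + Y\<^sup>2 - U\<^sup>2 + 1 - 2 * X) / (X - 1))"
  proof -
    have "1 - X = - (X - 1)" by simp
    then show ?thesis by (simp only: divide_minus_right)
  qed
  have F: "Y\<^sup>2 - U\<^sup>2 = (U + Y) * (Y - U)" "X\<^sup>2 - 1 = (1 + X) * (X - 1)" "U - Y = - (Y - U)" "(1 - X)\<^sup>2 = (X - 1)\<^sup>2"
    by algebra+
  have gen: "s * p * t * q / (- d * m) = - (s * d * (t * m) * (p * q) / (d\<^sup>2 * m\<^sup>2))" if "m \<noteq> 0" "d \<noteq> 0" for s p t q d m :: real
    using that by (simp add: field_simps power2_eq_square)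
  have q3: "(U + Y) * (1 - X + Y - U) * (1 + X) * (1 - X - Y + U) / ((U - Y) * (X - 1))
     = - ((Y\<^sup>2 - U\<^sup>2) * (X\<^sup>2 - 1) * ((1 - X)\<^sup>2 - (Y - U)\<^sup>2) / ((Y - U)\<^sup>2 * (1 - X)\<^sup>2))"
    unfolding A1(5) unfolding F using gen[OF r(1,2)] .
  have q3': "- ((U + Y) * (1 - X + Y - U) * (1 + X) * (1 - X - Y + U) / ((U - Y) * (X - 1)))
     = - ((Y\<^sup>2 - U\<^sup>2) * (X\<^sup>2 - 1) * ((Y - U)\<^sup>2 - (1 - X)\<^sup>2) / ((1 - X)\<^sup>2 * (Y - U)\<^sup>2))"
  proof -
    have "(Y - U)\<^sup>2 - (1 - X)\<^sup>2 = - ((1 - X + Y - U) * (1 - X - Y + U))" unfolding A1(5)[symmetric] by simp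
    then show ?thesis unfolding q3 A1(5) by (simp add: mult.commute)
  qed
  have A1r: "(Y - U)\<^sup>2 - (1 - X)\<^sup>2 = - ((1 - X + Y - U) * (1 - X - Y + U))" unfolding A1(5)[symmetric] by simp
  have sw: "(X - 1)\<^sup>2 = (1 - X)\<^sup>2" by algebra
  have neq: "\<not> b > 0" if "b < 0" for b :: real using that by simp
  have "alpha1sq (x, y, u) = (E3 X Y U - E2 X Y U) / (E3 X Y U - E1 X Y U)
    \<and> alpha2sq (x, y, u) = (E3 X Y U - E2 X Y U) / (E3 X Y U - E1 X Y U) * E1 X Y U / E2 X Y U
    \<and> Q1 (x, y, u) = E1 X Y U + (Y\<^sup>2 - U\<^sup>2) + (X\<^sup>2 - 1) + (Y\<^sup>2 - U\<^sup>2) * (X\<^sup>2 - 1) / E1 X Y U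
    \<and> Q2 (x, y, u) = E2 X Y U - E1 X Y U
    \<and> Q3 (x, y, u) = - ((Y\<^sup>2 - U\<^sup>2) * (X\<^sup>2 - 1) * (E2 X Y U - E1 X Y U) / (E1 X Y U * E2 X Y U))"
  proof (cases rule: chamber_factor_cases[OF nc'])
    case 1
    show ?thesis
      unfolding D prod.case chc e X_def[symmetric] Y_def[symmetric] U_def[symmetric] if_P[OF 1(1)] if_P[OF 1(2)]
        E(1)[OF 1(1), THEN conjunct1] E(1)[OF 1(1), THEN conjunct2] E(3)[OF 1(2), THEN conjunct1] E(3)[OF 1(2), THEN conjunct2]
        q1a q3 by (simp add: A1)
  next
    case 2
    show ?thesis
      unfolding D prod.case chc e X_def[symmetric] Y_def[symmetric] U_def[symmetric] if_P[OF 2(1)] if_not_P[OF neq[OF 2(2)]]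
        E(1)[OF 2(1), THEN conjunct1] E(1)[OF 2(1), THEN conjunct2] E(4)[OF 2(2), THEN conjunct1] E(4)[OF 2(2), THEN conjunct2]
        q1a q3 by (simp add: A1)
  next
    case 3
    show ?thesis
      unfolding D prod.case chc e X_def[symmetric] Y_def[symmetric] U_def[symmetric] if_not_P[OF neq[OF 3(1)]] if_not_P[OF neq[OF 3(2)]]
        E(2)[OF 3(1), THEN conjunct1] E(2)[OF 3(1), THEN conjunct2] E(4)[OF 3(2), THEN conjunct1] E(4)[OF 3(2), THEN conjunct2]
        q1b q3' sw by (simp add: A1 A1r)
  next
    case 4
    show ?thesis
      unfolding D prod.case chc e X_def[symmetric] Y_def[symmetric] U_def[symmetric] if_not_P[OF neq[OF 4(1)]] if_P[OF 4(2)]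
        E(2)[OF 4(1), THEN conjunct1] E(2)[OF 4(1), THEN conjunct2] E(3)[OF 4(2), THEN conjunct1] E(3)[OF 4(2), THEN conjunct2]
        q1c q1b q3' sw by (simp add: A1 A1r)
  qed
  then show "alpha1sq (x, y, u) = (E3 X Y U - E2 X Y U) / (E3 X Y U - E1 X Y U)"
    and "alpha2sq (x, y, u) = (E3 X Y U - E2 X Y U) / (E3 X Y U - E1 X Y U) * E1 X Y U / E2 X Y U"
    and "Q1 (x, y, u) = E1 X Y U + (Y\<^sup>2 - U\<^sup>2) + (X\<^sup>2 - 1) + (Y\<^sup>2 - U\<^sup>2) * (X\<^sup>2 - 1) / E1 X Y U"
    and "Q2 (x, y, u) = E2 X Y U - E1 X Y U"
    and "Q3 (x, y, u) = - ((Y\<^sup>2 - U\<^sup>2) * (X\<^sup>2 - 1) * (E2 X Y U - E1 X Y U) / (E1 X Y U * E2 X Y U))"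
    by blast+
qed


section \<open>The hypergeometric formulas at a point\<close>

lemma Phi_formula_xy:
  assumes nc: "noncrit (exp x) (exp y) (exp u)" and reg: "(x, y, u) \<in> regular_pts"
  defines "q \<equiv> (x, y, u)"
  shows "- of_real (gfun q / 4) * (of_real (Q1 q) * Phi1 (of_real (ksq q)) +
      of_real (Q2 q) * Phi2 (of_real (alpha1sq q)) (of_real (ksq q)) +
      of_real (Q3 q) * Phi2 (of_real (alpha2sq q)) (of_real (ksq q))) =
    complex_of_real (ellint (Rxy (exp x) (exp y) (exp u)) (exp x) (exp y) (exp u) / pi\<^sup>2)"
proof -
  interpret quartic_XYU "exp x" "exp y" "exp u" by (rule noncrit_quartic[OF nc])
  note Q = Q_alpha_eq[OF nc reg, folded q_def]
  have g: "gfun q = elscale" "ksq q = elmod" using gfun_ksq_eq[OF nc] by (simp_all add: q_def elscale_def elmod_alt)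
  have a: "alpha1sq q = elchar" "alpha2sq q = elchar2" by (simp_all add: Q elchar_def elchar2_def)
  have n2: "elchar2 > 0" using Q(1) elchar_bounds E2_pos by (simp add: elchar2_def)
  have P: "Phi1 (of_real elmod) = of_real (2 / pi\<^sup>2 * ellK elmod)"
    "Phi2 (of_real elchar) (of_real elmod) = of_real (2 / pi\<^sup>2 * ellPi elchar elmod)"
    "Phi2 (of_real elchar2) (of_real elmod) = of_real (2 / pi\<^sup>2 * ellPi elchar2 elmod)"
    using Phi1_eq[OF elmod_bounds] Phi2_eq[OF elchar_bounds elmod_bounds] Phi2_eq[OF n2 elchar2_bounds(2) elmod_bounds] by simp_all
  have alg: "- (c / 4) * (a1 * (2 / p * K) + a2 * (2 / p * P1) + - a3 * (2 / p * P2)) = - (c / 2) * (a1 * K + a2 * P1 - a3 * P2) / p"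
    for c p K P1 P2 a1 a2 a3 :: real
  proof -
    have "- (c / 4) * (a1 * (2 * r * K) + a2 * (2 * r * P1) + - a3 * (2 * r * P2)) = - (c / 2) * (a1 * K + a2 * P1 - a3 * P2) * r" for r :: real
      by algebra
    from this[of "1 / p"] show ?thesis by simp
  qed
  show ?thesis
    unfolding g a P ellint_Rxy[OF Q(1)] Q(4,5,6) alg[symmetric]
    by (simp only: of_real_mult of_real_add of_real_minus)
qed

text \<open>The quartic here is that of (Y, X, U), with X as threshold. No partial fractions occur,
  so no regularity of the point is required.\<close>

lemma Phi_formula_xx:
  assumes nc: "noncrit (exp x) (exp y) (exp u)"
  shows "of_real (gfun (x, y, u) * exp (2 * x)) * Phi1 (of_real (ksq (x, y, u))) =
    complex_of_real (ellint (\<lambda>s. 2 * (exp x)\<^sup>2) (exp y) (exp x) (exp u) / pi\<^sup>2)"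
proof -
  have nc': "noncrit (exp y) (exp x) (exp u)" using nc noncrit_swap by blast
  interpret quartic_XYU "exp y" "exp x" "exp u" by (rule noncrit_quartic[OF nc'])
  have g: "gfun (x, y, u) = elscale" "ksq (x, y, u) = elmod"
    using gfun_ksq_eq[OF nc'] gfun_ksq_swap[OF nc] by (simp_all add: elscale_def elmod_alt)
  show ?thesis
    unfolding g Phi1_eq[OF elmod_bounds] ellint_const of_real_mult[symmetric]
    by (simp add: exp_double)
qed

section \<open>Partial derivatives and the continuous extension\<close>

lemma pderiv_e_x:
  assumes "((\<lambda>t. F (t, y, u)) has_real_derivative D) (at x)"
  shows "pdiff e_x F (x, y, u)" "pderiv_dir e_x F (x, y, u) = D"
proof -
  have "((\<lambda>h. F ((x, y, u) + h *\<^sub>R e_x)) has_real_derivative D) (at 0)"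
    using assms DERIV_shift[of "\<lambda>t. F (t, y, u)" D 0 x] by (simp add: add.commute)
  then show "pdiff e_x F (x, y, u)" "pderiv_dir e_x F (x, y, u) = D"
    unfolding pdiff_def pderiv_dir_def field_differentiable_def by (auto intro: DERIV_imp_deriv)
qed

lemma pderiv_e_y:
  assumes "((\<lambda>t. F (x, t, u)) has_real_derivative D) (at y)"
  shows "pdiff e_y F (x, y, u)" "pderiv_dir e_y F (x, y, u) = D"
proof -
  have "((\<lambda>h. F ((x, y, u) + h *\<^sub>R e_y)) has_real_derivative D) (at 0)"
    using assms DERIV_shift[of "\<lambda>t. F (x, t, u)" D 0 y] by (simp add: add.commute)
  then show "pdiff e_y F (x, y, u)" "pderiv_dir e_y F (x, y, u) = D"
    unfolding pdiff_def pderiv_dir_def field_differentiable_def by (auto intro: DERIV_imp_deriv)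
qed

lemma Ronkin_first_derivs:
  "pdiff e_x (Ronkin lin3) q" "pderiv_dir e_x (Ronkin lin3) = (\<lambda>(x, y, u). prob3 (exp x) (exp y) (exp u))"
  "pdiff e_y (Ronkin lin3) q" "pderiv_dir e_y (Ronkin lin3) = (\<lambda>(x, y, u). prob3 (exp y) (exp x) (exp u))"
proof -
  obtain x y u where q: "q = (x, y, u)" by (cases q)
  show "pdiff e_x (Ronkin lin3) q" "pdiff e_y (Ronkin lin3) q"
    unfolding q by (rule pderiv_e_x[OF Ronkin_deriv(1)] pderiv_e_y[OF Ronkin_deriv(2)])+
  show "pderiv_dir e_x (Ronkin lin3) = (\<lambda>(x, y, u). prob3 (exp x) (exp y) (exp u))"
    using pderiv_e_x(2)[OF Ronkin_deriv(1)] by (intro ext) auto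
  show "pderiv_dir e_y (Ronkin lin3) = (\<lambda>(x, y, u). prob3 (exp y) (exp x) (exp u))"
    using pderiv_e_y(2)[OF Ronkin_deriv(2)] by (intro ext) auto
qed

text \<open>Holds on all noncritical points, including those where the lowest branch point is 0:
  \<open>Rxy\<close> has its only singularity at s = 0, while s stays above the positive second
  branch point.\<close>

lemma continuous_on_Dxy:
  "continuous_on {(x, y, u). noncrit (exp x) (exp y) (exp u)}
     (\<lambda>(x, y, u). ellint (Rxy (exp x) (exp y) (exp u)) (exp x) (exp y) (exp u) / pi\<^sup>2)"
proof -
  let ?S = "{(x, y, u). noncrit (exp x) (exp y) (exp u)}"
  have "continuous_on ?S (\<lambda>p. ellint (Rxy (exp (fst p)) (exp (fst (snd p))) (exp (snd (snd p))))
     (exp (fst p)) (exp (fst (snd p))) (exp (snd (snd p))))"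
  proof (rule continuous_on_ellint)
    show "quartic_XYU (exp (fst p)) (exp (fst (snd p))) (exp (snd (snd p)))" if "p \<in> ?S" for p
      using that by (auto intro: noncrit_quartic)
    show "continuous_on (?S \<times> {0<..}) (\<lambda>(p, s). Rxy (exp (fst p)) (exp (fst (snd p))) (exp (snd (snd p))) s)"
      unfolding case_prod_unfold Rxy_def by (intro continuous_intros) auto
  qed (intro continuous_intros)+
  then show ?thesis
    unfolding case_prod_unfold by (intro continuous_intros) (auto simp: case_prod_unfold)
qed

theorem proposition3p11:
  fixes f :: "complex \<times> complex \<times> complex \<Rightarrow> complex"
    and \<gamma>1 \<gamma>2 :: "complex list" and B1 B2 :: "int list list"
    and \<Phi> :: "complex \<Rightarrow> complex" and \<Phi>t :: "complex \<Rightarrow> complex \<Rightarrow> complex"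
    and x y u :: real
  defines "f \<equiv> \<lambda>(z, w, t). 1 + z + w + t"
    and "\<gamma>1 \<equiv> [-1/2, -1/2, 0]"
    and "\<gamma>2 \<equiv> [-1, 0, -1/2, -1/2]"
    and "B1 \<equiv> [[-1], [-1], [1], [1]]"
    and "B2 \<equiv> [[-1, 0], [1, 1], [0, -1], [-1, -1], [1, 0], [0, 1]]"
    and "\<Phi> \<equiv> \<lambda>z. hyp_Phi \<gamma>1 B1 [1, 1, 1, z]"
    and "\<Phi>t \<equiv> \<lambda>z1 z2. hyp_Phi_tilde \<gamma>2 B2 [1, 1, 1, 1, z1, z2]"
  assumes "(x, y, u) \<in> amoeba f - contour f"
  shows "pdiff2 e_x e_x (Ronkin f) (x, y, u) \<and>
         complex_of_real (pderiv_dir e_x (pderiv_dir e_x (Ronkin f)) (x, y, u))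
           = of_real (gfun (x, y, u) * exp (2 * x)) * \<Phi> (of_real (ksq (x, y, u))) \<and>
         pdiff2 e_x e_y (Ronkin f) (x, y, u) \<and>
         extends_to
           (\<lambda>q. - of_real (gfun q / 4) *
              (of_real (Q1 q) * \<Phi> (of_real (ksq q))
               + of_real (Q2 q) * \<Phi>t (of_real (alpha1sq q)) (of_real (ksq q))
               + of_real (Q3 q) * \<Phi>t (of_real (alpha2sq q)) (of_real (ksq q))))
           regular_pts (x, y, u)
           (complex_of_real (pderiv_dir e_x (pderiv_dir e_y (Ronkin f)) (x, y, u)))"
proof -
  let ?S = "{(x, y, u). noncrit (exp x) (exp y) (exp u)}"
  let ?D = "\<lambda>(x, y, u). ellint (Rxy (exp x) (exp y) (exp u)) (exp x) (exp y) (exp u) / pi\<^sup>2"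
  let ?F = "\<lambda>q. - of_real (gfun q / 4) *
              (of_real (Q1 q) * \<Phi> (of_real (ksq q))
               + of_real (Q2 q) * \<Phi>t (of_real (alpha1sq q)) (of_real (ksq q))
               + of_real (Q3 q) * \<Phi>t (of_real (alpha2sq q)) (of_real (ksq q)))"
  have nc: "noncrit (exp x) (exp y) (exp u)"
    by (rule noncrit_amoeba) (use assms(8) in \<open>simp add: f_def\<close>)
  have P: "\<Phi> = Phi1" "\<Phi>t = Phi2"
    by (simp_all add: \<Phi>_def \<Phi>t_def \<gamma>1_def \<gamma>2_def B1_def B2_def)
  have nc': "noncrit (exp y) (exp x) (exp u)" using nc noncrit_swap by blast
  note dxx = pderiv_e_x[where F="\<lambda>(x, y, u). prob3 (exp x) (exp y) (exp u)", unfolded prod.case,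
      OF prob3_deriv_1[OF nc']]
  note dxy = pderiv_e_x[where F="\<lambda>(x, y, u). prob3 (exp y) (exp x) (exp u)", unfolded prod.case,
      OF prob3_deriv_2[OF nc]]
  have F: "?F q = of_real (?D q)" if "q \<in> ?S" "q \<in> regular_pts" for q
    using that Phi_formula_xy unfolding P by (cases q) auto
  have "extends_to ?F regular_pts (x, y, u) (of_real (?D (x, y, u)))"
  proof (cases "(x, y, u) \<in> regular_pts")
    case True
    then show ?thesis using F[of "(x, y, u)"] nc by (simp add: extends_to_def)
  next
    case False
    have "isCont ?D (x, y, u)"
      \<comment> \<open>The exceptional point is an interior point of the noncritical set, so the
        integral is continuous there; at regular points nearby it equals the closed formula, whose
        limit is therefore the derivative.\<close>
      by (rule continuous_on_interior[OF continuous_on_Dxy])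
        (use nc in \<open>simp add: interior_open[OF open_noncrit_exp]\<close>)
    then have "(?D \<longlongrightarrow> ?D (x, y, u)) (at (x, y, u) within regular_pts)"
      using continuous_at_imp_continuous_at_within continuous_within by blast
    then have "((\<lambda>q. complex_of_real (?D q)) \<longlongrightarrow> of_real (?D (x, y, u))) (at (x, y, u) within regular_pts)"
      by (rule tendsto_of_real)
    moreover have "eventually (\<lambda>q. complex_of_real (?D q) = ?F q) (at (x, y, u) within regular_pts)"
    proof -
      have "eventually (\<lambda>q. q \<in> ?S) (at (x, y, u) within regular_pts)"
        by (rule eventually_at_in_open'[THEN filter_leD[OF at_le[OF subset_UNIV]], OF open_noncrit_exp]) (use nc in simp)
      moreover have "eventually (\<lambda>q. q \<in> regular_pts) (at (x, y, u) within regular_pts)"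
        by (simp add: eventually_at_filter)
      ultimately show ?thesis by eventually_elim (rule F[symmetric])
    qed
    ultimately have "(?F \<longlongrightarrow> of_real (?D (x, y, u))) (at (x, y, u) within regular_pts)"
      by (rule Lim_transform_eventually)
    then show ?thesis using False by (simp add: extends_to_def)
  qed
  then show ?thesis
    unfolding f_def pdiff2_def Ronkin_first_derivs(2,4) dxx(2) dxy(2) P Phi_formula_xx[OF nc] prod.case
    using dxx(1) dxy(1) Ronkin_first_derivs(1,3) by (intro conjI always_eventually allI refl)
qed

end
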